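(* The \textsc{$3$-terminal cut} problem can be solved in time $1.36^k\cdot n^{O(1)}$. More generally, for every $p\ge 3$, the \textsc{$p$-terminal cut} problem can be solved in time $1.84^{(p-2)k/(p-1)}\cdot n^{O(1)}$.
   Context: \textsc{$p$-terminal cut} is the following problem: the input is a simple undirected graph $G=(V,E)$ with $n=|V|$, a weight function $w:E\to\mathbb{N}$ assigning each edge a positive integer weight, a set $T=\{t_1,\dots,t_p\}$ of exactly $p$ distinct vertices called terminals, and a nonnegative integer $k$. A multiterminal cut for $T$ is a partition $\{V_1,\dots,V_p\}$ of $V$ with $t_i\in V_i$ for each $1\le i\le p$; its size is the total weight of the edges whose two ends lie in different parts. The task is to either output a multiterminal cut for $T$ of size at most $k$, or correctly report that none exists. *)

theory Defs
  imports Complex_Main "HOL-Library.Disjoint_Sets"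
begin

section \<open>Model of computation\<close>

text \<open>
  Algorithms are programs of a first-order, call-by-value, recursive functional language over
  pairs and natural-number atoms (pure Lisp). Every expression evaluation step costs one unit.
  Values are shared pointers, atoms carry only addition, truncated subtraction and comparison
  (no multiplication), and there is no deep equality test. A program has a fixed number of
  functions, each with a fixed number of local variables. Hence one step takes a constant number
  of instructions on the usual unit-cost random access machine with addition and subtraction,
  so that every time bound in this model is, up to a constant factor, a RAM time bound.
\<close>

datatype data = Atom nat | Cell data data

datatype exp =
    Arg nat
  | Lit nat
  | Add exp exp
  | Sub exp exp
  | IfLess exp exp exp exp
  | MkPair exp exp
  | First exp
  | Second exp
  | IfPair exp exp exp
  | LetIn exp exp
  | Call nat "exp list"

text \<open>
  The function called by \<open>Call f\<close> has as its body the \<open>f\<close>-th entry of the program.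
\<close>

type_synonym program = "exp list"

text \<open>
  \<open>eval P env e v t\<close>: with local variables \<open>env\<close>, the expression \<open>e\<close> evaluates to \<open>v\<close> in \<open>t\<close> steps.
  Run-time errors and non-termination both show up as the absence of a derivation.
\<close>

inductive eval :: "program \<Rightarrow> data list \<Rightarrow> exp \<Rightarrow> data \<Rightarrow> nat \<Rightarrow> bool"
  and evals :: "program \<Rightarrow> data list \<Rightarrow> exp list \<Rightarrow> data list \<Rightarrow> nat \<Rightarrow> bool"
  for P :: program where
  Arg: "i < length env \<Longrightarrow> eval P env (Arg i) (env ! i) 1"
| Lit: "eval P env (Lit m) (Atom m) 1"
| Add: "\<lbrakk>eval P env a (Atom m) s; eval P env b (Atom n) t\<rbrakk>
    \<Longrightarrow> eval P env (Add a b) (Atom (m + n)) (s + t + 1)"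
| Sub: "\<lbrakk>eval P env a (Atom m) s; eval P env b (Atom n) t\<rbrakk>
    \<Longrightarrow> eval P env (Sub a b) (Atom (m - n)) (s + t + 1)"
| IfLess_True: "\<lbrakk>eval P env a (Atom m) s; eval P env b (Atom n) t; m < n; eval P env c v r\<rbrakk>
    \<Longrightarrow> eval P env (IfLess a b c d) v (s + t + r + 1)"
| IfLess_False: "\<lbrakk>eval P env a (Atom m) s; eval P env b (Atom n) t; \<not> m < n; eval P env d v r\<rbrakk>
    \<Longrightarrow> eval P env (IfLess a b c d) v (s + t + r + 1)"
| MkPair: "\<lbrakk>eval P env a x s; eval P env b y t\<rbrakk>
    \<Longrightarrow> eval P env (MkPair a b) (Cell x y) (s + t + 1)"
| First: "eval P env a (Cell x y) s \<Longrightarrow> eval P env (First a) x (s + 1)"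
| Second: "eval P env a (Cell x y) s \<Longrightarrow> eval P env (Second a) y (s + 1)"
| IfPair_True: "\<lbrakk>eval P env a (Cell x y) s; eval P env b v t\<rbrakk>
    \<Longrightarrow> eval P env (IfPair a b c) v (s + t + 1)"
| IfPair_False: "\<lbrakk>eval P env a (Atom m) s; eval P env c v t\<rbrakk>
    \<Longrightarrow> eval P env (IfPair a b c) v (s + t + 1)"
| LetIn: "\<lbrakk>eval P env a x s; eval P (x # env) b v t\<rbrakk>
    \<Longrightarrow> eval P env (LetIn a b) v (s + t + 1)"
| Call: "\<lbrakk>f < length P; evals P env as xs s; eval P xs (P ! f) v t\<rbrakk>
    \<Longrightarrow> eval P env (Call f as) v (s + t + 1)"
| Nil: "evals P env [] [] 0"
| Cons: "\<lbrakk>eval P env a x s; evals P env as xs t\<rbrakk> \<Longrightarrow> evals P env (a # as) (x # xs) (s + t)"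

inductive_cases eval_elims:
  "eval P env (Arg i) v t"
  "eval P env (Lit m) v t"
  "eval P env (Add a b) v t"
  "eval P env (Sub a b) v t"
  "eval P env (IfLess a b c d) v t"
  "eval P env (MkPair a b) v t"
  "eval P env (First a) v t"
  "eval P env (Second a) v t"
  "eval P env (IfPair a b c) v t"
  "eval P env (LetIn a b) v t"
  "eval P env (Call f as) v t"
  "evals P env [] vs t"
  "evals P env (a # as) vs t"

lemma eval_deterministic:
  shows "eval P env e v t \<Longrightarrow> (\<forall>v' t'. eval P env e v' t' \<longrightarrow> v' = v \<and> t' = t)"
    and "evals P env es vs t \<Longrightarrow> (\<forall>vs' t'. evals P env es vs' t' \<longrightarrow> vs' = vs \<and> t' = t)"
proof (induct rule: eval_evals.inducts)
qed (intro allI impI, (erule eval_elims;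
      metis data.inject data.distinct One_nat_def add_Suc_right add_0_right))+

definition runs :: "program \<Rightarrow> data \<Rightarrow> data \<Rightarrow> nat \<Rightarrow> bool" where
  "runs P x y t \<longleftrightarrow> P \<noteq> [] \<and> eval P [x] (P ! 0) y t"


section \<open>Multiterminal cuts\<close>

definition simple_graph :: "'a set \<Rightarrow> 'a set set \<Rightarrow> bool" where
  "simple_graph V E \<longleftrightarrow> finite V \<and> (\<forall>e\<in>E. e \<subseteq> V \<and> card e = 2)"

text \<open>The terminals \<open>t\<^sub>1, \<dots>, t\<^sub>p\<close> are the entries of the list \<open>ts\<close>.\<close>

definition terminal_cut_instance ::
    "nat \<Rightarrow> 'a set \<Rightarrow> 'a set set \<Rightarrow> ('a set \<Rightarrow> nat) \<Rightarrow> 'a list \<Rightarrow> bool" where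
  "terminal_cut_instance p V E w ts \<longleftrightarrow>
     simple_graph V E \<and> (\<forall>e\<in>E. 0 < w e) \<and>
     length ts = p \<and> distinct ts \<and> set ts \<subseteq> V"

definition multiterminal_cut :: "'a set \<Rightarrow> 'a list \<Rightarrow> 'a set list \<Rightarrow> bool" where
  "multiterminal_cut V ts Vs \<longleftrightarrow>
     length Vs = length ts \<and> distinct Vs \<and> partition_on V (set Vs) \<and>
     (\<forall>i<length ts. ts ! i \<in> Vs ! i)"

definition cut_size :: "'a set set \<Rightarrow> ('a set \<Rightarrow> nat) \<Rightarrow> 'a set list \<Rightarrow> nat" where
  "cut_size E w Vs =
     (\<Sum>e \<in> {e \<in> E. \<exists>X\<in>set Vs. \<exists>Y\<in>set Vs. X \<noteq> Y \<and> e \<inter> X \<noteq> {} \<and> e \<inter> Y \<noteq> {}}. w e)"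


section \<open>Inputs, outputs and running time\<close>

fun enc_list :: "('a \<Rightarrow> data) \<Rightarrow> 'a list \<Rightarrow> data" where
  "enc_list f [] = Atom 0"
| "enc_list f (x # xs) = Cell (f x) (enc_list f xs)"

text \<open>
  Vertices are named by arbitrary natural numbers. The input lists the vertices, the weighted edges
  \<open>(u, v, c)\<close> (each edge once, in either orientation) and the terminals, followed by \<open>k\<close>. A program
  has to cope with every order in which the vertices and edges may be listed.
\<close>

definition encodes_instance ::
    "nat set \<Rightarrow> nat set set \<Rightarrow> (nat set \<Rightarrow> nat) \<Rightarrow> nat list \<Rightarrow> nat \<Rightarrow> data \<Rightarrow> bool" where
  "encodes_instance V E w ts k x \<longleftrightarrow>
     (\<exists>vs es.
        distinct vs \<and> set vs = V \<and>
        distinct (map (\<lambda>(u, v, c). {u, v}) es) \<and>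
        set (map (\<lambda>(u, v, c). {u, v}) es) = E \<and>
        (\<forall>(u, v, c) \<in> set es. c = w {u, v}) \<and>
        x = Cell (enc_list Atom vs)
              (Cell (enc_list (\<lambda>(u, v, c). Cell (Atom u) (Cell (Atom v) (Atom c))) es)
                (Cell (enc_list Atom ts) (Atom k))))"

text \<open>
  The answer is either the atom \<open>0\<close>, reporting that there is no cut of size at most \<open>k\<close>, or the
  atom \<open>1\<close> paired with the list of the parts \<open>V\<^sub>1, \<dots>, V\<^sub>p\<close>, each given as a list of its vertices.
\<close>

definition correct_answer ::
    "nat set \<Rightarrow> nat set set \<Rightarrow> (nat set \<Rightarrow> nat) \<Rightarrow> nat list \<Rightarrow> nat \<Rightarrow> data \<Rightarrow> bool" where
  "correct_answer V E w ts k y \<longleftrightarrow>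
     (y = Atom 0 \<and> \<not> (\<exists>Vs. multiterminal_cut V ts Vs \<and> cut_size E w Vs \<le> k)) \<or>
     (\<exists>Ls. y = Cell (Atom 1) (enc_list (enc_list Atom) Ls) \<and>
           multiterminal_cut V ts (map set Ls) \<and> cut_size E w (map set Ls) \<le> k)"

definition solves_terminal_cut_within :: "nat \<Rightarrow> program \<Rightarrow> (nat \<Rightarrow> nat \<Rightarrow> real) \<Rightarrow> bool" where
  "solves_terminal_cut_within p P T \<longleftrightarrow>
     (\<forall>V E w ts k x.
        terminal_cut_instance p V E w ts \<longrightarrow> encodes_instance V E w ts k x \<longrightarrow>
        (\<exists>y t. runs P x y t \<and> correct_answer V E w ts k y \<and> real t \<le> T k (card V)))"

end

theory Submission imports Defs begin

text \<open>
  Let \<open>d\<^sub>i\<close> be the minimum weight of a cut isolating the terminal \<open>t\<^sub>i\<close> from the other ones. A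
  multiterminal cut of size at most \<open>k\<close> needs \<open>\<Sum> d\<^sub>i \<le> 2 k\<close>, and if \<open>\<Sum> d\<^sub>i - d\<^sub>j \<le> k\<close> for some \<open>j\<close>, then
  joining all isolating cuts but the \<open>j\<close>-th gives one. Otherwise the measure \<open>2 k - \<Sum> d\<^sub>i\<close> is less
  than \<open>(p - 2) k / (p - 1)\<close>, and it suffices to branch with measure drops \<open>(1, 2, 3)\<close>, whose
  branching number \<open>1.8393\<close> is below \<open>1.84\<close>.

  By submodularity the largest minimum isolating cuts may be contracted into their terminals. Let
  \<open>v\<close> be a neighbour of \<open>t\<close>, and \<open>U\<close> the largest minimum isolating cut of \<open>t\<close> containing \<open>v\<close>. Either \<open>U\<close>
  belongs to the part of \<open>t\<close>, or a unit of the edge \<open>t v\<close> is cut; both drop the measure by 1. If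
  \<open>U\<close> exceeds the minimum by 2, the drops are \<open>(2, 1)\<close>. If two units of edges from \<open>t\<close> into \<open>U\<close> can be
  removed without lowering the other \<open>d\<^sub>i\<close>, they are \<open>(1, 2)\<close>. If almost all edges leaving \<open>U - {t}\<close>
  go to one vertex \<open>z\<close> and at most one more to a vertex \<open>a\<close>, then \<open>U\<close> is only worth taking together
  with \<open>z\<close> or \<open>a\<close>, and the drops are \<open>(2, 3, 1)\<close>. Uncrossing, applied to a largest such \<open>U\<close>, shows that one
  of these cases always applies.
\<close>

section \<open>Cuts in multigraphs\<close>

text \<open>Weights can be far larger than \<open>k\<close>, so an edge of weight \<open>c\<close>
  becomes \<open>min c (k + 1)\<close> parallel unit edges: no cut within the budget contains an
  edge heavier than \<open>k\<close>. Contraction is then a renaming of ends in an edge list, and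
  paying for one cut unit removes one entry. The vertex sets merged by contractions are never
  stored; one loop per vertex heads the list and is renamed with the edges, so the final list itself
  tells to which terminal each vertex went.

  The dichotomy on \<open>U\<close> rests on strict minimality. Once \<open>{t}\<close> is the only
  minimum isolating cut and \<open>U\<close> exceeds it by just 1, \<open>U\<close> is a cheapest
  cut around each of its vertices other than \<open>t\<close>. Hence a part of \<open>t\<close> that
  contains any of them may take all of \<open>U\<close>; if it contains none, all edges from
  \<open>t\<close> into \<open>U\<close> are cut at once, which is what makes removing two units
  sound.

  The gap between the branching number and \<open>1.84\<close> is needed: the cost of a node is
  polynomial in \<open>k\<close> as well as in \<open>n\<close>, and the slack in the base absorbs
  the powers of \<open>k\<close>.\<close>

definition wt :: "('a \<times> 'a) list \<Rightarrow> 'a set \<Rightarrow> 'a set \<Rightarrow> nat" where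
  "wt es A B = length (filter (\<lambda>(u, v). u \<in> A \<and> v \<in> B \<or> v \<in> A \<and> u \<in> B) es)"

definition dg :: "('a \<times> 'a) list \<Rightarrow> 'a set \<Rightarrow> nat" where
  "dg es X = wt es X (- X)"

definition cost :: "('a \<times> 'a) list \<Rightarrow> ('a \<Rightarrow> 'a) \<Rightarrow> nat" where
  "cost es \<phi> = length (filter (\<lambda>(u, v). \<phi> u \<noteq> \<phi> v) es)"

definition vx :: "('a \<times> 'a) list \<Rightarrow> 'a set" where
  "vx es = fst ` set es \<union> snd ` set es"

definition rename :: "('a \<Rightarrow> 'b) \<Rightarrow> ('a \<times> 'a) list \<Rightarrow> ('b \<times> 'b) list" where
  "rename f es = map (\<lambda>(u, v). (f u, f v)) es"

lemma wt_Nil [simp]: "wt [] A B = 0"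
  and wt_Cons: "wt ((u, v) # es) A B = wt es A B + of_bool (u \<in> A \<and> v \<in> B \<or> v \<in> A \<and> u \<in> B)"
  by (auto simp: wt_def)

lemma dg_Nil [simp]: "dg [] X = 0"
  and dg_Cons: "dg ((u, v) # es) X = dg es X + of_bool ((u \<in> X) \<noteq> (v \<in> X))"
  by (auto simp: dg_def wt_Cons)

lemma cost_Nil [simp]: "cost [] \<phi> = 0"
  and cost_Cons: "cost ((u, v) # es) \<phi> = cost es \<phi> + of_bool (\<phi> u \<noteq> \<phi> v)"
  by (auto simp: cost_def)

lemma vx_Nil [simp]: "vx [] = {}"
  and vx_Cons [simp]: "vx ((u, v) # es) = insert u (insert v (vx es))"
  by (auto simp: vx_def)

lemma rename_Nil [simp]: "rename f [] = []"
  and rename_Cons [simp]: "rename f ((u, v) # es) = (f u, f v) # rename f es"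
  and length_rename [simp]: "length (rename f es) = length es"
  and take_rename: "take n (rename f es) = rename f (take n es)"
  by (auto simp: rename_def take_map)

lemma rename_rename: "rename g (rename f es) = rename (g \<circ> f) es"
  by (induction es) auto

lemma rename_cong: "(\<And>x. x \<in> vx es \<Longrightarrow> f x = g x) \<Longrightarrow> rename f es = rename g es"
  by (induction es) auto

lemma vx_rename: "vx (rename f es) = f ` vx es"
  by (induction es) auto

lemma finite_vx [simp]: "finite (vx es)"
  by (simp add: vx_def)

lemma dg_rename: "dg (rename f es) X = dg es (f -` X)"
  by (induction es) (auto simp: dg_Cons)

lemma cost_rename: "cost (rename f es) \<phi> = cost es (\<phi> \<circ> f)"
  by (induction es) (auto simp: cost_Cons)

lemma wt_commute: "wt es A B = wt es B A"
  by (induction es) (auto simp: wt_Cons)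

lemma wt_pos_iff: "0 < wt es A B \<longleftrightarrow> (\<exists>u\<in>A. \<exists>v\<in>B. (u, v) \<in> set es \<or> (v, u) \<in> set es)"
  by (force simp: wt_def filter_empty_conv)

lemma wt_mono: "A \<subseteq> A' \<Longrightarrow> B \<subseteq> B' \<Longrightarrow> wt es A B \<le> wt es A' B'"
  by (induction es) (auto simp: wt_Cons of_bool_def)

lemma wt_Un_right: "A \<inter> (B \<union> C) = {} \<Longrightarrow> B \<inter> C = {} \<Longrightarrow> wt es A (B \<union> C) = wt es A B + wt es A C"
  by (induction es) (auto simp: wt_Cons of_bool_def)

text \<open>An edge between \<open>A - B\<close> and \<open>B - A\<close> counts twice on both
  sides; one from \<open>A \<inter> B\<close> to the outside of both counts twice on the left and
  leaves neither difference. The exact form matters: the last term separates the cases in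
  \<open>kids_exist\<close>.\<close>

lemma dg_posimodular:
  "dg es A + dg es B = dg es (A - B) + dg es (B - A) + 2 * wt es (A \<inter> B) (- (A \<union> B))"
  by (induction es) (auto simp: wt_Cons dg_Cons of_bool_def)

lemma dg_submodular: "dg es (A \<inter> B) + dg es (A \<union> B) \<le> dg es A + dg es B"
  by (induction es) (auto simp: dg_Cons of_bool_def)

lemma dg_Un_disjoint: "A \<inter> B = {} \<Longrightarrow> dg es (A \<union> B) + 2 * wt es A B = dg es A + dg es B"
  by (induction es) (auto simp: wt_Cons dg_Cons of_bool_def)

lemma dg_le_length: "dg es X \<le> length es"
  by (simp add: dg_def wt_def)

text \<open>A partition is represented by a map sending everything to the terminal of its part. It
  is total on the type, so no vertex set has to be carried through contractions; names outside the
  graph have no effect on \<open>cost\<close>.\<close>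

definition labelling :: "'a set \<Rightarrow> ('a \<Rightarrow> 'a) \<Rightarrow> bool" where
  "labelling T \<phi> \<longleftrightarrow> (\<forall>t\<in>T. \<phi> t = t) \<and> (\<forall>x. \<phi> x \<in> T)"

lemma labelling_comp:
  "labelling T \<phi> \<Longrightarrow> (\<And>t. t \<in> T \<Longrightarrow> f t = t) \<Longrightarrow> labelling T (\<phi> \<circ> f)"
  by (simp add: labelling_def)

text \<open>An edge whose ends have different labels leaves exactly two of the label
  classes.\<close>

lemma sum_dg_eq_cost:
  assumes "finite T" "labelling T \<phi>"
  shows "(\<Sum>t\<in>T. dg es (\<phi> -` {t})) = 2 * cost es \<phi>"
proof (induction es)
  case (Cons e es)
  obtain u v where e: "e = (u, v)" by (cases e)
  have T: "\<phi> u \<in> T" "\<phi> v \<in> T" using assms by (auto simp: labelling_def)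
  have "(\<Sum>t\<in>T. of_bool ((\<phi> u = t) \<noteq> (\<phi> v = t)) :: nat) = 2 * of_bool (\<phi> u \<noteq> \<phi> v)"
  proof (cases "\<phi> u = \<phi> v")
    case False
    have "(\<Sum>t\<in>T. of_bool ((\<phi> u = t) \<noteq> (\<phi> v = t)) :: nat)
        = (\<Sum>t\<in>T. of_bool (\<phi> u = t) + of_bool (\<phi> v = t))"
      using False by (intro sum.cong) auto
    also have "\<dots> = 2" using T assms(1) by (simp add: sum.distrib of_bool_def)
    finally show ?thesis using False by simp
  qed simp
  then show ?case using Cons by (simp add: e dg_Cons cost_Cons sum.distrib)
qed simp

section \<open>Minimum isolating cuts and the effect of contractions on them\<close>

definition iso :: "'a set \<Rightarrow> 'a \<Rightarrow> 'a set \<Rightarrow> bool" where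
  "iso T t X \<longleftrightarrow> X \<inter> T = {t}"

definition mc :: "'a set \<Rightarrow> ('a \<times> 'a) list \<Rightarrow> 'a \<Rightarrow> nat" where
  "mc T es t = (INF X \<in> Collect (iso T t). dg es X)"

lemma iso_in: "iso T t X \<Longrightarrow> t \<in> X" and iso_T: "iso T t X \<Longrightarrow> t \<in> T"
  by (auto simp: iso_def)

lemma mc_le: "iso T t X \<Longrightarrow> mc T es t \<le> dg es X"
  unfolding mc_def by (intro cINF_lower) auto

lemma mc_attained:
  assumes "t \<in> T" obtains X where "iso T t X" "dg es X = mc T es t"
proof -
  have "iso T t {t}" using assms by (auto simp: iso_def)
  then have "dg es ` Collect (iso T t) \<noteq> {}" by auto
  then have "mc T es t \<in> dg es ` Collect (iso T t)"
    unfolding mc_def by (rule Inf_nat_def1)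
  then show ?thesis using that by auto
qed

lemma mc_ge:
  assumes "t \<in> T" "\<And>X. iso T t X \<Longrightarrow> c \<le> dg es X" shows "c \<le> mc T es t"
  using mc_attained[OF assms(1), of es] assms(2) by metis

text \<open>An isolating cut of the renamed graph pulls back along \<open>f\<close> to one of the
  original graph with the same degree, and the preimage contains everything that was renamed to
  \<open>t\<close>.\<close>

lemma mc_rename_ge:
  assumes "t \<in> T" "\<And>s. s \<in> T \<Longrightarrow> f s = s"
    and "\<And>X. iso T t X \<Longrightarrow> f -` {t} \<subseteq> X \<Longrightarrow> c \<le> dg es X"
  shows "c \<le> mc T (rename f es) t"
proof (rule mc_ge[OF assms(1)])
  fix X assume X: "iso T t X"
  have "iso T t (f -` X)" using X assms(2) by (auto simp: iso_def)
  moreover have "f -` {t} \<subseteq> f -` X" using X by (auto simp: iso_def)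
  ultimately show "c \<le> dg (rename f es) X" by (simp add: dg_rename assms(3))
qed

lemma mc_rename:
  assumes "t \<in> T" "\<And>s. s \<in> T \<Longrightarrow> f s = s" shows "mc T es t \<le> mc T (rename f es) t"
  using assms by (intro mc_rename_ge) (auto intro: mc_le)

lemma sum_mc_le_cost:
  assumes "finite T" "labelling T \<phi>" shows "(\<Sum>t\<in>T. mc T es t) \<le> 2 * cost es \<phi>"
proof -
  have "(\<Sum>t\<in>T. mc T es t) \<le> (\<Sum>t\<in>T. dg es (\<phi> -` {t}))"
    using assms(2) by (intro sum_mono mc_le) (auto simp: iso_def labelling_def)
  then show ?thesis using assms by (simp add: sum_dg_eq_cost)
qed

text \<open>Uncrossing: no part loses by handing its share of \<open>U\<close> over to the part of \<open>t\<close>.\<close>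

lemma absorb:
  assumes "finite T" and \<phi>: "labelling T \<phi>" and "t \<in> T" and UT: "U \<inter> T \<subseteq> {t}"
    and S: "\<And>x. x \<in> S \<Longrightarrow> \<phi> x = t" "S \<subseteq> U"
    and min: "\<And>W. S \<subseteq> W \<Longrightarrow> W \<subseteq> U \<Longrightarrow> dg es U \<le> dg es W"
  defines "\<psi> \<equiv> \<lambda>x. if x \<in> U then t else \<phi> x"
  shows "labelling T \<psi>" "cost es \<psi> \<le> cost es \<phi>"
proof -
  show \<psi>: "labelling T \<psi>" using \<phi> UT \<open>t \<in> T\<close> by (auto simp: labelling_def \<psi>_def)
  have "dg es (\<psi> -` {s}) \<le> dg es (\<phi> -` {s})" if "s \<in> T" for s
  proof (cases "s = t")
    case True
    have "\<psi> -` {s} = \<phi> -` {t} \<union> U" by (auto simp: \<psi>_def True)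
    moreover have "dg es U \<le> dg es (\<phi> -` {t} \<inter> U)" using S by (intro min) auto
    ultimately show ?thesis using dg_submodular[of es "\<phi> -` {t}" U] True by simp
  next
    case False
    have "\<psi> -` {s} = \<phi> -` {s} - U" using False by (auto simp: \<psi>_def)
    \<comment> \<open>What \<open>U\<close> has outside the part of \<open>s\<close> still contains
      \<open>S\<close>, so its degree is at least that of \<open>U\<close>; posimodularity turns
      this into a bound on what \<open>s\<close> keeps.\<close>
    moreover have "dg es U \<le> dg es (U - \<phi> -` {s})" using S False by (intro min) auto
    ultimately show ?thesis using dg_posimodular[of es "\<phi> -` {s}" U] by simp
  qed
  then have "(\<Sum>s\<in>T. dg es (\<psi> -` {s})) \<le> (\<Sum>s\<in>T. dg es (\<phi> -` {s}))" by (rule sum_mono)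
  then show "cost es \<psi> \<le> cost es \<phi>" using sum_dg_eq_cost[OF \<open>finite T\<close>] \<phi> \<psi> by (metis nat_mult_le_cancel_disj zero_less_numeral)
qed

section \<open>Isolating cuts by augmenting paths\<close>

text \<open>
  The visited list pairs each vertex \<open>x\<close> that reaches a sink with a path \<open>r\<close> such that \<open>x # r\<close>
  leads to a sink; \<open>look\<close> returns \<open>x # r\<close>, or \<open>[]\<close> if \<open>x\<close> has not been visited.
\<close>

fun look :: "'a \<Rightarrow> ('a \<times> 'a list) list \<Rightarrow> 'a list" where
  "look x [] = []"
| "look x ((y, r) # vis) = (if x = y then y # r else look x vis)"

text \<open>One pass over the arcs, followed backwards: the tail of an arc with visited head becomes
  visited and inherits the path of the head.\<close>

fun grow :: "('a \<times> 'a) list \<Rightarrow> ('a \<times> 'a list) list \<Rightarrow> ('a \<times> 'a list) list" where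
  "grow [] vis = vis"
| "grow ((u, v) # as) vis =
     grow as (if look v vis \<noteq> [] \<and> look u vis = [] then (u, look v vis) # vis else vis)"

fun sat :: "'b list \<Rightarrow> ('a \<times> 'a) list \<Rightarrow> ('a \<times> 'a list) list \<Rightarrow> ('a \<times> 'a list) list" where
  "sat [] as vis = vis"
| "sat (c # cs) as vis = sat cs as (grow as vis)"

text \<open>Arcs have unit capacity and may be parallel. Sending a unit along \<open>(x, y)\<close>
  reverses a single copy, so the arc list is its own residual graph.\<close>

fun push :: "'a \<Rightarrow> 'a \<Rightarrow> ('a \<times> 'a) list \<Rightarrow> ('a \<times> 'a) list" where
  "push x y [] = []"
| "push x y ((u, v) # as) = (if u = x \<and> v = y then (v, u) # as else (u, v) # push x y as)"

fun aug :: "'a list \<Rightarrow> ('a \<times> 'a) list \<Rightarrow> ('a \<times> 'a) list" where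
  "aug (x # y # p) as = aug (y # p) (push x y as)"
| "aug [x] as = as"
| "aug [] as = as"

fun flow :: "'b list \<Rightarrow> ('a \<times> 'a) list \<Rightarrow> 'a \<Rightarrow> ('a \<times> 'a list) list \<Rightarrow> ('a \<times> 'a list) list" where
  "flow [] as t s = sat as as s"
| "flow (c # cs) as t s = flow cs (aug (look t (sat as as s)) as) t s"

fun dbl :: "('a \<times> 'a) list \<Rightarrow> ('a \<times> 'a) list" where
  "dbl [] = []"
| "dbl ((u, v) # es) = (u, v) # (v, u) # dbl es"

text \<open>The terminals as sinks with empty paths, visited from the start. The program also stores
  its terminal set in this form, with \<open>look\<close> as membership test.\<close>

definition sing :: "'a list \<Rightarrow> ('a \<times> 'a list) list" where
  "sing ts = map (\<lambda>t. (t, [])) ts"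

abbreviation merge :: "'a \<Rightarrow> 'a \<Rightarrow> 'a \<Rightarrow> 'a" where
  "merge v t x \<equiv> (if x = v then t else x)"

text \<open>Contracting \<open>v\<close> into \<open>t\<close> beforehand forces \<open>v\<close>
  onto the side of \<open>t\<close>; \<open>v = t\<close> gives the ordinary isolating cut. The
  result lists the vertices that reach another terminal, so the cut is its complement.\<close>

definition cutv :: "('a \<times> 'a) list \<Rightarrow> 'a list \<Rightarrow> 'a \<Rightarrow> 'a \<Rightarrow> ('a \<times> 'a list) list" where
  "cutv es ts t v = (let e = rename (merge v t) es in flow e (dbl e) t (sing (filter (\<lambda>s. s \<noteq> t) ts)))"

section \<open>Correctness of the backward search\<close>

definition heads :: "('a \<times> 'a list) list \<Rightarrow> 'a set" where
  "heads vis = fst ` set vis"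

lemma heads_simps [simp]: "heads [] = {}" "heads ((x, r) # vis) = insert x (heads vis)"
  by (auto simp: heads_def)

lemma finite_heads [simp]: "finite (heads vis)"
  by (simp add: heads_def)

lemma heads_sing [simp]: "heads (sing ts) = set ts"
  by (auto simp: heads_def sing_def image_image)

lemma look_eq_Nil_iff: "look x vis = [] \<longleftrightarrow> x \<notin> heads vis"
  by (induction x vis rule: look.induct) auto

lemma look_sing: "look x (sing ts) = [] \<longleftrightarrow> x \<notin> set ts"
  by (simp add: look_eq_Nil_iff)

lemma look_in_set: "x \<in> heads vis \<Longrightarrow> \<exists>r. (x, r) \<in> set vis \<and> look x vis = x # r"
  by (induction x vis rule: look.induct) auto

lemma dbl_set: "set (dbl es) = set es \<union> prod.swap ` set es"
  by (induction es rule: dbl.induct) auto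

lemma vx_dbl [simp]: "vx (dbl es) = vx es"
  by (induction es rule: dbl.induct) auto

lemma length_dbl [simp]: "length (dbl es) = 2 * length es"
  by (induction es rule: dbl.induct) auto

fun walk :: "('a \<times> 'a) list \<Rightarrow> 'a set \<Rightarrow> 'a list \<Rightarrow> bool" where
  "walk as S [] = False"
| "walk as S [x] = (x \<in> S)"
| "walk as S (x # y # p) = ((x, y) \<in> set as \<and> walk as S (y # p))"

text \<open>Requiring the stored paths to stay within the visited vertices keeps them simple: a
  newly visited vertex cannot already lie on the path to which it is prepended.\<close>

definition visok :: "('a \<times> 'a) list \<Rightarrow> 'a set \<Rightarrow> ('a \<times> 'a list) list \<Rightarrow> bool" where
  "visok as S vis \<longleftrightarrow>
     (\<forall>(x, r) \<in> set vis. walk as S (x # r) \<and> distinct (x # r) \<and> set r \<subseteq> heads vis)"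

lemma visok_sing: "visok as (set ts) (sing ts)"
  by (auto simp: visok_def sing_def)

lemma visok_look:
  "visok as S vis \<Longrightarrow> x \<in> heads vis \<Longrightarrow>
   \<exists>r. look x vis = x # r \<and> walk as S (x # r) \<and> distinct (x # r) \<and> set r \<subseteq> heads vis"
  using look_in_set[of x vis] by (fastforce simp: visok_def)

lemma visok_grow: "visok as S vis \<Longrightarrow> set bs \<subseteq> set as \<Longrightarrow> visok as S (grow bs vis)"
proof (induction bs vis rule: grow.induct)
  case (2 u v bs vis)
  have "visok as S (if look v vis \<noteq> [] \<and> look u vis = [] then (u, look v vis) # vis else vis)"
  proof (cases "look v vis \<noteq> [] \<and> look u vis = []")
    case True
    then have "v \<in> heads vis" "u \<notin> heads vis" by (auto simp: look_eq_Nil_iff)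
    with visok_look[OF 2(2), of v] 2(3) have "walk as S (u # look v vis) \<and> distinct (u # look v vis) \<and> set (look v vis) \<subseteq> heads vis"
      by auto
    then show ?thesis using True 2(2) unfolding visok_def by auto
  qed (use 2 in auto)
  with 2 show ?case by simp
qed simp

lemma visok_sat: "visok as S vis \<Longrightarrow> visok as S (sat cs as vis)"
  by (induction cs as vis rule: sat.induct) (auto intro: visok_grow)

lemma heads_grow_mono: "heads vis \<subseteq> heads (grow bs vis)"
proof (induction bs vis rule: grow.induct)
  case (2 u v bs vis)
  then show ?case by (auto split: if_splits)
qed simp

lemma heads_grow_le: "heads (grow bs vis) \<subseteq> heads vis \<union> fst ` set bs"
proof (induction bs vis rule: grow.induct)
  case (2 u v bs vis)
  then show ?case by (auto split: if_splits)
qed simp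

lemma heads_sat_mono: "heads vis \<subseteq> heads (sat cs as vis)"
proof (induction cs as vis rule: sat.induct)
  case (2 c cs as vis)
  then show ?case using heads_grow_mono by force
qed simp

lemma heads_sat_le: "heads (sat cs as vis) \<subseteq> heads vis \<union> fst ` set as"
proof (induction cs as vis rule: sat.induct)
  case (2 c cs as vis)
  then show ?case using heads_grow_le[of as vis] by auto
qed simp

definition closed_under :: "('a \<times> 'a) list \<Rightarrow> 'a set \<Rightarrow> bool" where
  "closed_under as H \<longleftrightarrow> (\<forall>(u, v) \<in> set as. v \<in> H \<longrightarrow> u \<in> H)"

lemma grow_unchanged: "closed_under bs (heads vis) \<Longrightarrow> grow bs vis = vis"
  by (induction bs vis rule: grow.induct) (auto simp: closed_under_def look_eq_Nil_iff)

lemma closed_if_heads_grow_eq: "heads (grow bs vis) = heads vis \<Longrightarrow> closed_under bs (heads vis)"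
proof (induction bs vis rule: grow.induct)
  case (2 u v bs vis)
  let ?vis = "if look v vis \<noteq> [] \<and> look u vis = [] then (u, look v vis) # vis else vis"
  have "heads ?vis \<subseteq> heads vis" using 2(2) heads_grow_mono[of ?vis bs] by simp
  then have "\<not> (look v vis \<noteq> [] \<and> look u vis = [])" by (auto simp: look_eq_Nil_iff split: if_splits)
  with 2 show ?case by (auto simp: closed_under_def look_eq_Nil_iff split: if_splits)
qed (simp add: closed_under_def)

text \<open>A pass that adds no vertex has reached a fixed point of \<open>grow\<close>, and every
  other pass adds at least one vertex.\<close>

lemma sat_progress:
  "closed_under as (heads (sat cs as vis)) \<or> card (heads vis) + length cs \<le> card (heads (sat cs as vis))"
proof (induction cs as vis rule: sat.induct)
  case (2 c cs as vis)
  show ?case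
  proof (cases "heads (grow as vis) = heads vis")
    case True
    then have c: "closed_under as (heads vis)" by (rule closed_if_heads_grow_eq)
    have "sat cs as vis = vis" for cs :: "'b list"
      using c by (induction cs) (auto simp: grow_unchanged)
    with c show ?thesis by (simp add: grow_unchanged)
  next
    case False
    then have "card (heads vis) < card (heads (grow as vis))"
      using heads_grow_mono[of vis as] by (intro psubset_card_mono) auto
    with 2 show ?thesis by auto
  qed
qed simp

text \<open>As many passes as arcs suffice: only tails of arcs can be added, so if every pass adds
  one, all tails have been visited at the end.\<close>

lemma closed_sat: "closed_under as (heads (sat as as vis))"
proof (cases "closed_under as (heads (sat as as vis))")
  case False
  then have *: "card (heads vis) + length as \<le> card (heads (sat as as vis))"
    using sat_progress[of as as vis] by auto
  have "card (heads vis \<union> fst ` set as) \<le> card (heads vis) + card (fst ` set as)" by (rule card_Un_le)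
  also have "card (fst ` set as) \<le> length as"
    by (metis card_length length_map list.set_map)
  finally have "card (heads vis \<union> fst ` set as) \<le> card (heads (sat as as vis))" using * by simp
  then have "heads (sat as as vis) = heads vis \<union> fst ` set as"
    using heads_sat_le[of as as vis] by (intro card_seteq) auto
  then show ?thesis by (force simp: closed_under_def)
qed

section \<open>Residual capacities and augmentation\<close>

definition out :: "('a \<times> 'a) list \<Rightarrow> 'a set \<Rightarrow> nat" where
  "out as X = length (filter (\<lambda>(u, v). u \<in> X \<and> v \<notin> X) as)"

lemma out_Nil [simp]: "out [] X = 0"
  and out_Cons: "out ((u, v) # as) X = out as X + of_bool (u \<in> X \<and> v \<notin> X)"
  by (auto simp: out_def)

lemma out_dbl: "out (dbl es) X = dg es X"
  by (induction es rule: dbl.induct) (auto simp: out_Cons dg_Cons)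

lemma out_push:
  "(x, y) \<in> set as \<Longrightarrow> out (push x y as) X + of_bool (x \<in> X) = out as X + of_bool (y \<in> X)"
  by (induction x y as rule: push.induct) (auto simp: out_Cons)

lemma set_push: "set as - {(x, y)} \<subseteq> set (push x y as)"
  by (induction x y as rule: push.induct) auto

lemma vx_push [simp]: "vx (push x y as) = vx as"
  by (induction x y as rule: push.induct) auto

lemma length_push [simp]: "length (push x y as) = length as"
  by (induction x y as rule: push.induct) auto

lemma vx_aug [simp]: "vx (aug p as) = vx as"
  and length_aug [simp]: "length (aug p as) = length as"
  by (induction p as rule: aug.induct) auto

lemma walk_push: "walk as S p \<Longrightarrow> x \<notin> set p \<Longrightarrow> walk (push x y as) S p"
  using set_push[of as x y] by (induction as S p rule: walk.induct) auto

text \<open>The changes in \<open>out_push\<close> telescope along the path. Distinctness ensures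
  that the later arcs of the path survive the earlier reversals.\<close>

lemma out_aug:
  "walk as S p \<Longrightarrow> distinct p \<Longrightarrow>
   out (aug p as) X + of_bool (hd p \<in> X) = out as X + of_bool (last p \<in> X)"
proof (induction p as rule: aug.induct)
  case (1 x y p as)
  have "out (aug (y # p) (push x y as)) X + of_bool (y \<in> X)
      = out (push x y as) X + of_bool (last (y # p) \<in> X)"
    using 1 walk_push[of as S "y # p" x y] by simp
  with out_push[of x y as X] 1(2) show ?case by simp
qed auto

lemma walk_last: "walk as S p \<Longrightarrow> last p \<in> S"
  by (induction as S p rule: walk.induct) auto

lemma walk_crosses: "walk as S p \<Longrightarrow> hd p \<in> X \<Longrightarrow> last p \<notin> X \<Longrightarrow> 0 < out as X"
proof (induction as S p rule: walk.induct)
  case (3 as S x y p)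
  show ?case
  proof (cases "y \<in> X")
    case False
    with 3 have "(x, y) \<in> set (filter (\<lambda>(u, v). u \<in> X \<and> v \<notin> X) as)" by auto
    then show ?thesis unfolding out_def by (metis length_pos_if_in_set)
  qed (use 3 in auto)
qed auto

lemma augment_step:
  fixes X :: "'a set"
  assumes "visok as S s" "look t (sat as as s) \<noteq> []" "t \<in> X" "X \<inter> S = {}"
  shows "out (aug (look t (sat as as s)) as) X + 1 = out as X"
proof -
  have "visok as S (sat as as s)" using assms(1) by (rule visok_sat)
  moreover have "t \<in> heads (sat as as s)" using assms(2) by (simp add: look_eq_Nil_iff)
  ultimately obtain r where r: "look t (sat as as s) = t # r" "walk as S (t # r)" "distinct (t # r)"
    using visok_look by fast
  have "last (t # r) \<notin> X" using walk_last[OF r(2)] assms(4) by auto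
  with out_aug[OF r(2,3), of X] assms(3) show ?thesis by (simp add: r(1))
qed

text \<open>Each augmentation lowers every cut separating \<open>t\<close> from the sinks by exactly
  one, so the same \<open>j\<close> serves all \<open>X\<close>, and comparing cuts in the residual
  graph is the same as comparing them in the original one.\<close>

lemma flow_result:
  fixes s :: "('a \<times> 'a list) list"
  assumes "\<And>as. visok as S s"
  obtains as' j where "flow cs as t s = sat as' as' s" "vx as' = vx as"
    "\<And>X. t \<in> X \<Longrightarrow> X \<inter> S = {} \<Longrightarrow> out as' X + j = out as X"
    "look t (sat as' as' s) = [] \<or> j = length cs"
proof (induction cs arbitrary: as thesis)
  case (Nil as thesis)
  show ?case by (rule Nil[of as 0]) auto
next
  case (Cons c cs as thesis)
  let ?as = "aug (look t (sat as as s)) as"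
  obtain as' j where *: "flow cs ?as t s = sat as' as' s" "vx as' = vx ?as"
    "\<And>X. t \<in> X \<Longrightarrow> X \<inter> S = {} \<Longrightarrow> out as' X + j = out ?as X"
    "look t (sat as' as' s) = [] \<or> j = length cs" using Cons.IH[of ?as] by blast
  show ?case
  proof (cases "look t (sat as as s) = []")
    case True
    have "flow cs as t s = sat as as s" for cs :: "'b list"
      by (induction cs) (auto simp: True)
    then show ?thesis using True by (intro Cons.prems[of as 0]) auto
  next
    case False
    have "out as' X + Suc j = out as X" if "t \<in> X" "X \<inter> S = {}" for X
      using augment_step[OF assms False that] *(3)[OF that] by simp
    then show ?thesis using * False by (intro Cons.prems[of as' "Suc j"]) auto
  qed
qed

text \<open>Searching from the sinks yields the largest minimum cut: a vertex that reaches a sink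
  cannot lie in a set that contains no sink and that no residual arc leaves. Being a complement,
  \<open>U\<close> also contains every name outside the graph other than the sinks.\<close>

lemma flow_cut:
  fixes es :: "('a \<times> 'a) list"
  assumes "t \<notin> set S" and H: "H = flow es (dbl es) t (sing S)" and U: "U = - heads H"
  shows "t \<in> U" "U \<inter> set S = {}" "- U \<subseteq> set S \<union> vx es"
    and "\<And>X. t \<in> X \<Longrightarrow> X \<inter> set S = {} \<Longrightarrow> dg es U \<le> dg es X"
    and "\<And>X. t \<in> X \<Longrightarrow> X \<inter> set S = {} \<Longrightarrow> dg es X \<le> dg es U \<Longrightarrow> X \<subseteq> U"
proof -
  obtain as j where as: "H = sat as as (sing S)" "vx as = vx es"
    "\<And>X. t \<in> X \<Longrightarrow> X \<inter> set S = {} \<Longrightarrow> out as X + j = dg es X"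
    "look t (sat as as (sing S)) = [] \<or> j = length es"
    using flow_result[where cs = es and as = "dbl es" and t = t, OF visok_sing[of _ S]]
    unfolding H out_dbl vx_dbl by metis
  have S: "set S \<subseteq> heads H" using heads_sat_mono[of "sing S" as as] by (simp add: as)
  then show US: "U \<inter> set S = {}" unfolding U by auto
  \<comment> \<open>If all \<open>length es\<close> rounds had augmented, the path still available
    would force the degree of \<open>t\<close> above the number of edges.\<close>
  have "look t H = []"
  proof (rule ccontr)
    assume "look t H \<noteq> []"
    moreover from this as have "j = length es" by auto
    moreover have "out as {t} + j = dg es {t}" using assms(1) as by auto
    ultimately show False
      using augment_step[OF visok_sing, where X = "{t}", of t as S] assms(1) as(1) dg_le_length[of es "{t}"] by auto
  qed
  then show tU: "t \<in> U" by (simp add: U look_eq_Nil_iff)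
  have "fst ` set as \<subseteq> vx as" by (simp add: vx_def)
  then show "- U \<subseteq> set S \<union> vx es" 
    using heads_sat_le[of as as "sing S"] unfolding U as(1) as(2) heads_sing by blast
  have cl: "closed_under as (heads H)" using closed_sat as by metis
  have "filter (\<lambda>(u, v). u \<in> U \<and> v \<notin> U) as = []"
    using cl by (auto simp: filter_empty_conv U closed_under_def)
  then have "out as U = 0" by (simp add: out_def)
  then have j: "dg es U = j" using as(3)[of U] tU US by simp
  show "dg es U \<le> dg es X" if "t \<in> X" "X \<inter> set S = {}" for X
    using as(3)[OF that] j by simp
  show "X \<subseteq> U" if X: "t \<in> X" "X \<inter> set S = {}" "dg es X \<le> dg es U" for X
  proof
    fix x assume x: "x \<in> X"
    have o: "out as X = 0" using as(3)[OF X(1,2)] X(3) j by simp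
    show "x \<in> U"
    proof (rule ccontr)
      assume "x \<notin> U"
      then have "x \<in> heads H" by (simp add: U)
      moreover have "visok as (set S) H" unfolding as by (intro visok_sat visok_sing)
      ultimately obtain r where "walk as (set S) (x # r)" using visok_look by fast
      moreover from this have "last (x # r) \<notin> X" using walk_last X(2) by fast
      ultimately show False using walk_crosses[of as "set S" "x # r" X] x o by simp
    qed
  qed
qed

definition cutset :: "('a \<times> 'a) list \<Rightarrow> 'a list \<Rightarrow> 'a \<Rightarrow> 'a \<Rightarrow> 'a set" where
  "cutset es ts t v = - heads (cutv es ts t v)"

lemma cutset:
  assumes "t \<in> set ts" "v \<notin> set ts \<or> v = t" and U: "U = cutset es ts t v"
  shows "v \<in> U" "iso (set ts) t U"
    and "\<And>X. iso (set ts) t X \<Longrightarrow> v \<in> X \<Longrightarrow> dg es U \<le> dg es X"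
    and "\<And>X. iso (set ts) t X \<Longrightarrow> v \<in> X \<Longrightarrow> dg es X \<le> dg es U \<Longrightarrow> X \<subseteq> U"
proof -
  define e where "e = rename (merge v t) es"
  define S where "S = filter (\<lambda>s. s \<noteq> t) ts"
  have S: "set S = set ts - {t}" by (auto simp: S_def)
  have t: "t \<notin> set S" by (simp add: S)
  have H: "U = - heads (flow e (dbl e) t (sing S))"
    by (simp add: U cutset_def cutv_def e_def S_def Let_def)
  note fc = flow_cut[OF t refl H]
  have "vx e = merge v t ` vx es" by (simp add: e_def vx_rename)
  then have "v \<notin> vx e \<or> v = t" by auto
  then show v: "v \<in> U" using fc(1,3) assms S by auto
  have iso_iff: "iso (set ts) t X \<longleftrightarrow> t \<in> X \<and> X \<inter> set S = {}" for X
    using assms(1) by (auto simp: iso_def S)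
  show "iso (set ts) t U" using fc(1,2) by (simp add: iso_iff)
  have e: "dg e X = dg es X" if "t \<in> X" "v \<in> X" for X
  proof -
    have "merge v t -` X = X" using that by (auto split: if_splits)
    then show ?thesis by (simp add: e_def dg_rename)
  qed
  show "dg es U \<le> dg es X" if "iso (set ts) t X" "v \<in> X" for X
    using fc(4)[of X] that e[of X] e[of U] v fc(1) by (auto simp: iso_iff)
  show "X \<subseteq> U" if "iso (set ts) t X" "v \<in> X" "dg es X \<le> dg es U" for X
    using fc(5)[of X] that e[of X] e[of U] v fc(1) by (auto simp: iso_iff)
qed

section \<open>The branching algorithm\<close>

definition ren :: "('a \<times> 'a list) list \<Rightarrow> 'a \<Rightarrow> ('a \<times> 'a) list \<Rightarrow> ('a \<times> 'a) list" where
  "ren H t es = rename (\<lambda>x. if look x H = [] then t else x) es"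

fun prep :: "'a list \<Rightarrow> 'a list \<Rightarrow> ('a \<times> 'a) list \<Rightarrow> ('a \<times> 'a) list" where
  "prep [] ts es = es"
| "prep (t # l) ts es = prep l ts (ren (cutv es ts t t) t es)"

fun tdeg :: "'a list \<Rightarrow> ('a \<times> 'a) list \<Rightarrow> nat" where
  "tdeg ts [] = 0"
| "tdeg ts ((u, v) # es) =
     tdeg ts es + (if u = v then 0 else of_bool (u \<in> set ts) + of_bool (v \<in> set ts))"

fun del :: "'a \<Rightarrow> 'a \<Rightarrow> ('a \<times> 'a) list \<Rightarrow> ('a \<times> 'a) list" where
  "del x y [] = []"
| "del x y ((u, v) # es) = (if u = x \<and> v = y \<or> u = y \<and> v = x then es else (u, v) # del x y es)"

text \<open>The candidate of \<open>t\<close> gives all non-terminals to \<open>t\<close>. On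
  success the value is the fully contracted edge list, whose loops record the labelling;
  \<open>[]\<close> stands for failure.\<close>

fun cands :: "'a list \<Rightarrow> 'a list \<Rightarrow> ('a \<times> 'a) list \<Rightarrow> nat \<Rightarrow> ('a \<times> 'a) list" where
  "cands [] ts es k = []"
| "cands (t # l) ts es k =
     (let e = rename (\<lambda>x. if x \<in> set ts then x else t) es
      in if k < cost e id then cands l ts es k else e)"

text \<open>Here \<open>e1\<close> already lacks one unit of the branching edge, and a second unit
  from \<open>t\<close> into the cut is tried. The terminal degrees are compared after renewed
  contraction, with an allowance of 2 for what \<open>t\<close> itself loses.\<close>

fun two :: "('a \<times> 'a) list \<Rightarrow> 'a list \<Rightarrow> ('a \<times> 'a) list \<Rightarrow> ('a \<times> 'a list) list \<Rightarrow> 'a \<Rightarrow> nat \<Rightarrow> nat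
    \<Rightarrow> (('a \<times> 'a) list \<times> nat) list" where
  "two [] ts e1 H t d k = []"
| "two ((a, b) # l) ts e1 H t d k =
     (if a = t \<and> b \<noteq> t \<and> look b H = [] then
        (let e4 = prep ts ts (del t b e1)
         in if d \<le> tdeg ts e4 + 2 then [(e4, k - 2)] else two l ts e1 H t d k)
      else two l ts e1 H t d k)"

text \<open>Run on a doubled edge list, this collects the outer ends of the edges leaving the side
  of \<open>t\<close> from vertices other than \<open>t\<close>, with multiplicity.\<close>

fun outs :: "('a \<times> 'a list) list \<Rightarrow> 'a \<Rightarrow> ('a \<times> 'a) list \<Rightarrow> 'a list" where
  "outs H t [] = []"
| "outs H t ((a, b) # l) =
     (if a \<noteq> t \<and> look a H = [] \<and> look b H \<noteq> [] then b # outs H t l else outs H t l)"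

text \<open>Looks for a \<open>z\<close> that is the outer end of all listed edges but at most one;
  the tail of the result holds the exceptional end, if there is one.\<close>

fun pick :: "'a list \<Rightarrow> 'a list \<Rightarrow> 'a list" where
  "pick [] ys = []"
| "pick (z # zs) ys =
     (let r = filter (\<lambda>y. y \<noteq> z) ys in if length r \<le> 1 then z # r else pick zs ys)"

text \<open>A terminal cannot join the part of \<open>t\<close>, so the corresponding child is left
  out. In \<open>e2\<close> the edges from the cut to \<open>z\<close> have become edges
  \<open>t z\<close>; the child that takes \<open>a\<close> but not \<open>z\<close> pays for one of
  them.\<close>

fun three :: "'a list \<Rightarrow> 'a list \<Rightarrow> 'a \<Rightarrow> ('a \<times> 'a) list \<Rightarrow> ('a \<times> 'a) list \<Rightarrow> nat
    \<Rightarrow> (('a \<times> 'a) list \<times> nat) list" where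
  "three [] ts t e1 e2 k = []"
| "three (z # r) ts t e1 e2 k =
     (if z \<in> set ts then [] else [(rename (merge z t) e2, k)]) @
     (case r of [] \<Rightarrow> [] | a # _ \<Rightarrow>
        if a \<in> set ts then [] else [(del t z (rename (merge a t) e2), k - 1)]) @
     [(e1, k - 1)]"

definition cand :: "'a list \<Rightarrow> ('a \<times> 'a) list \<Rightarrow> nat \<Rightarrow> 'a \<Rightarrow> 'a \<Rightarrow> (('a \<times> 'a) list \<times> nat) list" where
  "cand ts e k t v =
     (let H = cutv e ts t v; e2 = ren H t e; e1 = del t v e
      in if tdeg ts e + 1 < tdeg ts e2 then [(e2, k), (e1, k - 1)]
         else let r = two (dbl e1) ts e1 H t (tdeg ts e) k
              in if r \<noteq> [] then (e2, k) # r
                 else let ys = outs H t (dbl e) in three (pick ys ys) ts t e1 e2 k)"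

fun kids :: "('a \<times> 'a) list \<Rightarrow> 'a list \<Rightarrow> ('a \<times> 'a) list \<Rightarrow> nat \<Rightarrow> (('a \<times> 'a) list \<times> nat) list" where
  "kids [] ts e k = []"
| "kids ((t, v) # l) ts e k =
     (if t \<in> set ts \<and> v \<notin> set ts \<and> cand ts e k t v \<noteq> [] then cand ts e k t v else kids l ts e k)"

section \<open>Degrees, single-edge deletion and derived instances\<close>

lemma tdeg_eq: "distinct ts \<Longrightarrow> tdeg ts es = (\<Sum>t\<in>set ts. dg es {t})"
proof (induction ts es rule: tdeg.induct)
  case (2 ts u v es)
  have "(\<Sum>t\<in>set ts. of_bool ((u = t) \<noteq> (v = t)) :: nat)
      = (if u = v then 0 else of_bool (u \<in> set ts) + of_bool (v \<in> set ts))"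
  proof (cases "u = v")
    case False
    have "(\<Sum>t\<in>set ts. of_bool ((u = t) \<noteq> (v = t)) :: nat)
        = (\<Sum>t\<in>set ts. of_bool (u = t) + of_bool (v = t))"
      using False by (intro sum.cong) auto
    also have "\<dots> = of_bool (u \<in> set ts) + of_bool (v \<in> set ts)"
      by (simp add: sum.distrib of_bool_def)
    finally show ?thesis using False by simp
  qed simp
  then show ?case using 2 by (simp add: dg_Cons sum.distrib)
qed simp

lemma length_del: "length (del x y es) \<le> length es"
  by (induction x y es rule: del.induct) auto

lemma set_del: "set (del x y es) \<subseteq> set es"
  by (induction x y es rule: del.induct) auto

lemma vx_del: "vx (del x y es) \<subseteq> vx es"
  using set_del[of x y es] by (auto simp: vx_def)

lemma set_del_other: "{a, b} \<noteq> {x, y} \<Longrightarrow> (a, b) \<in> set (del x y es) \<longleftrightarrow> (a, b) \<in> set es"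
  by (induction x y es rule: del.induct) auto

lemma dg_del:
  "(x, y) \<in> set (dbl es) \<Longrightarrow> dg (del x y es) X + of_bool ((x \<in> X) \<noteq> (y \<in> X)) = dg es X"
  by (induction x y es rule: del.induct) (auto simp: dg_Cons)

lemma dg_le_del: "dg es X \<le> dg (del x y es) X + of_bool ((x \<in> X) \<noteq> (y \<in> X))"
  by (induction x y es rule: del.induct) (auto simp: dg_Cons)

lemma wt_del:
  "(x, y) \<in> set (dbl es) \<Longrightarrow> x \<in> A \<Longrightarrow> y \<in> B \<Longrightarrow> wt es A B = Suc (wt (del x y es) A B)"
  by (induction x y es rule: del.induct) (auto simp: wt_Cons)

lemma cost_del:
  "(x, y) \<in> set (dbl es) \<Longrightarrow> cost (del x y es) \<phi> + of_bool (\<phi> x \<noteq> \<phi> y) = cost es \<phi>"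
  by (induction x y es rule: del.induct) (auto simp: cost_Cons)

lemma cost_le_del: "cost es \<phi> \<le> Suc (cost (del x y es) \<phi>)"
  by (induction x y es rule: del.induct) (auto simp: cost_Cons)

definition loops :: "nat \<Rightarrow> ('a \<times> 'a) list \<Rightarrow> bool" where
  "loops n es \<longleftrightarrow> n \<le> length es \<and> (\<forall>(u, v) \<in> set (take n es). u = v)"

lemma loops_rename: "loops n es \<Longrightarrow> loops n (rename f es)"
  by (auto simp: loops_def take_rename) (auto simp: rename_def)

lemma take_del: "loops n es \<Longrightarrow> x \<noteq> y \<Longrightarrow> take n (del x y es) = take n es"
proof (induction x y es arbitrary: n rule: del.induct)
  case (2 x y u v es)
  show ?case
  proof (cases n)
    case (Suc m)
    then have *: "loops m es" "u = v" using 2(2) by (auto simp: loops_def)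
    then have "\<not> (u = x \<and> v = y \<or> u = y \<and> v = x)" using 2(3) by auto
    with 2(1)[OF this *(1) 2(3)] show ?thesis by (auto simp: Suc)
  qed simp
qed simp

lemma loops_del: "loops n es \<Longrightarrow> x \<noteq> y \<Longrightarrow> loops n (del x y es)"
proof (induction x y es arbitrary: n rule: del.induct)
  case (2 x y u v es)
  show ?case
  proof (cases n)
    case (Suc m)
    then have *: "loops m es" "u = v" using 2(2) by (auto simp: loops_def)
    then have "\<not> (u = x \<and> v = y \<or> u = y \<and> v = x)" using 2(3) by auto
    with 2(1)[OF this *(1) 2(3)] *(2) show ?thesis by (auto simp: loops_def Suc)
  qed (simp add: loops_def)
qed simp

text \<open>
  The first \<open>n\<close> entries of an edge list are loops recording the current names of the \<open>n\<close> vertices.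
\<close>

definition deriv :: "'a set \<Rightarrow> nat \<Rightarrow> ('a \<times> 'a) list \<Rightarrow> nat \<Rightarrow> ('a \<times> 'a) list \<Rightarrow> nat \<Rightarrow> bool" where
  "deriv T n e k e' k' \<longleftrightarrow> length e' \<le> length e \<and> loops n e' \<and> k' \<le> k \<and>
     (\<exists>f. (\<forall>s\<in>T. f s = s) \<and> take n e' = rename f (take n e) \<and>
          (\<forall>\<phi>. cost e' \<phi> \<le> k' \<longrightarrow> cost e (\<phi> \<circ> f) \<le> k))"

lemma deriv_trans:
  assumes "deriv T n e k e' k'" "deriv T n e' k' e'' k''" shows "deriv T n e k e'' k''"
proof -
  obtain f g where f: "\<forall>s\<in>T. f s = s" "take n e' = rename f (take n e)"
      "\<And>\<phi>. cost e' \<phi> \<le> k' \<Longrightarrow> cost e (\<phi> \<circ> f) \<le> k"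
    and g: "\<forall>s\<in>T. g s = s" "take n e'' = rename g (take n e')"
      "\<And>\<phi>. cost e'' \<phi> \<le> k'' \<Longrightarrow> cost e' (\<phi> \<circ> g) \<le> k'"
    using assms unfolding deriv_def by blast
  have "take n e'' = rename (g \<circ> f) (take n e)" using f(2) g(2) by (simp add: rename_rename)
  moreover have "cost e (\<phi> \<circ> (g \<circ> f)) \<le> k" if "cost e'' \<phi> \<le> k''" for \<phi>
    using f(3)[OF g(3)[OF that]] by (simp add: comp_assoc)
  ultimately show ?thesis using assms f(1) g(1) unfolding deriv_def
    by (intro conjI exI[of _ "g \<circ> f"]) auto
qed

lemma deriv_rename:
  "loops n e \<Longrightarrow> (\<And>s. s \<in> T \<Longrightarrow> f s = s) \<Longrightarrow> deriv T n e k (rename f e) k"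
  unfolding deriv_def by (auto simp: loops_rename take_rename cost_rename intro!: exI[of _ f])

lemma deriv_del:
  assumes "loops n e" "x \<noteq> y" "1 \<le> k" shows "deriv T n e k (del x y e) (k - 1)"
proof -
  have "cost e \<phi> \<le> k" if "cost (del x y e) \<phi> \<le> k - 1" for \<phi>
    using cost_le_del[of e \<phi> x y] that assms(3) by linarith
  moreover have "rename id es = es" for es :: "('a \<times> 'a) list" by (induction es) auto
  ultimately show ?thesis using assms unfolding deriv_def
    by (auto simp: loops_del take_del length_del intro!: exI[of _ id])
qed

section \<open>Solvability and the contraction of largest minimum isolating cuts\<close>

definition solv :: "'a set \<Rightarrow> ('a \<times> 'a) list \<Rightarrow> nat \<Rightarrow> bool" where
  "solv T e k \<longleftrightarrow> (\<exists>\<phi>. labelling T \<phi> \<and> cost e \<phi> \<le> k)"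

lemma deriv_solv: "deriv T n e k e' k' \<Longrightarrow> solv T e' k' \<Longrightarrow> solv T e k"
  unfolding deriv_def solv_def using labelling_comp by blast

lemma solv_rename:
  assumes "labelling T \<phi>" "cost e \<phi> \<le> k" "\<And>x. \<phi> (f x) = \<phi> x" shows "solv T (rename f e) k"
proof -
  have "\<phi> \<circ> f = \<phi>" using assms(3) by auto
  then show ?thesis using assms unfolding solv_def by (metis cost_rename)
qed

text \<open>\<open>{t}\<close> is the only minimum isolating cut of \<open>t\<close> inside the
  graph. The restriction to \<open>vx e\<close> is forced, since adding names outside the graph
  changes no degree.\<close>

definition minimal_at :: "'a set \<Rightarrow> ('a \<times> 'a) list \<Rightarrow> 'a \<Rightarrow> bool" where
  "minimal_at T e t \<longleftrightarrow> (\<forall>X. iso T t X \<longrightarrow> dg e {t} \<le> dg e X \<and>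
     (\<forall>x\<in>X. x \<in> vx e \<longrightarrow> x \<noteq> t \<longrightarrow> dg e {t} < dg e X))"

abbreviation coll :: "'a set \<Rightarrow> 'a \<Rightarrow> 'a \<Rightarrow> 'a" where
  "coll U t x \<equiv> (if x \<in> U then t else x)"

lemma ren_cutv: "ren (cutv e ts t v) t e = rename (coll (cutset e ts t v) t) e"
  by (simp add: ren_def cutset_def look_eq_Nil_iff)

lemma coll_vimage_other: "s \<noteq> t \<Longrightarrow> s \<notin> U \<Longrightarrow> coll U t -` {s} = {s}"
  and coll_vimage_same: "t \<in> U \<Longrightarrow> coll U t -` {t} = U"
  by (auto split: if_splits)

text \<open>Isolating cuts of the contracted graph pull back to the original one. For
  \<open>t\<close> the first claim is thus the maximality of the contracted minimum cut, and for
  another terminal minimality is inherited, because its own preimage is a singleton. Solvability is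
  \<open>absorb\<close> with \<open>S = {t}\<close>.\<close>

lemma minimal_at_contract:
  fixes e :: "('a \<times> 'a) list"
  assumes t: "t \<in> set ts" defines "e' \<equiv> ren (cutv e ts t t) t e"
  shows "minimal_at (set ts) e' t"
    and "\<And>s. minimal_at (set ts) e s \<Longrightarrow> s \<in> set ts \<Longrightarrow> minimal_at (set ts) e' s"
    and "\<And>k. solv (set ts) e k \<Longrightarrow> solv (set ts) e' k"
proof -
  define U where "U = cutset e ts t t"
  define f where "f = coll U t"
  have e': "e' = rename f e" by (simp add: e'_def ren_cutv U_def f_def)
  note cs = cutset[OF t disjI2[OF refl] U_def]
  have fT: "f s = s" if "s \<in> set ts" for s using that cs(2) by (auto simp: f_def iso_def)
  have iso: "iso (set ts) s (f -` X)" if "iso (set ts) s X" for s X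
    using that fT by (auto simp: iso_def)
  have ft: "f -` {t} = U" using cs(1) coll_vimage_same by (simp add: f_def)
  show "minimal_at (set ts) e' t" unfolding minimal_at_def
  proof (intro allI impI conjI ballI)
    fix X assume X: "iso (set ts) t X"
    have t': "t \<in> f -` X" using iso[OF X] by (rule iso_in)
    show "dg e' {t} \<le> dg e' X" using cs(3)[OF iso[OF X] t'] by (simp add: e' dg_rename ft)
    fix x assume x: "x \<in> X" "x \<in> vx e'" "x \<noteq> t"
    then have "x \<notin> U" by (auto simp: e' vx_rename f_def split: if_splits)
    moreover have "x \<in> f -` X" using x calculation by (simp add: f_def)
    ultimately show "dg e' {t} < dg e' X"
      using cs(4)[OF iso[OF X] t'] by (fastforce simp: e' dg_rename ft)
  qed
  show "minimal_at (set ts) e' s" if s: "minimal_at (set ts) e s" "s \<in> set ts" for s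
  proof (cases "s = t")
    case False
    have "s \<notin> U" using False s(2) cs(2) by (auto simp: iso_def)
    then have fs: "f -` {s} = {s}" using False coll_vimage_other by (simp add: f_def)
    show ?thesis unfolding minimal_at_def
    proof (intro allI impI conjI ballI)
      fix X assume X: "iso (set ts) s X"
      show "dg e' {s} \<le> dg e' X" using s(1) iso[OF X] by (simp add: e' dg_rename fs minimal_at_def)
      fix x assume x: "x \<in> X" "x \<in> vx e'" "x \<noteq> s"
      then obtain y where "y \<in> vx e" "x = f y" by (auto simp: e' vx_rename)
      then have "y \<in> vx e" "y \<in> f -` X" "y \<noteq> s" using x fT s(2) by auto
      then show "dg e' {s} < dg e' X" using s(1) iso[OF X] by (auto simp: e' dg_rename fs minimal_at_def)
    qed
  qed (use \<open>minimal_at (set ts) e' t\<close> in simp)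
  show "solv (set ts) e' k" if k: "solv (set ts) e k" for k
  proof -
    obtain \<phi> where \<phi>: "labelling (set ts) \<phi>" "cost e \<phi> \<le> k" using k by (auto simp: solv_def)
    define \<psi> where "\<psi> = (\<lambda>x. if x \<in> U then t else \<phi> x)"
    have UT: "U \<inter> set ts \<subseteq> {t}" using cs(2) by (simp add: iso_def)
    have \<phi>t: "\<phi> x = t" if "x \<in> {t}" for x using that \<phi>(1) t by (simp add: labelling_def)
    have tU: "{t} \<subseteq> U" using cs(1) by simp
    have m: "dg e U \<le> dg e W" if "{t} \<subseteq> W" "W \<subseteq> U" for W
      using cs(2) t that by (intro cs(3)) (auto simp: iso_def)
    have "labelling (set ts) \<psi>" "cost e \<psi> \<le> cost e \<phi>"
      using absorb[OF _ \<phi>(1) t UT \<phi>t tU m] by (simp_all add: \<psi>_def)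
    moreover have "\<psi> (f x) = \<psi> x" for x using cs(1) by (simp add: \<psi>_def f_def)
    ultimately show ?thesis using \<phi>(2) unfolding e'
      by (intro solv_rename[of _ \<psi>]) auto
  qed
qed

lemma prep_eq_rename:
  "set l \<subseteq> set ts \<Longrightarrow> \<exists>f. (\<forall>s\<in>set ts. f s = s) \<and> prep l ts es = rename f es"
proof (induction l ts es rule: prep.induct)
  case (1 ts es)
  show ?case by (rule exI[of _ id]) (simp add: rename_def)
next
  case (2 t l ts es)
  obtain f where f: "\<forall>s\<in>set ts. f s = s" "prep (t # l) ts es = rename f (ren (cutv es ts t t) t es)"
    using 2 by auto
  have "coll (cutset es ts t t) t s = s" if "s \<in> set ts" for s
    using cutset(2)[of t ts t "cutset es ts t t" es] that 2(2) by (auto simp: iso_def)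
  then show ?case using f unfolding ren_cutv rename_rename
    by (intro exI[of _ "f \<circ> coll (cutset es ts t t) t"]) (auto simp: comp_def)
qed

text \<open>Contracting for one terminal does not spoil the terminals treated before, so a single
  round makes all of them minimal.\<close>

lemma prep:
  "set l \<subseteq> set ts \<Longrightarrow> \<forall>t\<in>set ts - set l. minimal_at (set ts) es t \<Longrightarrow>
   (\<forall>t\<in>set ts. minimal_at (set ts) (prep l ts es) t) \<and>
   (\<forall>k. solv (set ts) es k \<longrightarrow> solv (set ts) (prep l ts es) k)"
proof (induction l ts es rule: prep.induct)
  case (2 t l ts es)
  have t: "t \<in> set ts" using 2(2) by simp
  have "\<forall>s\<in>set ts - set l. minimal_at (set ts) (ren (cutv es ts t t) t es) s"
    using 2(3) minimal_at_contract(1,2)[OF t] by auto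
  then show ?case using 2 minimal_at_contract(3)[OF t] by simp
qed simp

lemma deriv_prep: "loops n e \<Longrightarrow> deriv (set ts) n e k (prep ts ts e) k"
  using prep_eq_rename[of ts ts e] deriv_rename by fastforce

section \<open>The lower bound given by minimum isolating cuts, and the candidate cuts\<close>

definition msum :: "'a set \<Rightarrow> ('a \<times> 'a) list \<Rightarrow> nat" where
  "msum T e = (\<Sum>t\<in>T. mc T e t)"

lemma msum_prep: "msum (set ts) e \<le> msum (set ts) (prep ts ts e)"
proof -
  obtain f where "\<forall>s\<in>set ts. f s = s" "prep ts ts e = rename f e"
    using prep_eq_rename[of ts ts e] by auto
  then show ?thesis unfolding msum_def by (auto intro!: sum_mono mc_rename)
qed

lemma mc_minimal_at: "minimal_at T e t \<Longrightarrow> t \<in> T \<Longrightarrow> mc T e t = dg e {t}"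
  by (intro antisym mc_le mc_ge) (auto simp: minimal_at_def iso_def)

lemma msum_eq_tdeg:
  "distinct ts \<Longrightarrow> \<forall>t\<in>set ts. minimal_at (set ts) e t \<Longrightarrow> msum (set ts) e = tdeg ts e"
  by (simp add: msum_def tdeg_eq mc_minimal_at)

lemma msum_le_solv: "solv (set ts) e k \<Longrightarrow> msum (set ts) e \<le> 2 * k"
  using sum_mc_le_cost[of "set ts" _ e] unfolding solv_def msum_def
  by (meson List.finite_set le_trans mult_le_mono2)

lemma msum_change:
  assumes "finite T" "t \<in> T" "\<And>s. s \<in> T \<Longrightarrow> s \<noteq> t \<Longrightarrow> mc T e s \<le> mc T e' s"
    "mc T e t + a \<le> mc T e' t + b"
  shows "msum T e + a \<le> msum T e' + b"
proof -
  have "(\<Sum>s\<in>T - {t}. mc T e s) \<le> (\<Sum>s\<in>T - {t}. mc T e' s)" using assms(3) by (intro sum_mono) auto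
  then show ?thesis using assms(1,2,4) by (simp add: msum_def sum.remove)
qed

lemma cands_not_Nil:
  "cands l ts es k \<noteq> [] \<Longrightarrow>
   \<exists>t\<in>set l. cands l ts es k = rename (\<lambda>x. if x \<in> set ts then x else t) es \<and> cost (cands l ts es k) id \<le> k"
  by (induction l ts es k rule: cands.induct) (auto simp: Let_def split: if_splits)

text \<open>For an empty edge list \<open>[]\<close> could also be a success; the loops in the list
  exclude this whenever the lemma is applied.\<close>

lemma cands_Nil:
  "cands l ts es k = [] \<Longrightarrow> es \<noteq> [] \<Longrightarrow> t \<in> set l \<Longrightarrow>
   k < cost (rename (\<lambda>x. if x \<in> set ts then x else t) es) id"
  by (induction l ts es k rule: cands.induct) (auto simp: Let_def rename_def split: if_splits)

text \<open>The candidate cuts an edge only if the edge has a terminal end other than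
  \<open>t\<close>. These ends pay for the cost, and the ends at \<open>t\<close> remain in
  \<open>tdeg\<close> to pay for the degree of \<open>t\<close>.\<close>

lemma cost_cand_le:
  assumes "t \<in> set ts"
  shows "cost (rename (\<lambda>x. if x \<in> set ts then x else t) es) id + dg es {t} \<le> tdeg ts es"
  using assms
proof (induction ts es rule: tdeg.induct)
  case (2 ts u v es)
  then show ?case by (auto simp: cost_Cons dg_Cons)
qed simp

section \<open>Correctness and measure of a branching step\<close>

text \<open>The drops are listed in the order of the children. The pattern \<open>[1]\<close>, and
  in the three-way case also \<open>[2, 1]\<close>, arises when \<open>z\<close> or \<open>a\<close>
  is a terminal or \<open>a\<close> does not exist.\<close>

definition drops :: "nat list set" where
  "drops = {[1], [2, 1], [1, 2], [2, 3, 1]}"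

definition kid_drop :: "'a set \<Rightarrow> ('a \<times> 'a) list \<Rightarrow> nat \<Rightarrow> (('a \<times> 'a) list \<times> nat) \<Rightarrow> nat \<Rightarrow> bool" where
  "kid_drop T e k c d \<longleftrightarrow>
     2 * int (snd c) - int (msum T (fst c)) \<le> 2 * int k - int (msum T e) - int d"

definition good_kids :: "'a set \<Rightarrow> nat \<Rightarrow> ('a \<times> 'a) list \<Rightarrow> nat \<Rightarrow> (('a \<times> 'a) list \<times> nat) list \<Rightarrow> bool" where
  "good_kids T n e k cs \<longleftrightarrow>
     (\<forall>(e', k') \<in> set cs. deriv T n e k e' k') \<and>
     (solv T e k \<longrightarrow> (\<exists>(e', k') \<in> set cs. solv T e' k')) \<and>
     (\<exists>ds\<in>drops. list_all2 (kid_drop T e k) cs ds)"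

text \<open>An instance that is prepared and not settled by \<open>cands\<close>. The budget
  condition makes \<open>k\<close> at least 2 at any branching edge, so the truncated subtractions
  \<open>k - 1\<close> and \<open>k - 2\<close> are exact.\<close>

locale node =
  fixes ts :: "'a list" and e :: "('a \<times> 'a) list" and k n :: nat
  assumes dist: "distinct ts"
    and minimal: "\<And>t. t \<in> set ts \<Longrightarrow> minimal_at (set ts) e t"
    and budget: "\<And>t. t \<in> set ts \<Longrightarrow> dg e {t} + 1 \<le> k"
    and loops: "loops n e"
begin

abbreviation "T \<equiv> set ts"

lemma mc_eq: "t \<in> T \<Longrightarrow> mc T e t = dg e {t}"
  by (rule mc_minimal_at[OF minimal])

lemma le_iso: "iso T t X \<Longrightarrow> dg e {t} \<le> dg e X"
  using minimal[OF iso_T, of t X] by (simp add: minimal_at_def)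

lemma less_iso: "iso T t X \<Longrightarrow> x \<in> X \<Longrightarrow> x \<in> vx e \<Longrightarrow> x \<noteq> t \<Longrightarrow> Suc (dg e {t}) \<le> dg e X"
  using minimal[OF iso_T, of t X] by (simp add: minimal_at_def Suc_le_eq)

lemma singleton_if_dg_eq: "iso T t X \<Longrightarrow> dg e X = dg e {t} \<Longrightarrow> X \<inter> vx e \<subseteq> {t}"
  using less_iso[of t X] by (auto dest: Suc_le_lessD)

end

lemma in_set_vx: "(x, y) \<in> set l \<Longrightarrow> x \<in> vx l \<and> y \<in> vx l"
  unfolding vx_def by (metis UnI1 UnI2 fst_conv imageI snd_conv)

lemma edge_vx: "(x, y) \<in> set (dbl e) \<Longrightarrow> x \<in> vx e \<and> y \<in> vx e"
  by (drule in_set_vx) simp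

lemma dbl_sym: "(x, y) \<in> set (dbl e) \<longleftrightarrow> (y, x) \<in> set (dbl e)"
  by (induction e rule: dbl.induct) auto

lemma wt_pos_iff_dbl: "0 < wt e A B \<longleftrightarrow> (\<exists>u\<in>A. \<exists>v\<in>B. (u, v) \<in> set (dbl e))"
  by (auto simp: wt_pos_iff dbl_set)

text \<open>Passing from \<open>{t}\<close> to \<open>U\<close> trades the edges from
  \<open>t\<close> into \<open>U\<close> for the edges that leave \<open>U\<close> from its other
  vertices. If \<open>U\<close> exceeds \<open>{t}\<close> by 1, there is just one more of the
  latter.\<close>

lemma dg_neighbours: "t \<in> U \<Longrightarrow> dg e U + wt e {t} (U - {t}) = dg e {t} + wt e (U - {t}) (- U)"
  by (induction e) (auto simp: wt_Cons dg_Cons of_bool_def)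

lemma wt_mono_vx: "A \<inter> vx e \<subseteq> A' \<Longrightarrow> B \<inter> vx e \<subseteq> B' \<Longrightarrow> wt e A B \<le> wt e A' B'"
proof (induction e)
  case (Cons a e)
  obtain u v where a: "a = (u, v)" by (cases a)
  have "u \<in> A \<longrightarrow> u \<in> A'" "v \<in> A \<longrightarrow> v \<in> A'" "u \<in> B \<longrightarrow> u \<in> B'" "v \<in> B \<longrightarrow> v \<in> B'"
    using Cons.prems by (auto simp: a)
  moreover have "wt e A B \<le> wt e A' B'" using Cons.prems by (intro Cons.IH) (auto simp: a)
  ultimately show ?case by (auto simp: a wt_Cons)
qed simp

text \<open>Of the two orientations of an edge in the doubled list exactly one starts on the side of
  \<open>t\<close>, so nothing is counted twice.\<close>

lemma filter_outs:
  "length (filter P (outs H t (dbl e))) = wt e (- heads H - {t}) (heads H \<inter> {x. P x})"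
  by (induction e) (auto simp: wt_Cons look_eq_Nil_iff)

lemma outs_set: "set (outs H t l) = {b. \<exists>a. (a, b) \<in> set l \<and> a \<noteq> t \<and> a \<notin> heads H \<and> b \<in> heads H}"
  by (induction H t l rule: outs.induct) (auto simp: look_eq_Nil_iff)

text \<open>
  Taking the vertices other than \<open>t\<close> of a side out of the part of \<open>t\<close> and into the part of an
  outside neighbour \<open>z\<close> saves the edges to \<open>z\<close>.
\<close>

lemma cost_flip:
  fixes e :: "('a \<times> 'a) list"
  assumes U: "U = - heads H" and "t \<in> U" and \<phi>: "\<And>x. x \<in> U \<Longrightarrow> \<phi> x = t"
    and c: "c \<noteq> t" "\<phi> z = c" and ys: "\<And>y. y \<in> set (outs H t (dbl e)) \<Longrightarrow> \<phi> y \<noteq> t"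
  shows "cost e (\<lambda>x. if x \<in> U - {t} then c else \<phi> x) + length (outs H t (dbl e))
    \<le> cost e \<phi> + wt e {t} (U - {t}) + length (filter (\<lambda>y. y \<noteq> z) (outs H t (dbl e)))"
  using ys
proof (induction e)
  case (Cons a e)
  obtain x y where a: "a = (x, y)" by (cases a)
  have look: "look r H = [] \<longleftrightarrow> r \<in> U" for r by (simp add: look_eq_Nil_iff U)
  have "cost e (\<lambda>x. if x \<in> U - {t} then c else \<phi> x) + length (outs H t (dbl e))
    \<le> cost e \<phi> + wt e {t} (U - {t}) + length (filter (\<lambda>y. y \<noteq> z) (outs H t (dbl e)))"
    using Cons.prems by (intro Cons.IH) (auto simp: a)
  moreover have "\<phi> y \<noteq> t" if "x \<in> U" "x \<noteq> t" "y \<notin> U"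
    using Cons.prems[of y] that by (simp add: a look)
  moreover have "\<phi> x \<noteq> t" if "y \<in> U" "y \<noteq> t" "x \<notin> U"
    using Cons.prems[of x] that by (simp add: a look)
  ultimately show ?case using \<phi>[of x] \<phi>[of y] \<open>t \<in> U\<close> c
    by (cases "x \<in> U"; cases "y \<in> U"; cases "x = t"; cases "y = t")
      (auto simp: a look cost_Cons wt_Cons of_bool_def split: if_splits)
qed simp

lemma pick_not_Nil_iff:
  "pick zs ys \<noteq> [] \<longleftrightarrow> (\<exists>z\<in>set zs. length (filter (\<lambda>y. y \<noteq> z) ys) \<le> 1)"
  by (induction zs ys rule: pick.induct) (auto simp: Let_def)

lemma pick_Cons:
  "pick zs ys = z # r \<Longrightarrow> z \<in> set zs \<and> r = filter (\<lambda>y. y \<noteq> z) ys \<and> length r \<le> 1"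
  by (induction zs ys rule: pick.induct) (auto simp: Let_def split: if_splits)

lemma two_not_Nil:
  "two l ts e1 H t d k \<noteq> [] \<Longrightarrow> \<exists>b. (t, b) \<in> set l \<and> b \<noteq> t \<and> b \<notin> heads H \<and>
     two l ts e1 H t d k = [(prep ts ts (del t b e1), k - 2)] \<and> d \<le> tdeg ts (prep ts ts (del t b e1)) + 2"
  by (induction l ts e1 H t d k rule: two.induct) (auto simp: Let_def look_eq_Nil_iff split: if_splits)

lemma two_Nil:
  "two l ts e1 H t d k = [] \<Longrightarrow> (t, b) \<in> set l \<Longrightarrow> b \<noteq> t \<Longrightarrow> b \<notin> heads H \<Longrightarrow>
     tdeg ts (prep ts ts (del t b e1)) + 2 < d"
  by (induction l ts e1 H t d k rule: two.induct) (auto simp: Let_def look_eq_Nil_iff split: if_splits)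

section \<open>Branching on an edge from a terminal to a non-terminal\<close>

locale branch = node +
  fixes t v
  assumes t: "t \<in> set ts" and v: "v \<notin> set ts" and edge: "(t, v) \<in> set (dbl e)"
begin

definition "H = cutv e ts t v"
definition "U = cutset e ts t v"
definition "e1 = del t v e"
definition "e2 = rename (coll U t) e"

lemma U_heads: "U = - heads H"
  by (simp add: U_def H_def cutset_def)

lemma e2_ren: "ren H t e = e2"
  by (simp add: e2_def U_def H_def ren_cutv)

lemmas U = cutset[OF t disjI1[OF v] U_def]

lemma t_U: "t \<in> U" and U_T: "U \<inter> T = {t}" and tv: "t \<noteq> v" and v_vx: "v \<in> vx e" and t_vx: "t \<in> vx e"
  using U(2) t v edge_vx[OF edge] by (auto simp: iso_def)

lemma coll_T: "s \<in> T \<Longrightarrow> coll U t s = s"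
  using U_T by auto

lemma dg_U: "Suc (dg e {t}) \<le> dg e U"
  using less_iso[OF U(2) U(1) v_vx] tv by auto

lemma iso_above_U: "iso T t X \<Longrightarrow> U \<subseteq> X \<Longrightarrow> dg e U \<le> dg e X"
  using U by blast

lemma tdeg_e2: "tdeg ts e2 + dg e {t} = tdeg ts e + dg e U"
proof -
  have "dg e2 {s} = dg e {s}" if "s \<in> T - {t}" for s
  proof -
    have "s \<notin> U" using that U_T by blast
    then show ?thesis using that coll_vimage_other[of s t U] by (simp add: e2_def dg_rename)
  qed
  moreover have "dg e2 {t} = dg e U"
    using coll_vimage_same[OF t_U] by (simp add: e2_def dg_rename)
  ultimately show ?thesis using t by (simp add: tdeg_eq[OF dist] sum.remove)
qed

text \<open>Cuts of \<open>t\<close> in the contracted graph correspond to cuts containing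
  \<open>U\<close>, so \<open>t\<close> gains the excess of \<open>U\<close>; a contraction never
  costs the other terminals anything.\<close>

lemma msum_e2: "msum T e + dg e U \<le> msum T e2 + dg e {t}"
proof (rule msum_change[OF _ t])
  show "mc T e s \<le> mc T e2 s" if "s \<in> T" for s
    unfolding e2_def using that coll_T by (intro mc_rename)
  have "dg e U \<le> mc T e2 t" unfolding e2_def
    using t coll_T iso_above_U coll_vimage_same[OF t_U] by (intro mc_rename_ge) auto
  then show "mc T e t + dg e U \<le> mc T e2 t + dg e {t}" by (simp add: mc_eq[OF t])
qed simp

text \<open>A cut of \<open>s\<close> loses the deleted edge only if it contains \<open>x\<close>,
  and then strict minimality at \<open>s\<close> leaves one unit to spare.\<close>

lemma mc_del_other:
  assumes "s \<in> T" "s \<noteq> t" "x \<in> vx e" "x \<notin> T" shows "mc T e s \<le> mc T (del t x e) s"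
proof (rule mc_ge[OF assms(1)])
  fix X assume X: "iso T s X"
  have "t \<notin> X" using X t assms(2) by (auto simp: iso_def)
  then have "dg e X \<le> dg (del t x e) X + of_bool (x \<in> X)" using dg_le_del[of e X t x] by simp
  moreover have "Suc (dg e {s}) \<le> dg e X" if "x \<in> X" using less_iso[OF X that] assms by auto
  ultimately show "mc T e s \<le> dg (del t x e) X"
    using le_iso[OF X] mc_eq[OF assms(1)] by (cases "x \<in> X") auto
qed

lemma msum_e1: "msum T e \<le> msum T e1 + 1"
proof -
  have "msum T e + 0 \<le> msum T e1 + 1"
  proof (rule msum_change[OF _ t])
    show "mc T e s \<le> mc T e1 s" if "s \<in> T" "s \<noteq> t" for s
      unfolding e1_def using that v v_vx by (intro mc_del_other)
    have "mc T e t - 1 \<le> mc T e1 t"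
    proof (rule mc_ge[OF t])
      fix X assume "iso T t X"
      then have "mc T e t \<le> dg e X" by (rule mc_le)
      also have "\<dots> \<le> dg e1 X + 1"
        using dg_le_del[of e X t v] by (auto simp: e1_def of_bool_def split: if_splits)
      finally show "mc T e t - 1 \<le> dg e1 X" by simp
    qed
    then show "mc T e t + 0 \<le> mc T e1 t + 1" by simp
  qed simp
  then show ?thesis by simp
qed

lemma k_ge: "2 \<le> k"
proof -
  have "of_bool True \<le> dg e {t}" using dg_del[OF edge, of "{t}"] tv by simp
  then show ?thesis using budget[OF t] by simp
qed

lemma deriv_e2: "deriv T n e k e2 k"
  unfolding e2_def using loops coll_T by (rule deriv_rename)

lemma deriv_e1: "deriv T n e k e1 (k - 1)"
  unfolding e1_def using k_ge by (intro deriv_del loops tv) simp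

text \<open>This is \<open>absorb\<close> with \<open>S = {t, x}\<close>. The witness
  \<open>x\<close> need not be \<open>v\<close>: in the tight case any vertex of \<open>U\<close>
  other than \<open>t\<close> can take its place.\<close>

lemma solv_e2:
  assumes \<phi>: "labelling T \<phi>" "cost e \<phi> \<le> k" and x: "x \<in> U" "\<phi> x = t"
    and min: "\<And>W. t \<in> W \<Longrightarrow> x \<in> W \<Longrightarrow> W \<subseteq> U \<Longrightarrow> dg e U \<le> dg e W"
  defines "\<psi> \<equiv> \<lambda>y. if y \<in> U then t else \<phi> y"
  shows "labelling T \<psi>" "cost e \<psi> \<le> k" "cost e2 \<psi> \<le> k"
proof -
  have S: "\<phi> y = t" if "y \<in> {t, x}" for y using that x \<phi>(1) t by (auto simp: labelling_def)
  have UT: "U \<inter> T \<subseteq> {t}" and SU: "{t, x} \<subseteq> U" using U_T t_U x(1) by auto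
  have m: "dg e U \<le> dg e W" if "{t, x} \<subseteq> W" "W \<subseteq> U" for W
    using that by (intro min) auto
  have "labelling T \<psi>" "cost e \<psi> \<le> cost e \<phi>"
    unfolding \<psi>_def by (rule absorb[OF _ \<phi>(1) t UT S SU m]; simp)+
  then show *: "labelling T \<psi>" "cost e \<psi> \<le> k" using \<phi>(2) by auto
  have "\<psi> \<circ> coll U t = \<psi>" using t_U by (auto simp: \<psi>_def)
  then show "cost e2 \<psi> \<le> k" using * by (simp add: e2_def cost_rename)
qed

lemma solv_e1: "labelling T \<phi> \<Longrightarrow> cost e \<phi> \<le> k \<Longrightarrow> \<phi> v \<noteq> t \<Longrightarrow> solv T e1 (k - 1)"
  using cost_del[OF edge, of \<phi>] t unfolding solv_def e1_def labelling_def by force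

lemma good_kids_large:
  assumes "tdeg ts e + 1 < tdeg ts e2" shows "good_kids T n e k [(e2, k), (e1, k - 1)]"
  unfolding good_kids_def
proof (intro conjI impI)
  show "\<forall>(e', k')\<in>set [(e2, k), (e1, k - 1)]. deriv T n e k e' k'"
    using deriv_e1 deriv_e2 by auto
  have "kid_drop T e k (e2, k) 2"
    using assms tdeg_e2 msum_e2 by (simp add: kid_drop_def)
  moreover have "kid_drop T e k (e1, k - 1) 1"
    using k_ge msum_e1 by (simp add: kid_drop_def of_nat_diff)
  ultimately show "\<exists>ds\<in>drops. list_all2 (kid_drop T e k) [(e2, k), (e1, k - 1)] ds"
    by (intro bexI[of _ "[2, 1]"]) (auto simp: drops_def)
  assume "solv T e k"
  then obtain \<phi> where \<phi>: "labelling T \<phi>" "cost e \<phi> \<le> k" by (auto simp: solv_def)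
  show "\<exists>(e', k')\<in>set [(e2, k), (e1, k - 1)]. solv T e' k'"
  proof (cases "\<phi> v = t")
    case True
    have "dg e U \<le> dg e W" if "t \<in> W" "v \<in> W" "W \<subseteq> U" for W
      using that U_T by (intro U(3)) (auto simp: iso_def)
    then have "solv T e2 k" using solv_e2[OF \<phi> U(1) True] unfolding solv_def by blast
    then show ?thesis by simp
  next
    case False
    then show ?thesis using solv_e1[OF \<phi>] by simp
  qed
qed

end

locale tight_branch = branch +
  assumes tight: "\<not> tdeg ts e + 1 < tdeg ts e2"
begin

lemma dg_U_eq: "dg e U = Suc (dg e {t})"
  using tight tdeg_e2 dg_U by simp

text \<open>As \<open>U\<close> exceeds the minimum by only 1, strict minimality makes it a cheapest
  cut around each of its graph vertices other than \<open>t\<close>, not only around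
  \<open>v\<close>.\<close>

lemma min_U: "x \<in> U \<Longrightarrow> x \<in> vx e \<Longrightarrow> x \<noteq> t \<Longrightarrow> t \<in> W \<Longrightarrow> x \<in> W \<Longrightarrow> W \<subseteq> U \<Longrightarrow> dg e U \<le> dg e W"
  unfolding dg_U_eq using U_T by (intro less_iso[of t W x]) (auto simp: iso_def)

text \<open>By the maximality of \<open>U\<close> every isolating cut properly above it costs at
  least one more. This makes contracting a further vertex drop the measure by 2.\<close>

lemma above_U: "iso T t X \<Longrightarrow> U \<subseteq> X \<Longrightarrow> z \<in> X \<Longrightarrow> z \<notin> U \<Longrightarrow> dg e {t} + 2 \<le> dg e X"
  using U(4)[of X] U(1) dg_U_eq by fastforce

lemma kid_e2: "kid_drop T e k (e2, k) 1"
  using dg_U_eq msum_e2 by (simp add: kid_drop_def)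

lemma kid_e1: "kid_drop T e k (e1, k - 1) 1"
  using k_ge msum_e1 by (simp add: kid_drop_def of_nat_diff)

text \<open>If no vertex of \<open>U - {t}\<close> belongs to \<open>t\<close>, both
  \<open>t v\<close> and \<open>t b\<close> are cut. Then \<open>2 * k\<close> falls by 4 and
  \<open>msum\<close> by at most 2. Otherwise the part of \<open>t\<close> can take all of
  \<open>U\<close>.\<close>

lemma good_kids_two:
  assumes b: "(t, b) \<in> set (dbl e1)" "b \<noteq> t" "b \<in> U"
  defines "e4 \<equiv> prep ts ts (del t b e1)"
  assumes deg: "tdeg ts e \<le> tdeg ts e4 + 2"
  shows "good_kids T n e k [(e2, k), (e4, k - 2)]"
  unfolding good_kids_def
proof (intro conjI impI)
  have k: "k - 2 = k - 1 - 1" by simp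
  have l1: "loops n e1" using deriv_e1 by (simp add: deriv_def)
  have d3: "deriv T n e1 (k - 1) (del t b e1) (k - 2)"
    unfolding k using k_ge b by (intro deriv_del l1) auto
  then have "loops n (del t b e1)" by (simp add: deriv_def)
  then have "deriv T n (del t b e1) (k - 2) e4 (k - 2)" unfolding e4_def by (rule deriv_prep)
  then have "deriv T n e k e4 (k - 2)" using deriv_e1 d3 deriv_trans by blast
  then show "\<forall>(e', k')\<in>set [(e2, k), (e4, k - 2)]. deriv T n e k e' k'"
    using deriv_e2 by auto
  have p4: "\<forall>t\<in>T. minimal_at T e4 t" "\<And>k. solv T (del t b e1) k \<Longrightarrow> solv T e4 k"
    using prep[of ts ts "del t b e1"] by (auto simp: e4_def)
  have "msum T e \<le> msum T e4 + 2"
    using deg msum_eq_tdeg[OF dist] p4(1) minimal by simp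
  then have "kid_drop T e k (e4, k - 2) 2"
    using k_ge by (simp add: kid_drop_def of_nat_diff)
  then show "\<exists>ds\<in>drops. list_all2 (kid_drop T e k) [(e2, k), (e4, k - 2)] ds"
    using kid_e2 by (intro bexI[of _ "[1, 2]"]) (auto simp: drops_def)
  assume "solv T e k"
  then obtain \<phi> where \<phi>: "labelling T \<phi>" "cost e \<phi> \<le> k" by (auto simp: solv_def)
  show "\<exists>(e', k')\<in>set [(e2, k), (e4, k - 2)]. solv T e' k'"
  proof (cases "\<exists>x\<in>U. x \<in> vx e \<and> x \<noteq> t \<and> \<phi> x = t")
    case True
    then have "solv T e2 k" using solv_e2[OF \<phi>] min_U unfolding solv_def by blast
    then show ?thesis by simp
  next
    case False
    have "b \<in> vx e" using edge_vx[OF b(1)] vx_del[of t v e] by (auto simp: e1_def)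
    then have "\<phi> b \<noteq> t" "\<phi> v \<noteq> t" using False b U(1) v_vx tv by auto
    moreover have "\<phi> t = t" using \<phi> t by (simp add: labelling_def)
    ultimately have "cost (del t b e1) \<phi> + 2 = cost e \<phi>"
      using cost_del[OF edge, of \<phi>] cost_del[OF b(1), of \<phi>] by (simp add: e1_def)
    then have "solv T (del t b e1) (k - 2)" using \<phi> unfolding solv_def by force
    then show ?thesis using p4(2) by simp
  qed
qed

abbreviation "ys \<equiv> outs H t (dbl e)"

lemma length_ys: "length ys = Suc (wt e {t} (U - {t}))"
proof -
  have "length ys = wt e (U - {t}) (- U)"
    using filter_outs[of "\<lambda>_. True" H t e] by (simp add: U_heads)
  then show ?thesis using dg_neighbours[OF t_U, of e] dg_U_eq by simp
qed

lemma ys_notin_U: "y \<in> set ys \<Longrightarrow> y \<notin> U \<and> y \<in> vx e \<and> (\<exists>a\<in>U. (a, y) \<in> set (dbl e))"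
  unfolding outs_set using edge_vx by (fastforce simp: U_heads)

lemma t_notin_ys: "t \<notin> set ys"
  using ys_notin_U t_U by blast

end

lemma dbl_rename: "dbl (rename f e) = rename f (dbl e)"
  by (induction e rule: dbl.induct) auto

lemma msum_change_sum:
  assumes "\<And>s. s \<in> T \<Longrightarrow> mc T e s + a s \<le> mc T e' s + b s"
  shows "msum T e + sum a T \<le> msum T e' + sum b T"
  unfolding msum_def using sum_mono[of T "\<lambda>s. mc T e s + a s" "\<lambda>s. mc T e' s + b s"] assms
  by (simp add: sum.distrib)

section \<open>Contracting \<open>U\<close> together with one more vertex\<close>

context tight_branch
begin

definition "grab y = rename (merge y t) e2"
definition "gr y = merge y t \<circ> coll U t"

lemma gr: "gr y x = (if x \<in> U \<or> x = y then t else x)"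
  by (simp add: gr_def)

lemma grab_rename: "grab y = rename (gr y) e"
  by (simp add: grab_def e2_def rename_rename gr_def)

lemma grab_T: "y \<notin> T \<Longrightarrow> s \<in> T \<Longrightarrow> gr y s = s"
  using coll_T[of s] unfolding gr by metis

lemma grab_iso:
  assumes "y \<notin> T" "iso T s X" shows "iso T s (gr y -` X)"
proof -
  have "x \<in> gr y -` X \<longleftrightarrow> x \<in> X" if "x \<in> T" for x
    using grab_T[OF assms(1) that] by simp
  then show ?thesis using assms(2) unfolding iso_def by blast
qed

lemma deriv_grab: "y \<notin> T \<Longrightarrow> deriv T n e k (grab y) k"
  unfolding grab_rename by (intro deriv_rename loops grab_T)

lemma mc_grab: "y \<notin> T \<Longrightarrow> s \<in> T \<Longrightarrow> mc T e s \<le> mc T (grab y) s"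
  unfolding grab_rename by (intro mc_rename grab_T)

lemma mc_grab_t:
  assumes "y \<notin> T" "y \<notin> U" shows "mc T e t + 2 \<le> mc T (grab y) t"
  unfolding grab_rename mc_eq[OF t]
proof (rule mc_rename_ge[OF t])
  show "gr y s = s" if "s \<in> T" for s
    using assms(1) that by (rule grab_T)
  fix X assume X: "iso T t X" "gr y -` {t} \<subseteq> X"
  have "U \<subseteq> X" "y \<in> X" using X(2) by (auto simp: gr)
  then show "dg e {t} + 2 \<le> dg e X" using above_U X(1) assms(2) by blast
qed

lemma cost_grab:
  assumes "\<And>x. x \<in> U \<Longrightarrow> \<phi> x = t" "\<phi> y = t" shows "cost (grab y) \<phi> = cost e \<phi>"
proof -
  have "\<phi> (gr y x) = \<phi> x" for x using assms t_U unfolding gr by metis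
  then have "\<phi> \<circ> gr y = \<phi>" by (simp add: comp_def)
  then show ?thesis by (simp add: grab_rename cost_rename)
qed

lemma msum_grab: "y \<notin> T \<Longrightarrow> y \<notin> U \<Longrightarrow> msum T e + 2 \<le> msum T (grab y) + 0"
  using mc_grab mc_grab_t by (intro msum_change[OF _ t]) auto

lemma edge_grab:
  assumes "z \<in> set ys" "y \<noteq> z" shows "(t, z) \<in> set (dbl (grab y))"
proof -
  obtain a where a: "a \<in> U" "(a, z) \<in> set (dbl e)" "z \<notin> U" using assms(1) ys_notin_U by blast
  have "(gr y a, gr y z) \<in> set (rename (gr y) (dbl e))"
    using a(2) by (force simp: rename_def)
  then show ?thesis using a assms(2) by (simp add: grab_rename dbl_rename gr)
qed

text \<open>The contraction gives \<open>t\<close> two units, of which the deletion takes back one.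
  Another terminal can lose only through a cut containing \<open>z\<close>, and strict minimality
  compensates for that unless \<open>z\<close> is this terminal.\<close>

lemma msum_grab_del:
  assumes y: "y \<notin> T" "y \<notin> U" and z: "z \<in> set ys" "y \<noteq> z"
  shows "msum T e + 1 \<le> msum T (del t z (grab y)) + of_bool (z \<in> T)"
proof -
  let ?c = "del t z (grab y)"
  have z': "z \<notin> U" "z \<in> vx e" using ys_notin_U z by auto
  have "mc T e s + of_bool (s = t) \<le> mc T ?c s + of_bool (s = z)" if s: "s \<in> T" for s
  proof (cases "s = t")
    case True
    have "mc T e t + 1 \<le> mc T ?c t"
    proof (rule mc_ge[OF t])
      fix X assume "iso T t X"
      then have "mc T (grab y) t \<le> dg (grab y) X" by (rule mc_le)
      also have "\<dots> \<le> dg ?c X + 1"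
        using dg_le_del[of "grab y" X t z] by (auto simp: of_bool_def split: if_splits)
      finally show "mc T e t + 1 \<le> dg ?c X" using mc_grab_t[OF y] by simp
    qed
    then show ?thesis using True by simp
  next
    case False
    have "mc T e s - of_bool (s = z) \<le> mc T ?c s"
    proof (rule mc_ge[OF s])
      fix X assume X: "iso T s X"
      have tX: "t \<notin> X" using X t False by (auto simp: iso_def)
      define X' where "X' = gr y -` X"
      have X': "iso T s X'" unfolding X'_def using y(1) X by (rule grab_iso)
      have "dg (grab y) X = dg e X'" by (simp add: grab_rename dg_rename X'_def)
      then have *: "dg e X' \<le> dg ?c X + of_bool (z \<in> X)"
        using dg_le_del[of "grab y" X t z] tX by simp
      have "z \<in> X'" if "z \<in> X" using that z z'(1) by (auto simp: X'_def gr)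
      then have "Suc (dg e {s}) \<le> dg e X'" if "z \<in> X" "z \<noteq> s"
        using less_iso[OF X', of z] that z'(2) by blast
      then show "mc T e s - of_bool (s = z) \<le> dg ?c X"
        using * le_iso[OF X'] mc_eq[OF s] by (cases "z \<in> X"; cases "z = s") auto
    qed
    then show ?thesis using False by simp
  qed
  from msum_change_sum[OF this]
  show ?thesis using t by (simp add: of_bool_def)
qed

lemma kid_grab: "y \<notin> T \<Longrightarrow> y \<notin> U \<Longrightarrow> kid_drop T e k (grab y, k) 2"
  using msum_grab[of y] by (simp add: kid_drop_def)

lemma kid_grab_del:
  "y \<notin> T \<Longrightarrow> y \<notin> U \<Longrightarrow> z \<in> set ys \<Longrightarrow> y \<noteq> z \<Longrightarrow>
   kid_drop T e k (del t z (grab y), k - 1) (if z \<in> T then 2 else 3)"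
  using msum_grab_del[of y z] k_ge by (auto simp: kid_drop_def of_nat_diff)

lemma deriv_grab_del:
  assumes "y \<notin> T" "z \<in> set ys" shows "deriv T n e k (del t z (grab y)) (k - 1)"
proof (rule deriv_trans[OF deriv_grab[OF assms(1)]])
  have "loops n (grab y)" using deriv_grab[OF assms(1)] by (simp add: deriv_def)
  then show "deriv T n (grab y) k (del t z (grab y)) (k - 1)"
    using k_ge t_notin_ys assms(2) by (intro deriv_del) auto
qed

lemma good_kids_three:
  assumes p: "pick ys ys = z # r"
  shows "good_kids T n e k (three (z # r) ts t e1 e2 k)"
proof -
  define cs where "cs = three (z # r) ts t e1 e2 k"
  have z: "z \<in> set ys" "z \<notin> U" and r: "r = filter (\<lambda>y. y \<noteq> z) ys" "length r \<le> 1"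
    using pick_Cons[OF p] ys_notin_U by auto
  obtain a where "r = [] \<or> r = [a]" using r(2) by (cases r; cases "tl r") auto
  then have ra: "r = [] \<or> r = [a] \<and> a \<in> set ys \<and> a \<notin> U \<and> a \<noteq> z"
  proof
    assume "r = [a]"
    then have "a \<in> set (filter (\<lambda>y. y \<noteq> z) ys)" using r(1) by (metis list.set_intros(1))
    then show ?thesis using \<open>r = [a]\<close> ys_notin_U by auto
  qed simp
  have set_cs: "set cs = (if z \<in> T then {} else {(grab z, k)}) \<union>
      (if r = [a] \<and> a \<notin> T then {(del t z (grab a), k - 1)} else {}) \<union> {(e1, k - 1)}"
    using ra by (auto simp: grab_def cs_def)
  have d: "\<forall>(e', k')\<in>set cs. deriv T n e k e' k'"
    using deriv_grab[of z] deriv_grab_del[OF _ z(1), of a] deriv_e1 by (simp add: set_cs)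
  \<comment> \<open>The middle drop is 2 instead of 3 if \<open>z\<close> is a terminal, since the
    deleted edge then also lowers the bound for \<open>z\<close>.\<close>
  define ds where "ds = (if z \<in> T then [] else [2::nat]) @
    (if r = [a] \<and> a \<notin> T then [if z \<in> T then 2 else 3] else []) @ [1]"
  have "list_all2 (kid_drop T e k) cs ds"
    using ra kid_grab[of z] kid_grab_del[of a z] z kid_e1
    by (auto simp: ds_def grab_def cs_def)
  moreover have "ds \<in> drops" by (auto simp: ds_def drops_def)
  ultimately have l: "\<exists>ds\<in>drops. list_all2 (kid_drop T e k) cs ds" by blast
  have "\<exists>(e', k')\<in>set cs. solv T e' k'" if "solv T e k"
  proof -
    obtain \<phi> where \<phi>: "labelling T \<phi>" "cost e \<phi> \<le> k" using \<open>solv T e k\<close> by (auto simp: solv_def)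
    show ?thesis
    proof (cases "\<exists>x\<in>U. x \<in> vx e \<and> x \<noteq> t \<and> \<phi> x = t")
      case True
      define \<psi> where "\<psi> = (\<lambda>y. if y \<in> U then t else \<phi> y)"
      obtain x where x: "x \<in> U" "x \<in> vx e" "x \<noteq> t" "\<phi> x = t" using True by blast
      have m: "dg e U \<le> dg e W" if "t \<in> W" "x \<in> W" "W \<subseteq> U" for W
        using x(1-3) that by (rule min_U)
      have \<psi>: "labelling T \<psi>" "cost e \<psi> \<le> k"
        unfolding \<psi>_def by (rule solv_e2[OF \<phi> x(1,4) m]; assumption)+
      have \<psi>U: "\<psi> x = t" if "x \<in> U" for x using that by (simp add: \<psi>_def)
      have \<psi>T: "x \<notin> T" if "\<psi> x = t" "x \<noteq> t" for x
        using that \<psi>(1) unfolding labelling_def by metis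
      have tz: "z \<noteq> t" using z(1) t_notin_ys by blast
      consider "\<psi> z = t" | "\<psi> z \<noteq> t" "r = [a]" "\<psi> a = t" | "\<psi> z \<noteq> t" "r = [a] \<longrightarrow> \<psi> a \<noteq> t"
        by blast
      then show ?thesis
      proof cases
        case 1
        then have "solv T (grab z) k" using \<psi> cost_grab[of \<psi> z, OF \<psi>U] unfolding solv_def by metis
        then show ?thesis using \<psi>T[OF 1 tz] by (simp add: set_cs)
      next
        case 2
        have a: "a \<in> set ys" "a \<noteq> z" "a \<noteq> t" using ra 2(2) t_notin_ys by auto
        have "cost (del t z (grab a)) \<psi> + 1 = cost e \<psi>"
          using cost_del[OF edge_grab[OF z(1) a(2)], of \<psi>] cost_grab[of \<psi> a, OF \<psi>U] 2 \<psi>U[OF t_U]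
          by simp
        then have "solv T (del t z (grab a)) (k - 1)" using \<psi> unfolding solv_def by force
        then show ?thesis using \<psi>T[OF 2(3) a(3)] 2(2) by (simp add: set_cs)
      next
        case 3
        \<comment> \<open>Every edge leaving \<open>U - {t}\<close> towards the outside is already
          cut. Moving \<open>U - {t}\<close> to the part of \<open>z\<close> saves at least
          \<open>length ys - length r\<close> of them and newly cuts at most the
          \<open>length ys - 1\<close> edges from \<open>t\<close> into \<open>U\<close>. As
          \<open>length r \<le> 1\<close>, the cost does not rise, and since \<open>v\<close> has
          left \<open>t\<close>, the child \<open>e1\<close> covers this case.\<close>
        define \<chi> where "\<chi> = (\<lambda>x. if x \<in> U - {t} then \<psi> z else \<psi> x)"
        have sub: "set ys \<subseteq> insert z (set r)" using r(1) by auto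
        have ys: "\<psi> y \<noteq> t" if "y \<in> set ys" for y
        proof (cases "y = z")
          case False
          with that sub have "y \<in> set r" by blast
          with ra have "r = [a]" "y = a" by auto
          then show ?thesis using 3(2) by blast
        qed (use 3(1) in blast)
        have "cost e \<chi> + length ys \<le> cost e \<psi> + wt e {t} (U - {t}) + length r"
          unfolding \<chi>_def r(1) 
            by (rule cost_flip[where z = z and \<phi> = \<psi> and c = "\<psi> z", OF U_heads t_U \<psi>U 3(1) refl ys])
        then have "cost e \<chi> \<le> k" using length_ys r(2) \<psi>(2) by simp
        moreover have "labelling T \<chi>"
        proof -
          have "\<chi> s = \<psi> s" if "s \<in> T" for s
          proof -
            have "s \<notin> U - {t}" using that U_T by blast
            then show ?thesis unfolding \<chi>_def by (rule if_not_P)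
          qed
          moreover have "\<chi> x \<in> T" for x using \<psi>(1) by (simp add: \<chi>_def labelling_def)
          ultimately show ?thesis using \<psi>(1) by (simp add: labelling_def)
        qed
        moreover have "\<chi> v = \<psi> z" using U(1) tv by (simp add: \<chi>_def)
        ultimately have "solv T e1 (k - 1)" using solv_e1[of \<chi>] 3(1) by simp
        then show ?thesis by (simp add: set_cs)
      qed
    next
      case False
      then have "\<phi> v \<noteq> t" using U(1) v_vx tv by metis
      then show ?thesis using solv_e1[OF \<phi>] by (simp add: set_cs)
    qed
  qed
  with d l show ?thesis unfolding cs_def[symmetric] by (simp add: good_kids_def)
qed

text \<open>Renewed contraction cannot lower \<open>msum\<close> and \<open>t\<close> loses at most
  2, so some other terminal \<open>s\<close> must lose. Its cheapest cut after both deletions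
  contains \<open>v\<close> or \<open>b\<close>, hence had a unit to spare. To fall below the
  minimum it must lose two units, so it contains both and had exactly one to spare.\<close>

lemma two_fails:
  assumes "two (dbl e1) ts e1 H t (tdeg ts e) k = []" and b: "(t, b) \<in> set (dbl e1)" "b \<in> U" "b \<noteq> t"
  shows "\<exists>s X. s \<in> T \<and> s \<noteq> t \<and> iso T s X \<and> v \<in> X \<and> b \<in> X \<and> dg e X = Suc (dg e {s})"
proof -
  define e3 where "e3 = del t b e1"
  have b_vx: "b \<in> vx e" and bT: "b \<notin> T"
    using edge_vx[OF b(1)] vx_del[of t v e] U_T b by (auto simp: e1_def)
  have "tdeg ts (prep ts ts e3) + 2 < tdeg ts e"
    unfolding e3_def using assms by (intro two_Nil) (auto simp: U_heads)
  moreover have "msum T (prep ts ts e3) = tdeg ts (prep ts ts e3)"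
    using prep[of ts ts e3] by (intro msum_eq_tdeg dist) auto
  moreover have "msum T e = tdeg ts e" using minimal by (intro msum_eq_tdeg dist) auto
  ultimately have less: "msum T e3 + 2 < msum T e" using msum_prep[of ts e3] by simp
  have "\<exists>s\<in>T. s \<noteq> t \<and> mc T e3 s < mc T e s"
  proof (rule ccontr)
    assume *: "\<not> ?thesis"
    have "mc T e t - 2 \<le> mc T e3 t"
    proof (rule mc_ge[OF t])
      fix X assume "iso T t X"
      then have "mc T e t \<le> dg e X" by (rule mc_le)
      also have "\<dots> \<le> dg e3 X + 2"
        using dg_le_del[of e X t v] dg_le_del[of e1 X t b]
        by (auto simp: e1_def e3_def of_bool_def split: if_splits)
      finally show "mc T e t - 2 \<le> dg e3 X" by simp
    qed
    then have "msum T e + 0 \<le> msum T e3 + 2"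
      using * by (intro msum_change[OF _ t]) (auto simp: not_less)
    then show False using less by simp
  qed
  then obtain s where s: "s \<in> T" "s \<noteq> t" "mc T e3 s < dg e {s}" using mc_eq by auto
  obtain X where X: "iso T s X" "dg e3 X = mc T e3 s" using mc_attained[OF s(1)] by blast
  have tX: "t \<notin> X" using X(1) t s by (auto simp: iso_def)
  have *: "dg e X \<le> dg e3 X + of_bool (v \<in> X) + of_bool (b \<in> X)"
    using dg_le_del[of e X t v] dg_le_del[of e1 X t b] tX by (simp add: e1_def e3_def)
  have "Suc (dg e {s}) \<le> dg e X" if "v \<in> X \<or> b \<in> X"
    using less_iso[OF X(1)] v v_vx b_vx bT s(1) that by blast
  then have "v \<in> X \<and> b \<in> X \<and> dg e X = Suc (dg e {s})"
    using * X(2) s(3) le_iso[OF X(1)] by (cases "v \<in> X"; cases "b \<in> X") auto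
  then show ?thesis using s X by blast
qed

end

lemma three_not_Nil: "three (z # r) ts t e1 e2 k \<noteq> []"
  by simp

context branch
begin

lemma cand_eq:
  "cand ts e k t v =
     (if tdeg ts e + 1 < tdeg ts e2 then [(e2, k), (e1, k - 1)]
      else if two (dbl e1) ts e1 H t (tdeg ts e) k \<noteq> []
        then (e2, k) # two (dbl e1) ts e1 H t (tdeg ts e) k
      else three (pick (outs H t (dbl e)) (outs H t (dbl e))) ts t e1 e2 k)"
  by (simp add: cand_def Let_def flip: e2_ren) (simp add: H_def e1_def)

lemma good_kids_cand:
  assumes "cand ts e k t v \<noteq> []" shows "good_kids T n e k (cand ts e k t v)"
proof (cases "tdeg ts e + 1 < tdeg ts e2")
  case True
  then show ?thesis using good_kids_large by (simp add: cand_eq)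
next
  case False
  then interpret tight_branch ts e k n t v by unfold_locales
  show ?thesis
  proof (cases "two (dbl e1) ts e1 H t (tdeg ts e) k = []")
    case True
    with False assms have c: "cand ts e k t v = three (pick ys ys) ts t e1 e2 k" "pick ys ys \<noteq> []"
      by (auto simp: cand_eq)
    then obtain z r where "pick ys ys = z # r" by (cases "pick ys ys") auto
    then show ?thesis using good_kids_three c(1) by simp
  next
    case nt: False
    obtain b where b: "(t, b) \<in> set (dbl e1)" "b \<noteq> t" "b \<notin> heads H"
      "two (dbl e1) ts e1 H t (tdeg ts e) k = [(prep ts ts (del t b e1), k - 2)]"
      "tdeg ts e \<le> tdeg ts (prep ts ts (del t b e1)) + 2"
      using two_not_Nil[OF nt] by blast
    then have "good_kids T n e k [(e2, k), (prep ts ts (del t b e1), k - 2)]"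
      by (intro good_kids_two) (auto simp: U_heads)
    then show ?thesis using False b(4) by (simp add: cand_eq)
  qed
qed

end

section \<open>Existence of an edge on which branching succeeds\<close>

context node
begin

text \<open>The tight sets \<open>U\<close> of the branching step, for any terminal \<open>s\<close>
  and any \<open>x\<close>, whether or not an edge joins them.\<close>

definition block :: "'a \<Rightarrow> 'a \<Rightarrow> 'a set \<Rightarrow> bool" where
  "block s x Y \<longleftrightarrow> iso T s Y \<and> x \<in> Y \<and> dg e Y = Suc (dg e {s}) \<and>
     (\<forall>Z. iso T s Z \<longrightarrow> x \<in> Z \<longrightarrow> dg e Z \<le> Suc (dg e {s}) \<longrightarrow> Z \<subseteq> Y)"

lemma block_cutset:
  assumes "iso T s X" "x \<in> X" "x \<in> vx e" "x \<notin> T" "dg e X \<le> Suc (dg e {s})"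
  shows "block s x (cutset e ts s x)" "X \<subseteq> cutset e ts s x"
proof -
  note U = cutset[OF iso_T[OF assms(1)] disjI1[OF assms(4)] refl, where es = e]
  have "x \<noteq> s" using assms(4) iso_T[OF assms(1)] by metis
  then have "Suc (dg e {s}) \<le> dg e (cutset e ts s x)" by (rule less_iso[OF U(2,1) assms(3)])
  moreover have "dg e (cutset e ts s x) \<le> dg e X" using assms(1,2) by (rule U(3))
  ultimately have eq: "dg e (cutset e ts s x) = Suc (dg e {s})" using assms(5) by simp
  have m: "Z \<subseteq> cutset e ts s x" if "iso T s Z" "x \<in> Z" "dg e Z \<le> Suc (dg e {s})" for Z
    using U(4)[OF that(1,2)] that(3) eq by simp
  then show "block s x (cutset e ts s x)" 
    unfolding block_def by (intro conjI allI impI U(1,2) eq m)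
  show "X \<subseteq> cutset e ts s x" by (rule m[OF assms(1,2,5)])
qed

lemma blockD:
  assumes "block s x Y"
  shows "iso T s Y" "x \<in> Y" "dg e Y = Suc (dg e {s})"
    and "\<And>Z. iso T s Z \<Longrightarrow> x \<in> Z \<Longrightarrow> dg e Z \<le> Suc (dg e {s}) \<Longrightarrow> Z \<subseteq> Y"
  using assms by (simp_all add: block_def)

lemma iso_diff: "iso T s X \<Longrightarrow> iso T s' Y \<Longrightarrow> s \<noteq> s' \<Longrightarrow> iso T s (X - Y)"
  by (simp add: iso_def Diff_Int_distrib2)

text \<open>Each set exceeds its minimum by 1, so two units of slack are shared by the two
  differences and, counted double, the edges from the intersection to the outside.\<close>

lemma dg_diffs:
  assumes "block s x X" "iso T s' Y" "dg e Y = Suc (dg e {s'})" "s \<noteq> s'"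
  shows "dg e (X - Y) + dg e (Y - X) + 2 * wt e (X \<inter> Y) (- (X \<union> Y)) = dg e {s} + dg e {s'} + 2"
    "dg e {s} \<le> dg e (X - Y)" "dg e {s'} \<le> dg e (Y - X)"
proof -
  show "dg e (X - Y) + dg e (Y - X) + 2 * wt e (X \<inter> Y) (- (X \<union> Y)) = dg e {s} + dg e {s'} + 2"
    using dg_posimodular[of e X Y] blockD(3)[OF assms(1)] assms(3) by simp
  show "dg e {s} \<le> dg e (X - Y)"
    using iso_diff[OF blockD(1)[OF assms(1)] assms(2,4)] by (rule le_iso)
  show "dg e {s'} \<le> dg e (Y - X)"
    using iso_diff[OF assms(2) blockD(1)[OF assms(1)] assms(4)[symmetric]] by (rule le_iso)
qed

text \<open>Let \<open>Z\<close> be the part of \<open>X - Y\<close> other than \<open>s\<close>.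
  Without an edge from \<open>s\<close> into \<open>Z\<close>, the tightness of \<open>X\<close>
  forces at least half of the edges leaving \<open>Z\<close> to end in \<open>X \<inter> Y\<close>.
  Then adding \<open>Z\<close> to \<open>Y\<close> does not raise its degree, and the maximality of
  \<open>Y\<close> makes \<open>Z\<close> empty, although \<open>X - Y\<close> costs more than
  \<open>{s}\<close>.\<close>

lemma block_neighbour:
  assumes X: "block s x X" and Y: "block s' x Y" and s: "s \<noteq> s'" and x: "x \<in> vx e" "x \<notin> T"
    and less: "Suc (dg e {s}) \<le> dg e (X - Y)"
  shows "\<exists>y\<in>X - Y - {s}. (s, y) \<in> set (dbl e)"
proof (rule ccontr)
  define Z where "Z = X - Y - {s}"
  note X' = blockD[OF X] and Y' = blockD[OF Y]
  have sX: "s \<in> X" "s \<notin> Y" "x \<noteq> s" "X \<inter> T = {s}" "Y \<inter> T = {s'}"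
    using X'(1) Y'(1) s x(2) unfolding iso_def by blast+
  have ZT: "Z \<inter> T = {}" using sX by (auto simp: Z_def)
  assume "\<not> ?thesis"
  then have 0: "wt e {s} Z = 0"
    using wt_pos_iff_dbl[of e "{s}" Z] by (auto simp: Z_def)
  have "X - Y = {s} \<union> Z" "{s} \<inter> Z = {}" using sX by (auto simp: Z_def)
  then have "dg e {s} + dg e Z = dg e (X - Y)" using dg_Un_disjoint[of "{s}" Z e] 0 by simp
  then have Z1: "1 \<le> dg e Z" using less by simp
  define C where "C = X \<inter> Y"
  have "X = ({s} \<union> C) \<union> Z" and d: "({s} \<union> C) \<inter> Z = {}" using sX by (auto simp: Z_def C_def)
  then have "dg e X + 2 * wt e ({s} \<union> C) Z = dg e ({s} \<union> C) + dg e Z"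
    using dg_Un_disjoint[OF d, of e] by simp
  moreover have "Suc (dg e {s}) \<le> dg e ({s} \<union> C)"
  proof (rule less_iso)
    show "iso T s ({s} \<union> C)" using sX iso_T[OF X'(1)] unfolding iso_def C_def by blast
    show "x \<in> {s} \<union> C" using X'(2) Y'(2) by (simp add: C_def)
  qed (use x sX in auto)
  moreover have "wt e ({s} \<union> C) Z = wt e C Z"
  proof -
    have "Z \<inter> ({s} \<union> C) = {}" "{s} \<inter> C = {}" using sX(2) by (auto simp: Z_def C_def)
    from wt_Un_right[OF this, of e] show ?thesis
      using 0 by (simp add: wt_commute[of e Z])
  qed
  ultimately have "dg e Z \<le> 2 * wt e C Z" using X'(3) by simp
  also have "\<dots> \<le> 2 * wt e Y Z" by (intro mult_le_mono2 wt_mono) (auto simp: C_def)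
  finally have "dg e Z \<le> 2 * wt e Y Z" .
  moreover have "Y \<inter> Z = {}" by (auto simp: Z_def)
  ultimately have "dg e (Y \<union> Z) \<le> dg e Y" using dg_Un_disjoint[of Y Z e] by simp
  then have "Y \<union> Z \<subseteq> Y"
    using Y' ZT by (intro Y'(4)) (auto simp: iso_def)
  then have "Z = {}" by (auto simp: Z_def)
  with Z1 show False by (simp add: dg_def wt_def filter_empty_conv)
qed

text \<open>If branching fails at an edge \<open>t v\<close> whose cut \<open>U\<close> has the most
  vertices, another terminal \<open>s\<close> has a block \<open>Y\<close> containing
  \<open>v\<close>. The two units of slack between \<open>U\<close> and \<open>Y\<close> can go to
  an edge leaving \<open>U \<inter> Y\<close>, all to \<open>Y - U\<close>, or at least partly to
  \<open>U - Y\<close>. These options contradict, in turn, the failure of \<open>pick\<close>, the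
  choice of \<open>U\<close>, and a second application of \<open>two_fails\<close>.\<close>

lemma kids_exist:
  assumes "\<exists>t v. t \<in> T \<and> v \<notin> T \<and> (t, v) \<in> set (dbl e)"
  shows "\<exists>t v. t \<in> T \<and> v \<notin> T \<and> (t, v) \<in> set (dbl e) \<and> cand ts e k t v \<noteq> []"
proof (rule ccontr)
  assume none: "\<not> ?thesis"
  define A where "A = {(t, v). t \<in> T \<and> v \<notin> T \<and> (t, v) \<in> set (dbl e)}"
  define size where "size = (\<lambda>(t, v). card (cutset e ts t v \<inter> vx e))"
  have "finite A" by (rule finite_subset[of _ "set (dbl e)"]) (auto simp: A_def)
  moreover have "A \<noteq> {}" using assms by (auto simp: A_def)
  ultimately have "Max (size ` A) \<in> size ` A" by simp
  then obtain a where "a \<in> A" "size a = Max (size ` A)" by auto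
  then have max: "size b \<le> size a" if "b \<in> A" for b using that \<open>finite A\<close> by simp
  from \<open>a \<in> A\<close> obtain t v where t: "t \<in> T" and v: "v \<notin> T" and edge: "(t, v) \<in> set (dbl e)"
    and a: "a = (t, v)" by (auto simp: A_def)
  interpret branch ts e k n t v using t v edge by unfold_locales
  have c: "cand ts e k t v = []" using none t v edge by blast
  have "\<not> tdeg ts e + 1 < tdeg ts e2"
  proof
    assume "tdeg ts e + 1 < tdeg ts e2"
    with c show False by (simp add: cand_eq)
  qed
  then interpret tight_branch ts e k n t v by unfold_locales
  have two: "two (dbl e1) ts e1 H t (tdeg ts e) k = []"
  proof (rule ccontr)
    assume "two (dbl e1) ts e1 H t (tdeg ts e) k \<noteq> []"
    with c tight show False by (simp add: cand_eq)
  qed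
  have "pick ys ys = []"
  proof (cases "pick ys ys")
    case (Cons z r)
    then have "cand ts e k t v = three (z # r) ts t e1 e2 k" using tight two by (simp add: cand_eq)
    then show ?thesis using c three_not_Nil by metis
  qed
  then have nopick: "2 \<le> length (filter (\<lambda>y. y \<noteq> z) ys)" if "z \<in> set ys" for z
    using pick_not_Nil_iff[of ys ys] that by (auto simp: not_le)
  have blkU: "block t v U"
    unfolding U_def using U(1,2) v_vx v dg_U_eq by (intro block_cutset(1)[of t U]) auto
  have vC: "v \<in> U - {t}" using U(1) tv by blast
  then have "wt e {t} (U - {t}) = Suc (wt e1 {t} (U - {t}))"
    unfolding e1_def by (intro wt_del edge) auto
  \<comment> \<open>Some \<open>z\<close> occurs in \<open>ys\<close>, and at least two entries
    differ from it. As \<open>length ys\<close> is one more than the number of edges from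
    \<open>t\<close> into \<open>U\<close>, at least one such edge remains besides the removed unit
    of \<open>t v\<close>.\<close>
  moreover have "3 \<le> length ys"
  proof -
    have "ys \<noteq> []" using length_ys by auto
    then obtain z where "z \<in> set ys" by (meson last_in_set)
    with nopick[OF this] show ?thesis
      using length_filter_less[of z ys "\<lambda>y. y \<noteq> z"] by force
  qed
  ultimately have "0 < wt e1 {t} (U - {t})" using length_ys by simp
  then obtain b where b: "(t, b) \<in> set (dbl e1)" "b \<in> U" "b \<noteq> t"
    by (auto simp: wt_pos_iff_dbl)
  obtain s X where s: "s \<in> T" "s \<noteq> t" "iso T s X" "v \<in> X" "dg e X = Suc (dg e {s})"
    using two_fails[OF two b] by blast
  define Y where "Y = cutset e ts s v"
  have blkY: "block s v Y"
    unfolding Y_def using s v_vx v by (intro block_cutset(1)[of s X]) auto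
  note Y = blockD[OF blkY]
  have dd: "dg e (U - Y) + dg e (Y - U) + 2 * wt e (U \<inter> Y) (- (U \<union> Y)) = dg e {t} + dg e {s} + 2"
    "dg e {t} \<le> dg e (U - Y)" "dg e {s} \<le> dg e (Y - U)"
    using dg_diffs[OF blkU Y(1,3)] s(2) by auto
  have isoUY: "iso T t (U - Y)" and isoYU: "iso T s (Y - U)"
    using iso_diff[OF U(2) Y(1)] iso_diff[OF Y(1) U(2)] s(2) by auto
  have tY: "t \<notin> Y" using isoUY unfolding iso_def by blast
  show False
  proof (cases "wt e (U \<inter> Y) (- (U \<union> Y)) = 0")
    case False
    then have 1: "wt e (U \<inter> Y) (- (U \<union> Y)) = 1" "dg e (U - Y) = dg e {t}" "dg e (Y - U) = dg e {s}"
      using dd by auto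
    \<comment> \<open>Inside the graph \<open>U\<close> and \<open>Y\<close> now differ only by
      \<open>t\<close> and \<open>s\<close>, so all but one of the edges leaving
      \<open>U - {t}\<close> end in \<open>s\<close>, and \<open>pick\<close> would succeed with
      \<open>s\<close>.\<close>
    then have UY: "(U - Y) \<inter> vx e \<subseteq> {t}" and YU: "(Y - U) \<inter> vx e \<subseteq> {s}"
      using singleton_if_dg_eq isoUY isoYU by blast+
    have le: "length (filter (\<lambda>y. y \<noteq> s) ys) \<le> 1"
      unfolding filter_outs 1(1)[symmetric] using UY YU by (intro wt_mono_vx) (auto simp: U_heads)
    moreover from this have "s \<in> set ys"
      using \<open>3 \<le> length ys\<close> filter_True[of ys "\<lambda>y. y \<noteq> s"] by fastforce
    ultimately show False using nopick by fastforce
  next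
    case w0: True
    show False
    proof (cases "dg e (U - Y) = dg e {t}")
      case True
      then have UY: "(U - Y) \<inter> vx e \<subseteq> {t}" using singleton_if_dg_eq isoUY by blast
      \<comment> \<open>With all slack in \<open>Y - U\<close>, the terminal \<open>s\<close> has a
        neighbour \<open>y\<close> there. The largest cut for the edge \<open>s y\<close> contains
        \<open>Y\<close>, which compared with \<open>U\<close> loses at most \<open>t\<close> but
        gains both \<open>s\<close> and \<open>y\<close>, against the choice of
        \<open>U\<close>.\<close>
      have "Suc (dg e {s}) \<le> dg e (Y - U)" using dd w0 True by simp
      then obtain y where y: "y \<in> Y - U - {s}" "(s, y) \<in> set (dbl e)"
        using block_neighbour[OF blkY blkU s(2) v_vx v] by blast
      have yT: "y \<notin> T" using y(1) Y(1) unfolding iso_def by blast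
      have yv: "y \<in> vx e" "s \<in> vx e" using edge_vx[OF y(2)] by auto
      have "Y \<subseteq> cutset e ts s y"
        using Y(1,3) y(1) yv(1) yT by (intro block_cutset(2)) auto
      then have "card (Y \<inter> vx e) \<le> size (s, y)"
        by (auto simp: size_def intro!: card_mono)
      also have "\<dots> \<le> card (U \<inter> vx e)"
        using max[of "(s, y)"] s(1) yT y(2) by (simp add: A_def a size_def U_def)
      also have "U \<inter> vx e \<subseteq> insert t (U \<inter> Y \<inter> vx e)" using UY by blast
      then have "card (U \<inter> vx e) \<le> card (insert t (U \<inter> Y \<inter> vx e))" by (intro card_mono) auto
      also have "\<dots> \<le> Suc (card (U \<inter> Y \<inter> vx e))" by (rule card_insert_le_m1) auto
      finally have "card (Y \<inter> vx e) \<le> Suc (card (U \<inter> Y \<inter> vx e))" .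
      moreover have sU: "s \<in> Y - U" using isoYU unfolding iso_def by blast
      then have "insert s (insert y (U \<inter> Y \<inter> vx e)) \<subseteq> Y \<inter> vx e" using y(1) yv by blast
      then have "card (insert s (insert y (U \<inter> Y \<inter> vx e))) \<le> card (Y \<inter> vx e)"
        by (intro card_mono) auto
      moreover have "card (insert s (insert y (U \<inter> Y \<inter> vx e))) = Suc (Suc (card (U \<inter> Y \<inter> vx e)))"
        using y(1) sU by (subst card_insert_disjoint; auto)+
      ultimately show False by simp
    next
      case False
      \<comment> \<open>A neighbour \<open>y\<close> of \<open>t\<close> in \<open>U - Y\<close>
        gives a second tight cut \<open>X'\<close>, containing \<open>v\<close> and
        \<open>y\<close>. It cannot belong to \<open>s\<close>, since it would then lie inside
        \<open>Y\<close>. Otherwise the edge \<open>t v\<close> leaves \<open>Y \<inter> X'\<close>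
        and uses up all slack, so \<open>X' - Y\<close> would be a minimum cut although it contains
        \<open>y\<close>.\<close>
      then have "Suc (dg e {t}) \<le> dg e (U - Y)" using dd(2) by simp
      then obtain y where y: "y \<in> U - Y - {t}" "(t, y) \<in> set (dbl e)"
        using block_neighbour[OF blkU blkY s(2)[symmetric] v_vx v] by blast
      have yT: "y \<notin> T" using y(1) U_T by blast
      have yv: "y \<in> vx e" using edge_vx[OF y(2)] by auto
      have ye: "(t, y) \<in> set (dbl e1)"
      proof -
        have "y \<noteq> v" using y(1) Y(2) by blast
        then show ?thesis using y set_del_other[of t y t v e] set_del_other[of y t t v e] tv
          by (auto simp: e1_def dbl_set doubleton_eq_iff)
      qed
      obtain s' X' where s': "s' \<in> T" "s' \<noteq> t" "iso T s' X'" "v \<in> X'" "y \<in> X'"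
        "dg e X' = Suc (dg e {s'})"
        using two_fails[OF two ye] y(1) by blast
      show False
      proof (cases "s' = s")
        case True
        then have "X' \<subseteq> Y" using Y(4) s' by simp
        then show False using s'(5) y(1) by blast
      next
        case False
        have "t \<notin> X'" using s'(2,3) t by (auto simp: iso_def)
        then have "0 < wt e (Y \<inter> X') (- (Y \<union> X'))"
          using edge dbl_sym[of t v e] Y(2) s'(4) tY by (auto simp: wt_pos_iff_dbl)
        then have "dg e (X' - Y) \<le> dg e {s'}"
          using dg_diffs[OF blkY s'(3,6)] False by auto
        moreover have "Suc (dg e {s'}) \<le> dg e (X' - Y)"
        proof (rule less_iso)
          show "iso T s' (X' - Y)" using iso_diff[OF s'(3) Y(1)] False by blast
          show "y \<in> X' - Y" using s'(5) y(1) by blast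
        qed (use yv yT s'(1) in auto)
        ultimately show False by simp
      qed
    qed
  qed
qed

lemma kids_eq: "kids l ts e k \<noteq> [] \<Longrightarrow>
    \<exists>(t, v)\<in>set l. t \<in> T \<and> v \<notin> T \<and> kids l ts e k = cand ts e k t v"
  by (induction l ts e k rule: kids.induct) (auto split: if_splits)

end

lemma kids_Nil: "kids l ts e k = [] \<Longrightarrow> (t, v) \<in> set l \<Longrightarrow> t \<in> set ts \<Longrightarrow> v \<notin> set ts \<Longrightarrow>
    cand ts e k t v = []"
  by (induction l ts e k rule: kids.induct) (auto split: if_splits)

lemma (in node) good_kids:
  assumes "kids (dbl e) ts e k \<noteq> []" shows "good_kids T n e k (kids (dbl e) ts e k)"
proof -
  obtain t v where *: "(t, v) \<in> set (dbl e)" "t \<in> T" "v \<notin> T" "kids (dbl e) ts e k = cand ts e k t v"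
    using kids_eq[OF assms] by blast
  then interpret branch ts e k n t v by unfold_locales auto
  show ?thesis using good_kids_cand * assms by simp
qed

lemma (in node) no_kids:
  assumes "kids (dbl e) ts e k = []" "(u, v) \<in> set (dbl e)" shows "u \<in> T \<longleftrightarrow> v \<in> T"
proof -
  have "\<not> (\<exists>t v. t \<in> T \<and> v \<notin> T \<and> (t, v) \<in> set (dbl e))"
    using kids_exist kids_Nil[OF assms(1)] by blast
  then show ?thesis using assms(2) dbl_sym[of u v e] by blast
qed

section \<open>The program\<close>

abbreviation IfEq :: "exp \<Rightarrow> exp \<Rightarrow> exp \<Rightarrow> exp \<Rightarrow> exp" where
  "IfEq a b c d \<equiv> IfLess a b d (IfLess b a d c)"

text \<open>Under truncated subtraction one summand is 0, so this is the distance of two atoms. A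
  sum of two distances tests the equality of pairs by a single comparison.\<close>

abbreviation Diff :: "exp \<Rightarrow> exp \<Rightarrow> exp" where
  "Diff a b \<equiv> Add (Sub a b) (Sub b a)"

abbreviation "cLook x vis \<equiv> Call 1 [x, vis]"
abbreviation "cGrow as vis \<equiv> Call 2 [as, vis]"
abbreviation "cSat cs as vis \<equiv> Call 3 [cs, as, vis]"
abbreviation "cPush x y as \<equiv> Call 4 [x, y, as]"
abbreviation "cAug p as \<equiv> Call 5 [p, as]"
abbreviation "cFlow cs as t s \<equiv> Call 6 [cs, as, t, s]"
abbreviation "cDbl es \<equiv> Call 7 [es]"
abbreviation "cOthers t tv \<equiv> Call 8 [t, tv]"
abbreviation "cMerge v t es \<equiv> Call 9 [v, t, es]"
abbreviation "cCutv es tv t v \<equiv> Call 10 [es, tv, t, v]"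
abbreviation "cRen H t es \<equiv> Call 11 [H, t, es]"
abbreviation "cPrep l tv es \<equiv> Call 12 [l, tv, es]"
abbreviation "cTdeg tv es \<equiv> Call 13 [tv, es]"
abbreviation "cCost es \<equiv> Call 14 [es]"
abbreviation "cDel x y es \<equiv> Call 15 [x, y, es]"
abbreviation "cCands l tv es k \<equiv> Call 16 [l, tv, es, k]"
abbreviation "cTwo l tv e1 H t d k \<equiv> Call 17 [l, tv, e1, H, t, d, k]"
abbreviation "cOuts H t l \<equiv> Call 18 [H, t, l]"
abbreviation "cNeq z ys \<equiv> Call 19 [z, ys]"
abbreviation "cPick zs ys \<equiv> Call 20 [zs, ys]"
abbreviation "cThree q tv t e1 e2 k \<equiv> Call 21 [q, tv, t, e1, e2, k]"
abbreviation "cCand tv e k t v \<equiv> Call 22 [tv, e, k, t, v]"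
abbreviation "cKids l tv e k \<equiv> Call 23 [l, tv, e, k]"
abbreviation "cSolve tv es k \<equiv> Call 24 [tv, es, k]"
abbreviation "cTry tv l \<equiv> Call 25 [tv, l]"
abbreviation "cRep c b u v rest \<equiv> Call 26 [c, b, u, v, rest]"
abbreviation "cExpand es b \<equiv> Call 27 [es, b]"
abbreviation "cLoops vs rest \<equiv> Call 28 [vs, rest]"
abbreviation "cSing ts \<equiv> Call 29 [ts]"
abbreviation "cPart t vs r \<equiv> Call 30 [t, vs, r]"
abbreviation "cParts ts vs r \<equiv> Call 31 [ts, vs, r]"

abbreviation "hd1 i \<equiv> First (First (Arg i))"
abbreviation "hd2 i \<equiv> Second (First (Arg i))"

text \<open>Multiplicities are capped at \<open>k + 1\<close>, and the answer is read off the loops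
  at the front of the solved edge list.\<close>

definition "main_code =
  LetIn (cSolve (cSing (First (Second (Second (Arg 0)))))
      (cLoops (First (Arg 0))
        (cExpand (First (Second (Arg 0))) (Add (Second (Second (Second (Arg 0)))) (Lit 1))))
      (Second (Second (Second (Arg 0)))))
    (IfPair (Arg 0)
      (MkPair (Lit 1) (cParts (First (Second (Second (Arg 1)))) (First (Arg 1)) (Arg 0)))
      (Lit 0))"

definition "look_code =
  IfPair (Arg 1)
    (IfEq (hd1 1) (Arg 0) (First (Arg 1)) (cLook (Arg 0) (Second (Arg 1))))
    (Lit 0)"

definition "grow_code =
  IfPair (Arg 0)
    (LetIn (cLook (hd2 0) (Arg 1))
      (IfPair (Arg 0)
        (IfPair (cLook (hd1 1) (Arg 2))
          (cGrow (Second (Arg 1)) (Arg 2))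
          (cGrow (Second (Arg 1)) (MkPair (MkPair (hd1 1) (Arg 0)) (Arg 2))))
        (cGrow (Second (Arg 1)) (Arg 2))))
    (Arg 1)"

definition "sat_code =
  IfPair (Arg 0) (cSat (Second (Arg 0)) (Arg 1) (cGrow (Arg 1) (Arg 2))) (Arg 2)"

definition "push_code =
  IfPair (Arg 2)
    (IfLess (Lit 0) (Add (Diff (hd1 2) (Arg 0)) (Diff (hd2 2) (Arg 1)))
      (MkPair (First (Arg 2)) (cPush (Arg 0) (Arg 1) (Second (Arg 2))))
      (MkPair (MkPair (hd2 2) (hd1 2)) (Second (Arg 2))))
    (Lit 0)"

definition "aug_code =
  IfPair (Arg 0)
    (IfPair (Second (Arg 0))
      (cAug (Second (Arg 0)) (cPush (First (Arg 0)) (First (Second (Arg 0))) (Arg 1)))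
      (Arg 1))
    (Arg 1)"

definition "flow_code =
  IfPair (Arg 0)
    (cFlow (Second (Arg 0))
      (cAug (cLook (Arg 2) (cSat (Arg 1) (Arg 1) (Arg 3))) (Arg 1)) (Arg 2) (Arg 3))
    (cSat (Arg 1) (Arg 1) (Arg 3))"

definition "dbl_code =
  IfPair (Arg 0)
    (MkPair (First (Arg 0)) (MkPair (MkPair (hd2 0) (hd1 0)) (cDbl (Second (Arg 0)))))
    (Lit 0)"

definition "others_code =
  IfPair (Arg 1)
    (IfEq (hd1 1) (Arg 0)
      (cOthers (Arg 0) (Second (Arg 1)))
      (MkPair (First (Arg 1)) (cOthers (Arg 0) (Second (Arg 1)))))
    (Lit 0)"

definition "merge_code =
  IfPair (Arg 2)
    (MkPair
      (MkPair (IfEq (hd1 2) (Arg 0) (Arg 1) (hd1 2)) (IfEq (hd2 2) (Arg 0) (Arg 1) (hd2 2)))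
      (cMerge (Arg 0) (Arg 1) (Second (Arg 2))))
    (Lit 0)"

definition "cutv_code =
  LetIn (cMerge (Arg 3) (Arg 2) (Arg 0))
    (cFlow (Arg 0) (cDbl (Arg 0)) (Arg 3) (cOthers (Arg 3) (Arg 2)))"

definition "ren_code =
  IfPair (Arg 2)
    (MkPair
      (MkPair (IfPair (cLook (hd1 2) (Arg 0)) (hd1 2) (Arg 1))
        (IfPair (cLook (hd2 2) (Arg 0)) (hd2 2) (Arg 1)))
      (cRen (Arg 0) (Arg 1) (Second (Arg 2))))
    (Lit 0)"

definition "prep_code =
  IfPair (Arg 0)
    (cPrep (Second (Arg 0)) (Arg 1)
      (cRen (cCutv (Arg 2) (Arg 1) (hd1 0) (hd1 0)) (hd1 0) (Arg 2)))
    (Arg 2)"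

definition "tdeg_code =
  IfPair (Arg 1)
    (IfEq (hd1 1) (hd2 1)
      (cTdeg (Arg 0) (Second (Arg 1)))
      (Add (cTdeg (Arg 0) (Second (Arg 1)))
        (Add (IfPair (cLook (hd1 1) (Arg 0)) (Lit 1) (Lit 0))
          (IfPair (cLook (hd2 1) (Arg 0)) (Lit 1) (Lit 0)))))
    (Lit 0)"

definition "cost_code =
  IfPair (Arg 0)
    (IfEq (hd1 0) (hd2 0) (cCost (Second (Arg 0))) (Add (cCost (Second (Arg 0))) (Lit 1)))
    (Lit 0)"

definition "del_code =
  IfPair (Arg 2)
    (IfLess (Lit 0) (Add (Diff (hd1 2) (Arg 0)) (Diff (hd2 2) (Arg 1)))
      (IfLess (Lit 0) (Add (Diff (hd1 2) (Arg 1)) (Diff (hd2 2) (Arg 0)))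
        (MkPair (First (Arg 2)) (cDel (Arg 0) (Arg 1) (Second (Arg 2))))
        (Second (Arg 2)))
      (Second (Arg 2)))
    (Lit 0)"

definition "cands_code =
  IfPair (Arg 0)
    (LetIn (cRen (Arg 1) (hd1 0) (Arg 2))
      (IfLess (Arg 4) (cCost (Arg 0))
        (cCands (Second (Arg 1)) (Arg 2) (Arg 3) (Arg 4))
        (Arg 0)))
    (Lit 0)"

definition "two_code =
  IfPair (Arg 0)
    (IfEq (hd1 0) (Arg 4)
      (IfEq (hd2 0) (Arg 4)
        (cTwo (Second (Arg 0)) (Arg 1) (Arg 2) (Arg 3) (Arg 4) (Arg 5) (Arg 6))
        (IfPair (cLook (hd2 0) (Arg 3))
          (cTwo (Second (Arg 0)) (Arg 1) (Arg 2) (Arg 3) (Arg 4) (Arg 5) (Arg 6))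
          (LetIn (cPrep (Arg 1) (Arg 1) (cDel (Arg 4) (hd2 0) (Arg 2)))
            (IfLess (Add (cTdeg (Arg 2) (Arg 0)) (Lit 2)) (Arg 6)
              (cTwo (Second (Arg 1)) (Arg 2) (Arg 3) (Arg 4) (Arg 5) (Arg 6) (Arg 7))
              (MkPair (MkPair (Arg 0) (Sub (Arg 7) (Lit 2))) (Lit 0))))))
      (cTwo (Second (Arg 0)) (Arg 1) (Arg 2) (Arg 3) (Arg 4) (Arg 5) (Arg 6)))
    (Lit 0)"

definition "outs_code =
  IfPair (Arg 2)
    (IfEq (hd1 2) (Arg 1)
      (cOuts (Arg 0) (Arg 1) (Second (Arg 2)))
      (IfPair (cLook (hd1 2) (Arg 0))
        (cOuts (Arg 0) (Arg 1) (Second (Arg 2)))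
        (IfPair (cLook (hd2 2) (Arg 0))
          (MkPair (hd2 2) (cOuts (Arg 0) (Arg 1) (Second (Arg 2))))
          (cOuts (Arg 0) (Arg 1) (Second (Arg 2))))))
    (Lit 0)"

definition "neq_code =
  IfPair (Arg 1)
    (IfEq (First (Arg 1)) (Arg 0)
      (cNeq (Arg 0) (Second (Arg 1)))
      (MkPair (First (Arg 1)) (cNeq (Arg 0) (Second (Arg 1)))))
    (Lit 0)"

definition "pick_code =
  IfPair (Arg 0)
    (LetIn (cNeq (First (Arg 0)) (Arg 1))
      (IfPair (Arg 0)
        (IfPair (Second (Arg 0))
          (cPick (Second (Arg 1)) (Arg 2))
          (MkPair (First (Arg 1)) (Arg 0)))
        (MkPair (First (Arg 1)) (Arg 0))))
    (Lit 0)"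

definition "three_code =
  IfPair (Arg 0)
    (LetIn (MkPair (MkPair (Arg 3) (Sub (Arg 5) (Lit 1))) (Lit 0))
      (LetIn (IfPair (Second (Arg 1))
          (IfPair (cLook (First (Second (Arg 1))) (Arg 2))
            (Arg 0)
            (MkPair
              (MkPair (cDel (Arg 3) (First (Arg 1)) (cMerge (First (Second (Arg 1))) (Arg 3) (Arg 5)))
                (Sub (Arg 6) (Lit 1)))
              (Arg 0)))
          (Arg 0))
        (IfPair (cLook (First (Arg 2)) (Arg 3))
          (Arg 0)
          (MkPair (MkPair (cMerge (First (Arg 2)) (Arg 4) (Arg 6)) (Arg 7)) (Arg 0)))))
    (Lit 0)"

definition "cand_code =
  LetIn (cCutv (Arg 1) (Arg 0) (Arg 3) (Arg 4))
    (LetIn (cRen (Arg 0) (Arg 4) (Arg 2))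
      (LetIn (cDel (Arg 5) (Arg 6) (Arg 3))
        (IfLess (Add (cTdeg (Arg 3) (Arg 4)) (Lit 1)) (cTdeg (Arg 3) (Arg 1))
          (MkPair (MkPair (Arg 1) (Arg 5))
            (MkPair (MkPair (Arg 0) (Sub (Arg 5) (Lit 1))) (Lit 0)))
          (LetIn (cTwo (cDbl (Arg 0)) (Arg 3) (Arg 0) (Arg 2) (Arg 6) (cTdeg (Arg 3) (Arg 4)) (Arg 5))
            (IfPair (Arg 0)
              (MkPair (MkPair (Arg 2) (Arg 6)) (Arg 0))
              (LetIn (cOuts (Arg 3) (Arg 7) (cDbl (Arg 5)))
                (cThree (cPick (Arg 0) (Arg 0)) (Arg 5) (Arg 8) (Arg 2) (Arg 3) (Arg 7))))))))"

definition "kids_code =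
  IfPair (Arg 0)
    (IfPair (cLook (hd1 0) (Arg 1))
      (IfPair (cLook (hd2 0) (Arg 1))
        (cKids (Second (Arg 0)) (Arg 1) (Arg 2) (Arg 3))
        (LetIn (cCand (Arg 1) (Arg 2) (Arg 3) (hd1 0) (hd2 0))
          (IfPair (Arg 0)
            (Arg 0)
            (cKids (Second (Arg 1)) (Arg 2) (Arg 3) (Arg 4)))))
      (cKids (Second (Arg 0)) (Arg 1) (Arg 2) (Arg 3)))
    (Lit 0)"

definition "solve_code =
  LetIn (cPrep (Arg 0) (Arg 0) (Arg 1))
    (IfLess (Add (Arg 3) (Arg 3)) (cTdeg (Arg 1) (Arg 0))
      (Lit 0)
      (LetIn (cCands (Arg 1) (Arg 1) (Arg 0) (Arg 3))
        (IfPair (Arg 0)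
          (Arg 0)
          (cTry (Arg 2) (cKids (cDbl (Arg 1)) (Arg 2) (Arg 1) (Arg 4))))))"

definition "try_code =
  IfPair (Arg 1)
    (LetIn (cSolve (Arg 0) (hd1 1) (hd2 1))
      (IfPair (Arg 0) (Arg 0) (cTry (Arg 1) (Second (Arg 2)))))
    (Lit 0)"

definition "rep_code =
  IfLess (Lit 0) (Arg 0)
    (IfLess (Lit 0) (Arg 1)
      (MkPair (MkPair (Arg 2) (Arg 3))
        (cRep (Sub (Arg 0) (Lit 1)) (Sub (Arg 1) (Lit 1)) (Arg 2) (Arg 3) (Arg 4)))
      (Arg 4))
    (Arg 4)"

definition "expand_code =
  IfPair (Arg 0)
    (cRep (Second (Second (First (Arg 0)))) (Arg 1) (hd1 0) (First (Second (First (Arg 0))))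
      (cExpand (Second (Arg 0)) (Arg 1)))
    (Lit 0)"

definition "loops_code =
  IfPair (Arg 0)
    (MkPair (MkPair (First (Arg 0)) (First (Arg 0))) (cLoops (Second (Arg 0)) (Arg 1)))
    (Arg 1)"

definition "sing_code =
  IfPair (Arg 0)
    (MkPair (MkPair (First (Arg 0)) (Lit 0)) (cSing (Second (Arg 0))))
    (Lit 0)"

definition "part_code =
  IfPair (Arg 1)
    (IfEq (hd1 2) (Arg 0)
      (MkPair (First (Arg 1)) (cPart (Arg 0) (Second (Arg 1)) (Second (Arg 2))))
      (cPart (Arg 0) (Second (Arg 1)) (Second (Arg 2))))
    (Lit 0)"

definition "parts_code =
  IfPair (Arg 0)
    (MkPair (cPart (First (Arg 0)) (Arg 1) (Arg 2)) (cParts (Second (Arg 0)) (Arg 1) (Arg 2)))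
    (Lit 0)"

definition prog :: program where
  "prog = [main_code, look_code, grow_code, sat_code, push_code, aug_code,
    flow_code, dbl_code, others_code, merge_code, cutv_code, ren_code,
    prep_code, tdeg_code, cost_code, del_code, cands_code, two_code,
    outs_code, neq_code, pick_code, three_code, cand_code, kids_code,
    solve_code, try_code, rep_code, expand_code, loops_code, sing_code,
    part_code, parts_code]"

section \<open>Evaluation within a step bound\<close>

definition ev :: "data list \<Rightarrow> exp \<Rightarrow> data \<Rightarrow> nat \<Rightarrow> bool" where
  "ev env e v t \<longleftrightarrow> (\<exists>s\<le>t. eval prog env e v s)"

definition evs :: "data list \<Rightarrow> exp list \<Rightarrow> data list \<Rightarrow> nat \<Rightarrow> bool" where
  "evs env es vs t \<longleftrightarrow> (\<exists>s\<le>t. evals prog env es vs s)"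

definition fn :: "nat \<Rightarrow> data list \<Rightarrow> data \<Rightarrow> nat \<Rightarrow> bool" where
  "fn i xs v t \<longleftrightarrow> i < length prog \<and> ev xs (prog ! i) v t"

fun is_pair :: "data \<Rightarrow> bool" where
  "is_pair (Cell x y) = True"
| "is_pair (Atom n) = False"

lemma is_pair_enc [simp]: "is_pair (enc_list f xs) \<longleftrightarrow> xs \<noteq> []"
  by (cases xs) auto

lemma ev_weaken: "ev env e v s \<Longrightarrow> v = v' \<Longrightarrow> s \<le> t \<Longrightarrow> ev env e v' t"
  unfolding ev_def using le_trans by blast

lemma fn_weaken: "fn i xs v s \<Longrightarrow> v = v' \<Longrightarrow> s \<le> t \<Longrightarrow>
    fn i xs v' t"
  using ev_weaken by (auto simp: fn_def)

lemma ev_nth: "i < length env \<Longrightarrow> env ! i = v \<Longrightarrow> ev env (Arg i) v 1"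
  unfolding ev_def using eval_evals.Arg by blast

lemma ev_Arg:
  "ev (a0 # env) (Arg 0) a0 1"
  "ev (a0 # a1 # env) (Arg 1) a1 1"
  "ev (a0 # a1 # a2 # env) (Arg 2) a2 1"
  "ev (a0 # a1 # a2 # a3 # env) (Arg 3) a3 1"
  "ev (a0 # a1 # a2 # a3 # a4 # env) (Arg 4) a4 1"
  "ev (a0 # a1 # a2 # a3 # a4 # a5 # env) (Arg 5) a5 1"
  "ev (a0 # a1 # a2 # a3 # a4 # a5 # a6 # env) (Arg 6) a6 1"
  "ev (a0 # a1 # a2 # a3 # a4 # a5 # a6 # a7 # env) (Arg 7) a7 1"
  "ev (a0 # a1 # a2 # a3 # a4 # a5 # a6 # a7 # a8 # env) (Arg 8) a8 1"
  by (rule ev_nth; simp)+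

lemma ev_Lit: "ev env (Lit m) (Atom m) 1"
  unfolding ev_def using eval_evals.Lit by blast

lemma ev_Add: "ev env a (Atom m) s \<Longrightarrow> ev env b (Atom n) t \<Longrightarrow> ev env (Add a b) (Atom (m + n)) (s + t + 1)"
  unfolding ev_def by (elim exE conjE, rule exI, rule conjI[rotated], erule (1) eval_evals.Add, simp)

lemma ev_Sub: "ev env a (Atom m) s \<Longrightarrow> ev env b (Atom n) t \<Longrightarrow> ev env (Sub a b) (Atom (m - n)) (s + t + 1)"
  unfolding ev_def by (elim exE conjE, rule exI, rule conjI[rotated], erule (1) eval_evals.Sub, simp)

lemma ev_MkPair: "ev env a x s \<Longrightarrow> ev env b y t \<Longrightarrow> ev env (MkPair a b) (Cell x y) (s + t + 1)"
  unfolding ev_def by (elim exE conjE, rule exI, rule conjI[rotated], erule (1) eval_evals.MkPair, simp)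

lemma ev_First: "ev env a w s \<Longrightarrow> w = Cell x y \<Longrightarrow> ev env (First a) x (s + 1)"
  unfolding ev_def by (elim exE conjE, rule exI, rule conjI[rotated], rule eval_evals.First, auto)

lemma ev_Second: "ev env a w s \<Longrightarrow> w = Cell x y \<Longrightarrow> ev env (Second a) y (s + 1)"
  unfolding ev_def by (elim exE conjE, rule exI, rule conjI[rotated], rule eval_evals.Second, auto)

lemma ev_LetIn: "ev env a x s \<Longrightarrow> ev (x # env) b y t \<Longrightarrow> ev env (LetIn a b) y (s + t + 1)"
  unfolding ev_def by (elim exE conjE, rule exI, rule conjI[rotated], erule (1) eval_evals.LetIn, simp)

text \<open>Both branches are treated under their own condition and joined into a HOL conditional,
  so one derivation covers all paths through a function body; the costs are joined by
  \<open>max\<close>.\<close>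

lemma ev_IfPair:
  assumes "ev env a w s" "is_pair w \<Longrightarrow> ev env b v1 r1" "\<not> is_pair w \<Longrightarrow> ev env c v2 r2"
  shows "ev env (IfPair a b c) (if is_pair w then v1 else v2) (s + max r1 r2 + 1)"
proof -
  obtain s' where s: "s' \<le> s" "eval prog env a w s'" using assms(1) by (auto simp: ev_def)
  show ?thesis
  proof (cases w)
    case (Atom m)
    then obtain r where "r \<le> r2" "eval prog env c v2 r" using assms(3) by (auto simp: ev_def)
    with eval_evals.IfPair_False[OF s(2)[unfolded Atom] this(2)] s(1) Atom show ?thesis
      unfolding ev_def by (auto intro!: exI[of _ "s' + r + 1"])
  next
    case (Cell x y)
    then obtain r where "r \<le> r1" "eval prog env b v1 r" using assms(2) by (auto simp: ev_def)
    with eval_evals.IfPair_True[OF s(2)[unfolded Cell] this(2)] s(1) Cell show ?thesis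
      unfolding ev_def by (auto intro!: exI[of _ "s' + r + 1"])
  qed
qed

text \<open>Brings the value into the form \<open>Atom _\<close>, as \<open>ev_Add\<close> requires;
  \<open>ev_IfPair\<close> would produce a conditional between two atoms.\<close>

lemma ev_bit:
  assumes "ev env a w s"
  shows "ev env (IfPair a (Lit m) (Lit n)) (Atom (if is_pair w then m else n)) (s + 2)"
  by (rule ev_weaken[OF ev_IfPair[OF assms ev_Lit ev_Lit]]) auto

lemma ev_IfLess:
  assumes "ev env a (Atom m) s" "ev env b (Atom n) t"
    "m < n \<Longrightarrow> ev env c v1 r1" "\<not> m < n \<Longrightarrow> ev env d v2 r2"
  shows "ev env (IfLess a b c d) (if m < n then v1 else v2) (s + t + max r1 r2 + 1)"
proof -
  obtain s' t' where s: "s' \<le> s" "eval prog env a (Atom m) s'" "t' \<le> t" "eval prog env b (Atom n) t'"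
    using assms(1,2) by (auto simp: ev_def)
  show ?thesis
  proof (cases "m < n")
    case True
    then obtain r where "r \<le> r1" "eval prog env c v1 r" using assms(3) by (auto simp: ev_def)
    with eval_evals.IfLess_True[OF s(2,4) True this(2)] s(1,3) True show ?thesis
      unfolding ev_def by (auto intro!: exI[of _ "s' + t' + r + 1"])
  next
    case False
    then obtain r where "r \<le> r2" "eval prog env d v2 r" using assms(4) by (auto simp: ev_def)
    with eval_evals.IfLess_False[OF s(2,4) False this(2)] s(1,3) False show ?thesis
      unfolding ev_def by (auto intro!: exI[of _ "s' + t' + r + 1"])
  qed
qed

lemma ev_IfEq:
  assumes "ev env a (Atom m) s" "ev env b (Atom n) t"
    "m = n \<Longrightarrow> ev env c v1 r1" "m \<noteq> n \<Longrightarrow> ev env d v2 r2"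
  shows "ev env (IfEq a b c d) (if m = n then v1 else v2) (2 * s + 2 * t + max r1 r2 + 2)"
proof -
  consider "m < n" | "n < m" | "m = n" by linarith
  then show ?thesis
  proof cases
    case 1
    then show ?thesis
      using ev_weaken[OF ev_IfLess[OF assms(1,2), of d v2 r2 _ v2 0]] assms(4) by simp
  next
    case 2
    then have "ev env (IfLess b a d c) v2 (t + s + r2 + 1)"
      using ev_weaken[OF ev_IfLess[OF assms(2,1), of d v2 r2 c v2 0]] assms(4) by simp
    then show ?thesis
      using ev_weaken[OF ev_IfLess[OF assms(1,2), of d v2 0 _ v2 "t + s + r2 + 1"]] 2 by simp
  next
    case 3
    then have "ev env (IfLess b a d c) v1 (t + s + r1 + 1)"
      using ev_weaken[OF ev_IfLess[OF assms(2,1), of d v1 0 c v1 r1]] assms(3) by simp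
    then show ?thesis
      using ev_weaken[OF ev_IfLess[OF assms(1,2), of d v1 0 _ v1 "t + s + r1 + 1"]] 3 by simp
  qed
qed

lemma evs_Nil: "evs env [] [] 0"
  unfolding evs_def using eval_evals.Nil by blast

lemma evs_Cons: "ev env a x s \<Longrightarrow> evs env as xs t \<Longrightarrow> evs env (a # as) (x # xs) (s + t)"
  unfolding ev_def evs_def
  by (elim exE conjE, rule exI, rule conjI[rotated], erule (1) eval_evals.Cons, simp)

lemma ev_Call: "evs env as xs s \<Longrightarrow>
    fn i xs v t \<Longrightarrow> ev env (Call i as) v (s + t + 1)"
  unfolding ev_def evs_def fn_def
  by (elim exE conjE, rule exI, rule conjI[rotated], erule (2) eval_evals.Call, simp)

text \<open>An unreachable branch receives a default value and cost 0, and the conditional around it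
  then simplifies away.\<close>

lemma ev_absurd:
  "is_pair (Atom n) \<Longrightarrow> ev env e (Atom 0) 0"
  "\<not> is_pair (Cell x y) \<Longrightarrow> ev env e (Atom 0) 0"
  by simp_all

lemma enc_Cell: "xs \<noteq> [] \<Longrightarrow> enc_list f xs = Cell (f (hd xs)) (enc_list f (tl xs))"
  by (cases xs) auto

lemmas ev_intros = refl ev_Arg ev_Lit ev_Add ev_Sub ev_MkPair ev_First ev_Second ev_LetIn ev_bit
  ev_IfPair ev_IfEq ev_IfLess ev_Call evs_Cons evs_Nil

lemma fn_code:
  "ev xs main_code v t \<Longrightarrow> fn 0 xs v t"
  "ev xs look_code v t \<Longrightarrow> fn 1 xs v t"
  "ev xs grow_code v t \<Longrightarrow> fn 2 xs v t"
  "ev xs sat_code v t \<Longrightarrow> fn 3 xs v t"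
  "ev xs push_code v t \<Longrightarrow> fn 4 xs v t"
  "ev xs aug_code v t \<Longrightarrow> fn 5 xs v t"
  "ev xs flow_code v t \<Longrightarrow> fn 6 xs v t"
  "ev xs dbl_code v t \<Longrightarrow> fn 7 xs v t"
  "ev xs others_code v t \<Longrightarrow> fn 8 xs v t"
  "ev xs merge_code v t \<Longrightarrow> fn 9 xs v t"
  "ev xs cutv_code v t \<Longrightarrow> fn 10 xs v t"
  "ev xs ren_code v t \<Longrightarrow> fn 11 xs v t"
  "ev xs prep_code v t \<Longrightarrow> fn 12 xs v t"
  "ev xs tdeg_code v t \<Longrightarrow> fn 13 xs v t"
  "ev xs cost_code v t \<Longrightarrow> fn 14 xs v t"
  "ev xs del_code v t \<Longrightarrow> fn 15 xs v t"
  "ev xs cands_code v t \<Longrightarrow> fn 16 xs v t"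
  "ev xs two_code v t \<Longrightarrow> fn 17 xs v t"
  "ev xs outs_code v t \<Longrightarrow> fn 18 xs v t"
  "ev xs neq_code v t \<Longrightarrow> fn 19 xs v t"
  "ev xs pick_code v t \<Longrightarrow> fn 20 xs v t"
  "ev xs three_code v t \<Longrightarrow> fn 21 xs v t"
  "ev xs cand_code v t \<Longrightarrow> fn 22 xs v t"
  "ev xs kids_code v t \<Longrightarrow> fn 23 xs v t"
  "ev xs solve_code v t \<Longrightarrow> fn 24 xs v t"
  "ev xs try_code v t \<Longrightarrow> fn 25 xs v t"
  "ev xs rep_code v t \<Longrightarrow> fn 26 xs v t"
  "ev xs expand_code v t \<Longrightarrow> fn 27 xs v t"
  "ev xs loops_code v t \<Longrightarrow> fn 28 xs v t"
  "ev xs sing_code v t \<Longrightarrow> fn 29 xs v t"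
  "ev xs part_code v t \<Longrightarrow> fn 30 xs v t"
  "ev xs parts_code v t \<Longrightarrow> fn 31 xs v t"
  by (simp_all add: fn_def prog_def)

text \<open>Through \<open>ev_weaken\<close> the rules determine value and cost schematically; the
  two remaining premises compare them with the claimed ones.\<close>

lemmas fn_run = fn_code[OF ev_weaken, unfolded main_code_def look_code_def grow_code_def sat_code_def push_code_def
    aug_code_def flow_code_def dbl_code_def others_code_def merge_code_def
    cutv_code_def ren_code_def prep_code_def tdeg_code_def cost_code_def
    del_code_def cands_code_def two_code_def outs_code_def neq_code_def
    pick_code_def three_code_def cand_code_def kids_code_def solve_code_def
    try_code_def rep_code_def expand_code_def loops_code_def sing_code_def
    part_code_def parts_code_def]

section \<open>Encodings of the data structures and step bounds\<close>

abbreviation "encN \<equiv> enc_list Atom"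

fun enc_arc :: "nat \<times> nat \<Rightarrow> data" where
  "enc_arc (u, v) = Cell (Atom u) (Atom v)"

abbreviation "encE \<equiv> enc_list enc_arc"

fun enc_visit :: "nat \<times> nat list \<Rightarrow> data" where
  "enc_visit (x, r) = Cell (Atom x) (encN r)"

abbreviation "encV \<equiv> enc_list enc_visit"

fun enc_inst :: "(nat \<times> nat) list \<times> nat \<Rightarrow> data" where
  "enc_inst (e, k) = Cell (encE e) (Atom k)"

abbreviation "encK \<equiv> enc_list enc_inst"

lemmas enc_simps = enc_list.simps enc_arc.simps enc_visit.simps enc_inst.simps

text \<open>Step bounds for inputs with at most \<open>N\<close> edges and terminals; \<open>bV N\<close> bounds visited lists.\<close>

definition "bV N = N + 4 * N * N"
definition "tLin N = 100 * Suc (2 * N)"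
definition "tLook N = 20 * Suc (bV N)"
definition "tGrow N = (2 * tLook N + 40) * Suc (2 * N)"
definition "tSat N = (tGrow N + 20) * Suc (2 * N)"
definition "tAug N = (tLin N + 40) * Suc (Suc (bV N))"
definition "tFlow N = (tSat N + tLook N + tAug N + 40) * Suc N"
definition "tCutv N = tFlow N + 3 * tLin N + 40"
definition "tRen N = (2 * tLook N + 100) * Suc (2 * N)"
definition "tPrep N = (tCutv N + tRen N + 60) * Suc N"
definition "tCands N = (tRen N + tLin N + 60) * Suc N"
definition "tTwo N = (tLook N + tPrep N + tLin N + tRen N + 100) * Suc (2 * N)"
definition "tPick N = (tLin N + 60) * Suc (2 * N)"
definition "tThree N = 2 * tLook N + 3 * tLin N + 100"
definition "tCand N = tCutv N + 5 * tRen N + 5 * tLin N + tTwo N + tPick N + tThree N + 200"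
definition "tKids N = (2 * tLook N + tCand N + 80) * Suc (2 * N)"

lemma capI: "fn i xs v (K * Suc n) \<Longrightarrow> n \<le> m \<Longrightarrow> t = K * Suc m \<Longrightarrow>
    fn i xs v t"
  by (rule fn_weaken[OF _ refl]) (auto intro: mult_le_mono)

lemma length_sing [simp]: "length (sing ts) = length ts"
  by (simp add: sing_def)

lemma sing_simps: "sing [] = []" "sing (t # ts) = (t, []) # sing ts"
  by (simp_all add: sing_def)

lemma le_bV: "(n::nat) \<le> N \<Longrightarrow> n \<le> bV N"
  by (simp add: bV_def)

section \<open>Cost of the individual functions\<close>

lemma fn_look_exact: "fn 1 [Atom x, encV vis] (encN (look x vis)) (20 * Suc (length vis))"
proof (induction x vis rule: look.induct)
  case (1 x)
  show ?case unfolding enc_simps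
    by (rule fn_run) (erule ev_absurd | rule ev_intros | (auto simp: max_def; fail)[1])+
next
  case (2 x y r vis)
  show ?case unfolding enc_simps
    by (rule fn_run) (erule ev_absurd | rule ev_intros 2 | (auto simp: max_def; fail)[1])+
qed

lemma fn_look: "length vis \<le> bV N \<Longrightarrow>
    fn 1 [Atom x, encV vis] (encN (look x vis)) (tLook N)"
  by (rule fn_weaken[OF fn_look_exact]) (simp_all add: tLook_def)

lemma fn_grow_exact: "length vis + length as \<le> bV N \<Longrightarrow>
    fn 2 [encE as, encV vis] (encV (grow as vis)) ((2 * tLook N + 40) * Suc (length as))"
proof (induction as arbitrary: vis)
  case (Nil vis)
  show ?case unfolding enc_simps
    by (rule fn_run) (erule ev_absurd | rule ev_intros | (auto simp: max_def; fail)[1])+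
next
  case (Cons a as vis)
  obtain u v where a: "a = (u, v)" by (cases a)
  have l: "length vis + length as \<le> bV N" "length ((u, look v vis) # vis) + length as \<le> bV N"
      "length vis \<le> bV N"
    using Cons.prems by auto
  note ih = Cons.IH[OF l(1)] Cons.IH[OF l(2), unfolded enc_simps] fn_look[OF l(3)]
  show ?case unfolding a enc_simps
    by (rule fn_run) (erule ev_absurd | rule ev_intros ih | (auto simp: max_def; fail)[1])+
qed

lemma length_grow: "length (grow as vis) \<le> length vis + length as"
  by (induction as vis rule: grow.induct) auto

lemma fn_grow: "length vis + length as \<le> bV N \<Longrightarrow> length as \<le> 2 * N \<Longrightarrow>
    fn 2 [encE as, encV vis] (encV (grow as vis)) (tGrow N)"
  by (rule fn_weaken[OF fn_grow_exact]) (auto simp: tGrow_def intro!: mult_le_mono)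

lemma fn_sat_exact: "length vis + length cs * length as \<le> bV N \<Longrightarrow> length as \<le> 2 * N \<Longrightarrow>
    fn 3 [encE cs, encE as, encV vis] (encV (sat cs as vis)) ((tGrow N + 20) * Suc (length cs))"
proof (induction cs arbitrary: vis)
  case (Nil vis)
  show ?case unfolding enc_simps
    by (rule fn_run) (erule ev_absurd | rule ev_intros | (auto simp: max_def; fail)[1])+
next
  case (Cons a cs vis)
  obtain u v where a: "a = (u, v)" by (cases a)
  have "length (grow as vis) + length cs * length as \<le> bV N" "length vis + length as \<le> bV N"
    using Cons.prems(1) length_grow[of as vis] by auto
  note ih = Cons.IH[OF this(1) Cons.prems(2)] fn_grow[OF this(2) Cons.prems(2)]
  show ?case unfolding a enc_simps
    by (rule fn_run) (erule ev_absurd | rule ev_intros ih | (auto simp: max_def; fail)[1])+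
qed

text \<open>A crude count: at most \<open>N\<close> sinks at the start, and at most
  \<open>2 * N\<close> passes over \<open>2 * N\<close> arcs, each arc adding at most one entry per
  pass.\<close>

lemma sat_bV:
  assumes "length vis \<le> N" "length as \<le> 2 * N" shows "length vis + length as * length as \<le> bV N"
  using assms mult_le_mono[OF assms(2,2)] by (simp add: bV_def)

lemma fn_sat: "length vis \<le> N \<Longrightarrow> length as \<le> 2 * N \<Longrightarrow>
    fn 3 [encE as, encE as, encV vis] (encV (sat as as vis)) (tSat N)"
  by (rule fn_weaken[OF fn_sat_exact[where N = N]]) (auto simp: tSat_def sat_bV intro!: mult_le_mono)

lemma fn_push_exact: "fn 4 [Atom x, Atom y, encE as] (encE (push x y as)) (40 * Suc (length as))"
proof (induction as)
  case Nil
  show ?case unfolding enc_simps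
    by (rule fn_run) (erule ev_absurd | rule ev_intros | (auto simp: max_def; fail)[1])+
next
  case (Cons a as)
  obtain u v where a: "a = (u, v)" by (cases a)
  show ?case unfolding a enc_simps
    by (rule fn_run) (erule ev_absurd | rule ev_intros Cons | (auto simp: max_def; fail)[1])+
qed

lemma fn_push: "length as \<le> 2 * N \<Longrightarrow>
    fn 4 [Atom x, Atom y, encE as] (encE (push x y as)) (tLin N)"
  by (rule fn_weaken[OF fn_push_exact]) (auto simp: tLin_def)

lemma fn_aug_exact: "length as \<le> 2 * N \<Longrightarrow>
    fn 5 [encN p, encE as] (encE (aug p as)) ((tLin N + 40) * Suc (length p))"
proof (induction p as rule: aug.induct)
  case (1 x y p as)
  have l: "length (push x y as) \<le> 2 * N" using 1(2) by simp
  note ih = 1(1)[OF l, unfolded enc_simps]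
  show ?case unfolding enc_simps
    by (rule fn_run) (erule ev_absurd | rule ev_intros ih fn_push[OF 1(2)] | (auto simp: max_def; fail)[1])+
next
  case (2 x as)
  show ?case unfolding enc_simps
    by (rule fn_run) (erule ev_absurd | rule ev_intros | (auto simp: max_def; fail)[1])+
next
  case (3 as)
  show ?case unfolding enc_simps
    by (rule fn_run) (erule ev_absurd | rule ev_intros | (auto simp: max_def; fail)[1])+
qed

lemma length_sat: "length (sat cs as vis) \<le> length vis + length cs * length as"
proof (induction cs as vis rule: sat.induct)
  case (2 c cs as vis)
  then show ?case using length_grow[of as vis] by simp
qed simp

text \<open>Bounds the stored paths, and with them the cost of \<open>aug\<close>, by the length of
  the visited list.\<close>

definition short :: "('a \<times> 'a list) list \<Rightarrow> bool" where
  "short vis \<longleftrightarrow> (\<forall>p\<in>set vis. length (snd p) < length vis)"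

lemma length_look_le:
  assumes "short vis" shows "length (look x vis) \<le> length vis"
proof (cases "x \<in> heads vis")
  case True
  then obtain r where "(x, r) \<in> set vis" "look x vis = x # r" using look_in_set by metis
  then show ?thesis using assms by (force simp: short_def)
qed (simp add: look_eq_Nil_iff[THEN iffD2])

lemma short_grow: "short vis \<Longrightarrow> short (grow as vis)"
proof (induction as vis rule: grow.induct)
  case (2 u v as vis)
  have "short ((u, look v vis) # vis)"
    using 2(2) length_look_le[OF 2(2), of v] by (auto simp: short_def less_Suc_eq_le)
  then show ?case using 2 by auto
qed simp

lemma short_sat: "short vis \<Longrightarrow> short (sat cs as vis)"
  by (induction cs as vis rule: sat.induct) (simp_all add: short_grow)

lemma short_sing: "short (sing ts)"
  by (auto simp: short_def sing_def length_pos_if_in_set)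

lemma length_sat_bV: "length vis \<le> N \<Longrightarrow> length as \<le> 2 * N \<Longrightarrow> length (sat as as vis) \<le> bV N"
  using length_sat[of as as vis] sat_bV by (meson le_trans)


lemma fn_flow_exact: "length as \<le> 2 * N \<Longrightarrow> length s \<le> N \<Longrightarrow> short s \<Longrightarrow>
    fn 6 [encE cs, encE as, Atom t, encV s]
      (encV (flow cs as t s)) ((tSat N + tLook N + tAug N + 40) * Suc (length cs))"
proof (induction cs arbitrary: as)
  case (Nil as)
  show ?case unfolding enc_simps
    by (rule fn_run) (erule ev_absurd | rule ev_intros fn_sat[OF Nil(2,1)] | (auto simp: max_def; fail)[1])+
next
  case (Cons a cs as)
  obtain u v where a: "a = (u, v)" by (cases a)
  let ?vis = "sat as as s"
  have v: "length ?vis \<le> bV N" using Cons.prems by (intro length_sat_bV)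
  have "length (look t ?vis) \<le> bV N"
    using v length_look_le[OF short_sat[OF Cons.prems(3)]] by (rule le_trans[rotated])
  then have f5: "fn 5 [encN (look t ?vis), encE as] (encE (aug (look t ?vis) as)) (tAug N)"
    by (intro capI[where m = "Suc (bV N)", OF fn_aug_exact[OF Cons.prems(1)]]) (simp_all add: tAug_def)
  have "length (aug (look t ?vis) as) \<le> 2 * N" using Cons.prems(1) by simp
  note ih = f5 Cons.IH[OF this Cons.prems(2,3)] fn_look[OF v] fn_sat[OF Cons.prems(2,1)]
  show ?case unfolding a enc_simps
    by (rule fn_run) (erule ev_absurd | rule ev_intros ih | (auto simp: max_def; fail)[1])+
qed

lemma fn_flow: "length es \<le> N \<Longrightarrow> length ts \<le> N \<Longrightarrow>
    fn 6 [encE es, encE (dbl es), Atom t, encV (sing ts)] (encV (flow es (dbl es) t (sing ts))) (tFlow N)"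
  by (rule fn_weaken[OF fn_flow_exact[where N = N]]) (auto simp: tFlow_def short_sing intro!: mult_le_mono)

lemma fn_dbl_exact: "fn 7 [encE es] (encE (dbl es)) (40 * Suc (length es))"
proof (induction es)
  case Nil
  show ?case unfolding enc_simps
    by (rule fn_run) (erule ev_absurd | rule ev_intros | (auto simp: max_def; fail)[1])+
next
  case (Cons a es)
  obtain u v where a: "a = (u, v)" by (cases a)
  show ?case unfolding a enc_simps
    by (rule fn_run) (erule ev_absurd | rule ev_intros Cons | (auto simp: max_def; fail)[1])+
qed

lemma fn_dbl: "length es \<le> 2 * N \<Longrightarrow> fn 7 [encE es] (encE (dbl es)) (tLin N)"
  by (rule fn_weaken[OF fn_dbl_exact]) (auto simp: tLin_def)

lemma fn_others_exact: "fn 8 [Atom t, encV (sing ts)] (encV (sing (filter (\<lambda>s. s \<noteq> t) ts))) (40 * Suc (length ts))"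
proof (induction ts)
  case Nil
  show ?case unfolding sing_simps enc_simps
    by (rule fn_run) (erule ev_absurd | rule ev_intros | (auto simp: max_def sing_simps; fail)[1])+
next
  case (Cons s ts)
  show ?case unfolding sing_simps enc_simps
    by (rule fn_run) (erule ev_absurd | rule ev_intros Cons | (auto simp: max_def sing_simps; fail)[1])+
qed

lemma fn_others: "length ts \<le> 2 * N \<Longrightarrow>
    fn 8 [Atom t, encV (sing ts)] (encV (sing (filter (\<lambda>s. s \<noteq> t) ts))) (tLin N)"
  by (rule fn_weaken[OF fn_others_exact]) (auto simp: tLin_def)

lemma fn_merge_exact: "fn 9 [Atom v, Atom t, encE es] (encE (rename (merge v t) es)) (60 * Suc (length es))"
proof (induction es)
  case Nil
  show ?case unfolding enc_simps
    by (rule fn_run) (erule ev_absurd | rule ev_intros | (auto simp: max_def; fail)[1])+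
next
  case (Cons p es)
  obtain x y where p: "p = (x, y)" by (cases p)
  show ?case unfolding p enc_simps
    by (rule fn_run) (erule ev_absurd | rule ev_intros Cons | (auto simp: max_def; fail)[1])+
qed

lemma fn_merge: "length es \<le> 2 * N \<Longrightarrow>
    fn 9 [Atom v, Atom t, encE es] (encE (rename (merge v t) es)) (tLin N)"
  by (rule fn_weaken[OF fn_merge_exact]) (auto simp: tLin_def)

lemma fn_cutv: "length es \<le> N \<Longrightarrow> length ts \<le> N \<Longrightarrow>
    fn 10 [encE es, encV (sing ts), Atom t, Atom v] (encV (cutv es ts t v)) (tCutv N)"
proof -
  assume es: "length es \<le> N" and ts: "length ts \<le> N"
  let ?ts = "filter (\<lambda>s. s \<noteq> t) ts" and ?e = "rename (merge v t) es"
  have l: "length es \<le> 2 * N" "length ts \<le> 2 * N" "length ?e \<le> 2 * N" "length ?e \<le> N" "length ?ts \<le> N"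
    using es ts length_filter_le[of "\<lambda>s. s \<noteq> t" ts] by (simp_all del: length_filter_le)
  note ih = fn_merge[OF l(1), of v t] fn_others[OF l(2), of t] fn_dbl[OF l(3)] fn_flow[OF l(4,5), of t]
  show ?thesis
    by (rule fn_run) (erule ev_absurd | rule ev_intros ih | (auto simp: max_def cutv_def Let_def tCutv_def; fail)[1])+
qed

lemma length_cutv: "length (es :: ('a \<times> 'a) list) \<le> N \<Longrightarrow> length ts \<le> N \<Longrightarrow> length (cutv es ts t v) \<le> bV N"
proof -
  assume *: "length es \<le> N" "length ts \<le> N"
  have "\<exists>as. flow cs as' t s = sat as as s \<and> length as = length as'" for cs :: "('a \<times> 'a) list" and as' and s
  proof (induction cs arbitrary: as')
    case (Cons c cs)
    show ?case using Cons.IH[of "aug (look t (sat as' as' s)) as'"] by simp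
  qed auto
  from this[of "rename (merge v t) es" "dbl (rename (merge v t) es)" "sing (filter (\<lambda>s. s \<noteq> t) ts)"]
  obtain as where "cutv es ts t v = sat as as (sing (filter (\<lambda>s. s \<noteq> t) ts))" "length as = 2 * length es"
    unfolding cutv_def Let_def by auto
  moreover have "length (filter (\<lambda>s. s \<noteq> t) ts) \<le> N" using * length_filter_le le_trans by blast
  ultimately show ?thesis using * by (simp add: length_sat_bV)
qed

lemma fn_ren_exact: "length H \<le> bV N \<Longrightarrow>
    fn 11 [encV H, Atom t, encE es] (encE (ren H t es)) ((2 * tLook N + 100) * Suc (length es))"
proof (induction es)
  case Nil
  show ?case unfolding enc_simps
    by (rule fn_run) (erule ev_absurd | rule ev_intros | (auto simp: max_def ren_def; fail)[1])+
next
  case (Cons a es)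
  obtain u v where a: "a = (u, v)" by (cases a)
  note ih = fn_look[OF Cons.prems] Cons.IH[OF Cons.prems]
  show ?case unfolding a enc_simps
    by (rule fn_run) (erule ev_absurd | rule ev_intros ih | (auto simp: max_def ren_def; fail)[1])+
qed

lemma fn_ren: "length H \<le> bV N \<Longrightarrow> length es \<le> 2 * N \<Longrightarrow>
    fn 11 [encV H, Atom t, encE es] (encE (ren H t es)) (tRen N)"
  by (rule capI[where m = "2 * N", OF fn_ren_exact[where N = N]]) (simp_all add: tRen_def)

lemma length_ren [simp]: "length (ren H t es) = length es"
  by (simp add: ren_def)

lemma length_prep [simp]: "length (prep l ts es) = length es"
  by (induction l ts es rule: prep.induct) simp_all

lemma fn_prep_exact: "length es \<le> N \<Longrightarrow> length ts \<le> N \<Longrightarrow>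
    fn 12 [encV (sing l), encV (sing ts), encE es]
      (encE (prep l ts es)) ((tCutv N + tRen N + 60) * Suc (length l))"
proof (induction l arbitrary: es)
  case (Nil es)
  show ?case unfolding sing_simps enc_simps
    by (rule fn_run) (erule ev_absurd | rule ev_intros | (auto simp: max_def; fail)[1])+
next
  case (Cons t l es)
  have l: "length (ren (cutv es ts t t) t es) \<le> N" "length es \<le> 2 * N" using Cons.prems by simp_all
  note ih = fn_cutv[OF Cons.prems] fn_ren[OF length_cutv[OF Cons.prems] l(2)] Cons.IH[OF l(1) Cons.prems(2)]
  show ?case unfolding sing_simps enc_simps
    by (rule fn_run) (erule ev_absurd | rule ev_intros ih | (auto simp: max_def; fail)[1])+
qed

lemma fn_prep: "length es \<le> N \<Longrightarrow> length ts \<le> N \<Longrightarrow>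
    fn 12 [encV (sing ts), encV (sing ts), encE es] (encE (prep ts ts es)) (tPrep N)"
  by (rule capI[where m = "N", OF fn_prep_exact[where N = N]]) (simp_all add: tPrep_def)

lemma fn_tdeg_exact: "length ts \<le> bV N \<Longrightarrow>
    fn 13 [encV (sing ts), encE es] (Atom (tdeg ts es)) ((2 * tLook N + 100) * Suc (length es))"
proof (induction es)
  case Nil
  show ?case unfolding enc_simps
    by (rule fn_run) (erule ev_absurd | rule ev_intros | (auto simp: max_def; fail)[1])+
next
  case (Cons a es)
  obtain u v where a: "a = (u, v)" by (cases a)
  have l: "length (sing ts) \<le> bV N" using Cons.prems by simp
  note ih = fn_look[OF l] Cons.IH[OF Cons.prems]
  show ?case unfolding a enc_simps
    by (rule fn_run) (erule ev_absurd | rule ev_intros ih | (auto simp: max_def look_sing; fail)[1])+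
qed

lemma fn_tdeg: "length ts \<le> N \<Longrightarrow> length es \<le> 2 * N \<Longrightarrow>
    fn 13 [encV (sing ts), encE es] (Atom (tdeg ts es)) (tRen N)"
  by (rule capI[where m = "2 * N", OF fn_tdeg_exact[where N = N]]) (simp_all add: tRen_def le_bV)

lemma fn_cost_exact: "fn 14 [encE es] (Atom (cost es id)) (40 * Suc (length es))"
proof (induction es)
  case Nil
  show ?case unfolding enc_simps
    by (rule fn_run) (erule ev_absurd | rule ev_intros | (auto simp: max_def; fail)[1])+
next
  case (Cons a es)
  obtain u v where a: "a = (u, v)" by (cases a)
  show ?case unfolding a enc_simps
    by (rule fn_run) (erule ev_absurd | rule ev_intros Cons | (auto simp: max_def cost_Cons id_def; fail)[1])+
qed

lemma fn_cost: "length es \<le> 2 * N \<Longrightarrow> fn 14 [encE es] (Atom (cost es id)) (tLin N)"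
  by (rule fn_weaken[OF fn_cost_exact]) (auto simp: tLin_def)

lemma fn_del_exact: "fn 15 [Atom x, Atom y, encE es] (encE (del x y es)) (80 * Suc (length es))"
proof (induction es)
  case Nil
  show ?case unfolding enc_simps
    by (rule fn_run) (erule ev_absurd | rule ev_intros | (auto simp: max_def; fail)[1])+
next
  case (Cons a es)
  obtain u v where a: "a = (u, v)" by (cases a)
  show ?case unfolding a enc_simps
    by (rule fn_run) (erule ev_absurd | rule ev_intros Cons | (auto simp: max_def; fail)[1])+
qed

lemma fn_del: "length es \<le> 2 * N \<Longrightarrow>
    fn 15 [Atom x, Atom y, encE es] (encE (del x y es)) (tLin N)"
  by (rule fn_weaken[OF fn_del_exact]) (auto simp: tLin_def)

text \<open>Treating exactly the terminals as visited lets the program build its candidates with the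
  code for \<open>ren\<close>.\<close>

lemma ren_sing: "ren (sing ts) t es = rename (\<lambda>x. if x \<in> set ts then x else t) es"
  unfolding ren_def by (rule rename_cong) (simp add: look_sing)

lemma fn_cands_exact: "length es \<le> N \<Longrightarrow> length ts \<le> N \<Longrightarrow>
    fn 16 [encV (sing l), encV (sing ts), encE es, Atom k]
      (encE (cands l ts es k)) ((tRen N + tLin N + 60) * Suc (length l))"
proof (induction l)
  case Nil
  show ?case unfolding sing_simps enc_simps
    by (rule fn_run) (erule ev_absurd | rule ev_intros | (auto simp: max_def; fail)[1])+
next
  case (Cons t l)
  let ?e = "rename (\<lambda>x. if x \<in> set ts then x else t) es"
  have l: "length (sing ts) \<le> bV N" "length es \<le> 2 * N" "length ?e \<le> 2 * N"
    using Cons.prems by (simp_all add: le_bV)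
  note ih = fn_ren[OF l(1,2), of t, unfolded ren_sing] fn_cost[OF l(3)] Cons.IH[OF Cons.prems]
  show ?case unfolding sing_simps enc_simps
    by (rule fn_run) (erule ev_absurd | rule ev_intros ih | (auto simp: max_def Let_def; fail)[1])+
qed

lemma fn_cands: "length es \<le> N \<Longrightarrow> length ts \<le> N \<Longrightarrow>
    fn 16 [encV (sing ts), encV (sing ts), encE es, Atom k] (encE (cands ts ts es k)) (tCands N)"
  by (rule capI[where m = "N", OF fn_cands_exact[where N = N]]) (simp_all add: tCands_def)

lemma fn_two_exact: "length e1 \<le> N \<Longrightarrow> length ts \<le> N \<Longrightarrow> length H \<le> bV N \<Longrightarrow>
    fn 17 [encE l, encV (sing ts), encE e1, encV H, Atom t, Atom d, Atom k]
      (encK (two l ts e1 H t d k)) ((tLook N + tPrep N + tLin N + tRen N + 100) * Suc (length l))"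
proof (induction l)
  case Nil
  show ?case unfolding enc_simps
    by (rule fn_run) (erule ev_absurd | rule ev_intros | (auto simp: max_def; fail)[1])+
next
  case (Cons a l)
  obtain u v where a: "a = (u, v)" by (cases a)
  let ?e3 = "del t v e1"
  have l: "length e1 \<le> 2 * N" "length ?e3 \<le> N" "length (prep ts ts ?e3) \<le> 2 * N"
    using Cons.prems(1) length_del[of t v e1] by simp_all
  note ih = fn_look[OF Cons.prems(3)] fn_del[OF l(1)] fn_prep[OF l(2) Cons.prems(2)]
    fn_tdeg[OF Cons.prems(2) l(3)] Cons.IH[OF Cons.prems]
  show ?case unfolding a enc_simps
    by (rule fn_run) (erule ev_absurd | rule ev_intros ih | (auto simp: max_def Let_def; fail)[1])+
qed

lemma fn_two: "length e1 \<le> N \<Longrightarrow> length ts \<le> N \<Longrightarrow> length H \<le> bV N \<Longrightarrow> length l \<le> 2 * N \<Longrightarrow>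
    fn 17 [encE l, encV (sing ts), encE e1, encV H, Atom t, Atom d, Atom k] (encK (two l ts e1 H t d k)) (tTwo N)"
  by (rule capI[where m = "2 * N", OF fn_two_exact[where N = N]]) (simp_all add: tTwo_def)

lemma fn_outs_exact: "length H \<le> bV N \<Longrightarrow>
    fn 18 [encV H, Atom t, encE l] (encN (outs H t l)) ((2 * tLook N + 100) * Suc (length l))"
proof (induction l)
  case Nil
  show ?case unfolding enc_simps
    by (rule fn_run) (erule ev_absurd | rule ev_intros | (auto simp: max_def; fail)[1])+
next
  case (Cons a l)
  obtain u v where a: "a = (u, v)" by (cases a)
  note ih = fn_look[OF Cons.prems] Cons.IH[OF Cons.prems]
  show ?case unfolding a enc_simps
    by (rule fn_run) (erule ev_absurd | rule ev_intros ih | (auto simp: max_def; fail)[1])+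
qed

lemma fn_outs: "length H \<le> bV N \<Longrightarrow> length l \<le> 2 * N \<Longrightarrow>
    fn 18 [encV H, Atom t, encE l] (encN (outs H t l)) (tRen N)"
  by (rule capI[where m = "2 * N", OF fn_outs_exact[where N = N]]) (simp_all add: tRen_def)

lemma length_outs: "length (outs H t l) \<le> length l"
  by (induction H t l rule: outs.induct) auto

lemma fn_neq_exact: "fn 19 [Atom z, encN ys] (encN (filter (\<lambda>y. y \<noteq> z) ys)) (40 * Suc (length ys))"
proof (induction ys)
  case Nil
  show ?case unfolding enc_simps
    by (rule fn_run) (erule ev_absurd | rule ev_intros | (auto simp: max_def; fail)[1])+
next
  case (Cons y ys)
  show ?case unfolding enc_simps
    by (rule fn_run) (erule ev_absurd | rule ev_intros Cons | (auto simp: max_def; fail)[1])+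
qed

lemma fn_neq: "length ys \<le> 2 * N \<Longrightarrow>
    fn 19 [Atom z, encN ys] (encN (filter (\<lambda>y. y \<noteq> z) ys)) (tLin N)"
  by (rule fn_weaken[OF fn_neq_exact]) (auto simp: tLin_def)

lemma length_le_1_iff: "length xs \<le> Suc 0 \<longleftrightarrow> xs = [] \<or> tl xs = []"
  by (cases xs) auto

lemma fn_pick_exact: "length ys \<le> 2 * N \<Longrightarrow>
    fn 20 [encN zs, encN ys] (encN (pick zs ys)) ((tLin N + 60) * Suc (length zs))"
proof (induction zs)
  case Nil
  show ?case unfolding enc_simps
    by (rule fn_run) (erule ev_absurd | rule ev_intros | (auto simp: max_def; fail)[1])+
next
  case (Cons z zs)
  note ih = fn_neq[OF Cons.prems] Cons.IH[OF Cons.prems] enc_Cell[of _ Atom]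
  show ?case unfolding enc_simps
    by (rule fn_run) (erule ev_absurd | rule ev_intros ih | (auto simp: max_def Let_def length_le_1_iff; fail)[1])+
qed

lemma fn_pick: "length ys \<le> 2 * N \<Longrightarrow>
    fn 20 [encN ys, encN ys] (encN (pick ys ys)) (tPick N)"
  by (rule capI[where m = "2 * N", OF fn_pick_exact[where N = N]]) (simp_all add: tPick_def)

lemma fn_three:
  assumes "length e2 \<le> 2 * N" "length ts \<le> bV N"
  shows "fn 21 [encN q, encV (sing ts), Atom t, encE e1, encE e2, Atom k] (encK (three q ts t e1 e2 k)) (tThree N)"
proof -
  have l: "length (sing ts) \<le> bV N" using assms(2) by simp
  note ih = fn_look[OF l] fn_merge[OF assms(1)]
  consider "q = []" | z where "q = [z]" | z a r where "q = z # a # r" by (metis list.exhaust)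
  then show ?thesis
  proof cases
    case 1
    show ?thesis unfolding 1 enc_simps
    by (rule fn_run) (erule ev_absurd | rule ev_intros | (auto simp: max_def tThree_def; fail)[1])+
  next
    case 2
    show ?thesis unfolding 2 enc_simps
    by (rule fn_run) (erule ev_absurd | rule ev_intros ih | (auto simp: max_def tThree_def look_sing; fail)[1])+
  next
    case 3
    have "length (rename (merge a t) e2) \<le> 2 * N" using assms(1) by simp
    note ih = ih fn_del[OF this]
    show ?thesis unfolding 3 enc_simps
    by (rule fn_run) (erule ev_absurd | rule ev_intros ih | (auto simp: max_def tThree_def look_sing; fail)[1])+
  qed
qed

lemma fn_cand:
  assumes "length e \<le> N" "length ts \<le> N"
  shows "fn 22 [encV (sing ts), encE e, Atom k, Atom t, Atom v] (encK (cand ts e k t v)) (tCand N)"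
proof -
  define H where "H = cutv e ts t v"
  define e1 where "e1 = del t v e"
  define e2 where "e2 = ren H t e"
  define ys where "ys = outs H t (dbl e)"
  have l: "length e \<le> 2 * N" "length e1 \<le> N" "length e1 \<le> 2 * N" "length e2 \<le> 2 * N" "length H \<le> bV N"
    "length ts \<le> bV N" "length (dbl e1) \<le> 2 * N" "length (dbl e) \<le> 2 * N" "length ys \<le> 2 * N"
    using assms length_del[of t v e] length_outs[of H t "dbl e"] length_cutv[OF assms] le_bV
    by (auto simp: e1_def e2_def H_def ys_def)
  note ih = fn_cutv[OF assms, of t v, folded H_def] fn_ren[OF l(5,1), of t, folded e2_def]
    fn_del[OF l(1), of t v, folded e1_def] fn_tdeg[OF assms(2) l(1)] fn_tdeg[OF assms(2) l(4)]
    fn_dbl[OF l(3)] fn_two[OF l(2) assms(2) l(5,7)] fn_dbl[OF l(1)] fn_outs[OF l(5,8), of t, folded ys_def]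
    fn_pick[OF l(9)] fn_three[OF l(4,6)]
  have c: "cand ts e k t v =
    (if tdeg ts e + 1 < tdeg ts e2 then [(e2, k), (e1, k - 1)]
     else let r = two (dbl e1) ts e1 H t (tdeg ts e) k
          in if r \<noteq> [] then (e2, k) # r else three (pick ys ys) ts t e1 e2 k)"
    by (simp add: cand_def Let_def H_def e1_def e2_def ys_def)
  show ?thesis unfolding c
    by (rule fn_run) (erule ev_absurd | rule ev_intros ih | (auto simp: max_def Let_def tCand_def; fail)[1])+
qed

lemma fn_kids_exact: "length e \<le> N \<Longrightarrow> length ts \<le> N \<Longrightarrow>
    fn 23 [encE l, encV (sing ts), encE e, Atom k]
      (encK (kids l ts e k)) ((2 * tLook N + tCand N + 80) * Suc (length l))"
proof (induction l)
  case Nil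
  show ?case unfolding enc_simps
    by (rule fn_run) (erule ev_absurd | rule ev_intros | (auto simp: max_def; fail)[1])+
next
  case (Cons a l)
  obtain u v where a: "a = (u, v)" by (cases a)
  have l: "length (sing ts) \<le> bV N" using Cons.prems by (simp add: le_bV)
  note ih = fn_look[OF l] fn_cand[OF Cons.prems] Cons.IH[OF Cons.prems]
  show ?case unfolding a enc_simps
    by (rule fn_run) (erule ev_absurd | rule ev_intros ih | (auto simp: max_def look_sing; fail)[1])+
qed

lemma fn_kids: "length e \<le> N \<Longrightarrow> length ts \<le> N \<Longrightarrow>
    fn 23 [encE (dbl e), encV (sing ts), encE e, Atom k] (encK (kids (dbl e) ts e k)) (tKids N)"
  by (rule capI[where m = "2 * N", OF fn_kids_exact[where N = N]]) (simp_all add: tKids_def)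

section \<open>Running time of the branching algorithm\<close>

definition tNode :: "nat \<Rightarrow> nat" where
  "tNode N = tPrep N + tRen N + tCands N + tLin N + tKids N + 500"

text \<open>An empty \<open>r\<close> reports that there is no solution; otherwise the loops at the
  front of \<open>r\<close> show the terminal assigned to each recorded vertex.\<close>

definition answers :: "'a set \<Rightarrow> nat \<Rightarrow> ('a \<times> 'a) list \<Rightarrow> nat \<Rightarrow> ('a \<times> 'a) list \<Rightarrow> bool" where
  "answers T n e k r \<longleftrightarrow> (if solv T e k then r \<noteq> [] \<and>
     (\<exists>\<phi>. labelling T \<phi> \<and> cost e \<phi> \<le> k \<and> take n r = rename \<phi> (take n e)) else r = [])"

lemma answers_deriv:
  assumes "deriv T n e k e' k'" "answers T n e' k' r" "r \<noteq> []" shows "answers T n e k r"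
proof -
  obtain f where f: "\<forall>s\<in>T. f s = s" "take n e' = rename f (take n e)"
      "\<And>\<phi>. cost e' \<phi> \<le> k' \<Longrightarrow> cost e (\<phi> \<circ> f) \<le> k"
    using assms(1) unfolding deriv_def by blast
  have s: "solv T e' k'" using assms(2,3) by (auto simp: answers_def split: if_splits)
  then obtain \<phi> where \<phi>: "labelling T \<phi>" "cost e' \<phi> \<le> k'" "take n r = rename \<phi> (take n e')"
    using assms(2) by (auto simp: answers_def)
  have "labelling T (\<phi> \<circ> f)" using \<phi>(1) f(1) by (intro labelling_comp) auto
  moreover have "take n r = rename (\<phi> \<circ> f) (take n e)" using \<phi>(3) f(2) by (simp add: rename_rename)
  moreover have "cost e (\<phi> \<circ> f) \<le> k" using f(3) \<phi>(2) by blast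
  ultimately show ?thesis using assms(3) deriv_solv[OF assms(1) s] by (auto simp: answers_def)
qed

lemma fn_try_Nil: "fn 25 [encV (sing ts), encK []] (encE []) 40"
  unfolding enc_simps
  by (rule fn_run) (erule ev_absurd | rule ev_intros | (auto simp: max_def; fail)[1])+

lemma fn_try_Cons:
  assumes "fn 24 [encV (sing ts), encE e, Atom k] (encE r1) s1"
    "fn 25 [encV (sing ts), encK cs] (encE r2) s2"
  shows "fn 25 [encV (sing ts), encK ((e, k) # cs)] (encE (if r1 \<noteq> [] then r1 else r2)) (s1 + s2 + 40)"
  unfolding enc_simps
  by (rule fn_run) (erule ev_absurd | rule ev_intros assms | (auto simp: max_def; fail)[1])+

lemma fn_solve_large:
  assumes "length e \<le> N" "length ts \<le> N" and c: "k + k < tdeg ts (prep ts ts e)"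
  shows "fn 24 [encV (sing ts), encE e, Atom k] (encE []) (tNode N)"
proof -
  have l: "length (prep ts ts e) \<le> 2 * N" using assms(1) by simp
  have absurd: "\<not> k + k < tdeg ts (prep ts ts e) \<Longrightarrow> ev env ex (Atom 0) 0" for env ex using c by simp
  note ih = fn_prep[OF assms(1,2)] fn_tdeg[OF assms(2) l]
  show ?thesis
    by (rule fn_run) (erule ev_absurd absurd | rule ev_intros ih | (auto simp: max_def c tNode_def; fail)[1])+
qed

lemma fn_solve_cands:
  assumes "length e \<le> N" "length ts \<le> N" and c: "\<not> k + k < tdeg ts (prep ts ts e)"
    "cands ts ts (prep ts ts e) k \<noteq> []"
  shows "fn 24 [encV (sing ts), encE e, Atom k] (encE (cands ts ts (prep ts ts e) k)) (tNode N)"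
proof -
  have l: "length (prep ts ts e) \<le> 2 * N" "length (prep ts ts e) \<le> N" using assms(1) by simp_all
  have absurd: "k + k < tdeg ts (prep ts ts e) \<Longrightarrow> ev env ex (Atom 0) 0"
    "\<not> is_pair (encE (cands ts ts (prep ts ts e) k)) \<Longrightarrow> ev env ex (Atom 0) 0" for env ex
    using c by simp_all
  note ih = fn_prep[OF assms(1,2)] fn_tdeg[OF assms(2) l(1)] fn_cands[OF l(2) assms(2)]
  show ?thesis
    by (rule fn_run) (erule ev_absurd absurd | rule ev_intros ih | (auto simp: max_def c tNode_def; fail)[1])+
qed

text \<open>The 200 steps held in reserve pay for the loop over the children, which costs at most
  \<open>40 * (3 + 1)\<close> beyond the recursive calls.\<close>

lemma fn_solve_kids:
  assumes "length e \<le> N" "length ts \<le> N" and c: "\<not> k + k < tdeg ts (prep ts ts e)"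
    "cands ts ts (prep ts ts e) k = []"
    and r: "fn 25 [encV (sing ts), encK (kids (dbl (prep ts ts e)) ts (prep ts ts e) k)] (encE r) s"
  shows "fn 24 [encV (sing ts), encE e, Atom k] (encE r) (tNode N + s - 200)"
proof -
  have l: "length (prep ts ts e) \<le> 2 * N" "length (prep ts ts e) \<le> N" using assms(1) by simp_all
  have absurd: "k + k < tdeg ts (prep ts ts e) \<Longrightarrow> ev env ex (Atom 0) 0"
    "is_pair (encE (cands ts ts (prep ts ts e) k)) \<Longrightarrow> ev env ex (Atom 0) 0" for env ex
    using c by simp_all
  note ih = fn_prep[OF assms(1,2)] fn_tdeg[OF assms(2) l(1)] fn_cands[OF l(2) assms(2)]
    fn_dbl[OF l(1)] fn_kids[OF l(2) assms(2)] r
  show ?thesis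
    by (rule fn_run) (erule ev_absurd absurd | rule ev_intros ih | (auto simp: max_def c tNode_def; fail)[1])+
qed

text \<open>\<open>1.8395\<close> lies between the root \<open>1.8393\<close> of \<open>x\<^sup>3 = x\<^sup>2 + x + 1\<close> and \<open>1.84\<close>.\<close>

definition base :: real where "base = 1.8395"

lemma base: "1 \<le> base" "base ^ 2 + base + 1 \<le> base ^ 3"
  by (simp_all add: base_def power2_eq_square power3_eq_cube)

lemma sum_drops:
  assumes "ds \<in> drops" "3 \<le> y" shows "(\<Sum>d\<leftarrow>ds. base ^ (y - d)) \<le> base ^ y"
proof -
  obtain z where y: "y = z + 3" using assms(2) by (metis le_add_diff_inverse2)
  have "base * 1 \<le> base * base" using base(1) by (intro mult_left_mono) auto
  then have b: "base ^ 2 \<le> base ^ 3" "base ^ 2 + base \<le> base ^ 3" "base ^ 2 + base + 1 \<le> base ^ 3"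
    using base power_increasing[of 2 3 base] by auto
  then have "base ^ z * base ^ 2 \<le> base ^ z * base ^ 3" "base ^ z * (base ^ 2 + base) \<le> base ^ z * base ^ 3"
    "base ^ z * (base ^ 2 + base + 1) \<le> base ^ z * base ^ 3"
    using base(1) by (auto intro!: mult_left_mono)
  then show ?thesis using assms(1)
    by (auto simp: y drops_def power_add algebra_simps power2_eq_square power3_eq_cube numeral_eq_Suc)
qed

text \<open>The factor \<open>real y + 1\<close> accounts for the levels of the recursion, each of
  which has total weight at most \<open>base ^ y\<close>.\<close>

definition tBranch :: "nat \<Rightarrow> nat \<Rightarrow> real" where
  "tBranch N y = real (tNode N) * (real y + 1) * base ^ y"

lemma tNode_le: "real (tNode N) \<le> tBranch N y"
proof -
  have "1 * 1 \<le> (real y + 1) * base ^ y" using base(1) by (intro mult_mono) auto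
  then have "real (tNode N) * 1 \<le> real (tNode N) * ((real y + 1) * base ^ y)"
    by (intro mult_left_mono) auto
  then show ?thesis by (simp add: tBranch_def mult.assoc)
qed

text \<open>The level factor of every child is at most \<open>y\<close>, so the children use up
  \<open>y\<close> of the \<open>y + 1\<close> shares; the last share pays for the node
  itself.\<close>

lemma sum_tBranch:
  assumes "ds \<in> drops" "3 \<le> y"
  shows "real (tNode N) + (\<Sum>d\<leftarrow>ds. tBranch N (y - d)) \<le> tBranch N y"
proof -
  have "1 \<le> d" if "d \<in> set ds" for d using assms(1) that by (auto simp: drops_def)
  then have "real (y - d) + 1 \<le> real y" if "d \<in> set ds" for d
    using that assms(2) by (fastforce simp: of_nat_diff)
  then have "tBranch N (y - d) \<le> real (tNode N) * real y * base ^ (y - d)" if "d \<in> set ds" for d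
    unfolding tBranch_def using base(1) that by (intro mult_right_mono mult_left_mono) auto
  then have "(\<Sum>d\<leftarrow>ds. tBranch N (y - d)) \<le> (\<Sum>d\<leftarrow>ds. real (tNode N) * real y * base ^ (y - d))"
    by (intro sum_list_mono)
  also have "\<dots> = real (tNode N) * real y * (\<Sum>d\<leftarrow>ds. base ^ (y - d))"
    by (simp add: sum_list_const_mult)
  also have "\<dots> \<le> real (tNode N) * real y * base ^ y"
    using sum_drops[OF assms] by (intro mult_left_mono) auto
  finally have *: "(\<Sum>d\<leftarrow>ds. tBranch N (y - d)) \<le> real (tNode N) * real y * base ^ y" .
  have "real (tNode N) * 1 \<le> real (tNode N) * base ^ y"
    using base(1) by (intro mult_left_mono) auto
  with * show ?thesis by (simp add: tBranch_def algebra_simps)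
qed

definition solves_within :: "nat list \<Rightarrow> nat \<Rightarrow> (nat \<times> nat) list \<Rightarrow> nat \<Rightarrow> real \<Rightarrow> bool" where
  "solves_within ts n e k b \<longleftrightarrow> (\<exists>r s. fn 24 [encV (sing ts), encE e, Atom k] (encE r) s \<and>
     answers (set ts) n e k r \<and> real s \<le> b)"

lemma fn_try:
  assumes "\<And>e k. (e, k) \<in> set cs \<Longrightarrow> solves_within ts n e k (b (e, k))"
  shows "\<exists>r s. fn 25 [encV (sing ts), encK cs] (encE r) s \<and>
     real s \<le> (\<Sum>c\<leftarrow>cs. b c) + 40 * (length cs + 1) \<and>
     (if \<exists>(e, k)\<in>set cs. solv (set ts) e k
      then r \<noteq> [] \<and> (\<exists>(e, k)\<in>set cs. answers (set ts) n e k r) else r = [])"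
  using assms
proof (induction cs)
  case Nil
  show ?case using fn_try_Nil[of ts] by (intro exI[of _ "[]"] exI[of _ 40]) auto
next
  case (Cons c cs)
  obtain e k where c: "c = (e, k)" by (cases c)
  obtain r1 s1 where 1: "fn 24 [encV (sing ts), encE e, Atom k] (encE r1) s1"
    "answers (set ts) n e k r1" "real s1 \<le> b c"
    using Cons.prems[of e k] by (auto simp: solves_within_def c)
  obtain r2 s2 where 2: "fn 25 [encV (sing ts), encK cs] (encE r2) s2"
    "real s2 \<le> (\<Sum>c\<leftarrow>cs. b c) + 40 * (length cs + 1)"
    "if \<exists>(e, k)\<in>set cs. solv (set ts) e k
      then r2 \<noteq> [] \<and> (\<exists>(e, k)\<in>set cs. answers (set ts) n e k r2) else r2 = []"
    using Cons.IH Cons.prems by fastforce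
  have "r1 \<noteq> [] \<longleftrightarrow> solv (set ts) e k" using 1(2) by (auto simp: answers_def split: if_splits)
  then have "if \<exists>(e, k)\<in>set (c # cs). solv (set ts) e k
      then (if r1 \<noteq> [] then r1 else r2) \<noteq> [] \<and>
        (\<exists>(e, k)\<in>set (c # cs). answers (set ts) n e k (if r1 \<noteq> [] then r1 else r2))
      else (if r1 \<noteq> [] then r1 else r2) = []"
    using 1(2) 2(3) by (auto simp: c split: if_splits)
  moreover have "real (s1 + s2 + 40) \<le> (\<Sum>c\<leftarrow>c # cs. b c) + 40 * (length (c # cs) + 1)"
    using 1(3) 2(2) by simp
  ultimately show ?case using fn_try_Cons[OF 1(1) 2(1)] unfolding c by blast
qed

lemma node_prep:
  assumes "distinct ts" "loops n e" "1 \<le> n" and c: "\<not> k + k < tdeg ts (prep ts ts e)"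
    "cands ts ts (prep ts ts e) k = []"
  shows "node ts (prep ts ts e) k n"
proof
  have p: "\<forall>t\<in>set ts. minimal_at (set ts) (prep ts ts e) t" using prep[of ts ts e] by simp
  then show "minimal_at (set ts) (prep ts ts e) t" if "t \<in> set ts" for t using that by blast
  have "prep ts ts e \<noteq> []" using assms(2,3) length_prep[of ts ts e]
    by (auto simp: loops_def simp del: length_prep)
  \<comment> \<open>The failed candidate of \<open>t\<close> costs more than \<open>k\<close>, yet
    at most \<open>tdeg\<close> minus the degree of \<open>t\<close>, and \<open>tdeg\<close> is at
    most \<open>2 * k\<close>.\<close>
  then show "dg (prep ts ts e) {t} + 1 \<le> k" if "t \<in> set ts" for t
    using cands_Nil[OF c(2) _ that] cost_cand_le[OF that, of "prep ts ts e"] c(1) by linarith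
  show "loops n (prep ts ts e)" using deriv_prep[OF assms(2)] by (auto simp: deriv_def)
qed (rule assms(1))

text \<open>Without children no edge joins a terminal to a non-terminal. The candidate then cuts
  only edges between distinct terminals, which every labelling cuts, so its failure rules out all
  labellings.\<close>

lemma (in node) unsolvable_if_no_kids:
  assumes "cands ts ts e k = []" "e \<noteq> []" "kids (dbl e) ts e k = []" "ts \<noteq> []"
  shows "\<not> solv T e k"
proof
  assume "solv T e k"
  then obtain \<phi> where \<phi>: "labelling T \<phi>" "cost e \<phi> \<le> k" by (auto simp: solv_def)
  obtain t where t: "t \<in> T" using assms(4) by (meson last_in_set)
  define g where "g = (\<lambda>x. if x \<in> T then x else t)"
  have "u \<in> T \<longleftrightarrow> v \<in> T" if "(u, v) \<in> set e" for u v
    using no_kids[OF assms(3), of u v] that by (simp add: dbl_set)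
  then have "cost es g \<le> cost es \<phi>" if "set es \<subseteq> set e" for es
    using that
  proof (induction es)
    case (Cons p es)
    obtain u v where p: "p = (u, v)" by (cases p)
    have "u \<in> T \<longleftrightarrow> v \<in> T" using Cons.prems p by auto
    then have "g u \<noteq> g v \<longrightarrow> \<phi> u \<noteq> \<phi> v" using \<phi>(1) by (auto simp: g_def labelling_def)
    then show ?case using Cons by (auto simp: p cost_Cons)
  qed simp
  then have "cost e g \<le> k" using \<phi>(2) by (meson le_trans order_refl)
  then show False using cands_Nil[OF assms(1,2) t] by (simp add: cost_rename g_def[symmetric])
qed

lemma good_kids_answers:
  assumes "good_kids T n e k cs"
    "if \<exists>(e, k)\<in>set cs. solv T e k then r \<noteq> [] \<and> (\<exists>(e, k)\<in>set cs. answers T n e k r) else r = []"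
  shows "answers T n e k r"
proof (cases "\<exists>(e, k)\<in>set cs. solv T e k")
  case True
  then obtain e' k' where "(e', k') \<in> set cs" "answers T n e' k' r" "r \<noteq> []"
    using assms(2) by auto
  then show ?thesis using assms(1) by (auto simp: good_kids_def intro: answers_deriv)
next
  case False
  then show ?thesis using assms by (auto simp: answers_def good_kids_def)
qed

lemma list_all2_bex: "list_all2 P xs ys \<Longrightarrow> x \<in> set xs \<Longrightarrow> \<exists>y\<in>set ys. P x y"
  by (induction rule: list_all2_induct) auto

lemma sum_list_list_all2:
  fixes f :: "'a \<Rightarrow> real"
  assumes "list_all2 (\<lambda>x y. f x \<le> g y) xs ys" shows "(\<Sum>x\<leftarrow>xs. f x) \<le> (\<Sum>y\<leftarrow>ys. g y)"
  using assms by (induction rule: list_all2_induct) auto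

lemma tBranch_mono: "y \<le> y' \<Longrightarrow> tBranch N y \<le> tBranch N y'"
  unfolding tBranch_def using base(1) by (intro mult_mono power_increasing) auto

lemma solves_within_leaf:
  assumes "distinct ts" "length ts \<le> N" "length e \<le> N" "loops n e"
    and leaf: "k + k < tdeg ts (prep ts ts e) \<or> cands ts ts (prep ts ts e) k \<noteq> []"
  shows "solves_within ts n e k (tNode N)"
proof -
  let ?e = "prep ts ts e"
  note d = deriv_prep[OF assms(4), of ts k]
  have solv: "solv (set ts) ?e k \<longleftrightarrow> solv (set ts) e k"
    using prep[of ts ts e] deriv_solv[OF d] by auto
  have deg: "msum (set ts) ?e = tdeg ts ?e"
    using prep[of ts ts e] by (intro msum_eq_tdeg assms(1)) simp
  have ans: "answers (set ts) n e k r" if "answers (set ts) n ?e k r" for r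
  proof (cases "r = []")
    case True
    then show ?thesis using that solv by (simp add: answers_def split: if_splits)
  qed (rule answers_deriv[OF d that])
  consider "k + k < tdeg ts ?e" | "\<not> k + k < tdeg ts ?e" "cands ts ts ?e k \<noteq> []"
    using leaf by blast
  then show ?thesis
  proof cases
    case 1
    have "\<not> solv (set ts) ?e k" using msum_le_solv[of ts ?e k] 1 deg by auto
    then have "answers (set ts) n e k []" using solv by (simp add: answers_def)
    then show ?thesis
      using fn_solve_large[OF assms(3,2) 1] unfolding solves_within_def by blast
  next
    case 2
    obtain t where t: "t \<in> set ts" "cost (cands ts ts ?e k) id \<le> k"
      "cands ts ts ?e k = rename (\<lambda>x. if x \<in> set ts then x else t) ?e"
      using cands_not_Nil[OF 2(2)] by blast
    define g where "g = (\<lambda>x. if x \<in> set ts then x else t)"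
    have c: "cands ts ts ?e k = rename g ?e" using t(3) by (simp add: g_def)
    have g: "labelling (set ts) g" using t(1) by (simp add: labelling_def g_def)
    moreover have "cost ?e g \<le> k" using t(2) by (simp add: c cost_rename)
    ultimately have "answers (set ts) n ?e k (cands ts ts ?e k)"
      using 2(2) unfolding answers_def solv_def c take_rename by auto
    then show ?thesis
      using fn_solve_cands[OF assms(3,2) 2] ans unfolding solves_within_def by blast
  qed
qed

text \<open>The measure \<open>2 * k - msum\<close> is shifted by 3 so that the children of a node with nonnegative
  measure never fall below zero.\<close>

lemma solves_within:
  assumes "distinct ts" "ts \<noteq> []" "1 \<le> n" "length ts \<le> N"
  shows "length e \<le> N \<Longrightarrow> loops n e \<Longrightarrow> 2 * int k - int (msum (set ts) (prep ts ts e)) + 3 \<le> int y \<Longrightarrow>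
    solves_within ts n e k (tBranch N y)"
proof (induction y arbitrary: e k rule: less_induct)
  case (less y)
  let ?e = "prep ts ts e"
  note d = deriv_prep[OF less.prems(2), of ts k]
  have solv: "solv (set ts) ?e k \<longleftrightarrow> solv (set ts) e k"
    using prep[of ts ts e] deriv_solv[OF d] by auto
  have deg: "msum (set ts) ?e = tdeg ts ?e"
    using prep[of ts ts e] by (intro msum_eq_tdeg assms(1)) simp
  have ans: "answers (set ts) n e k r" if "answers (set ts) n ?e k r" for r
  proof (cases "r = []")
    case True
    then show ?thesis using that solv by (simp add: answers_def split: if_splits)
  qed (rule answers_deriv[OF d that])
  show ?case
  proof (cases "k + k < tdeg ts ?e \<or> cands ts ts ?e k \<noteq> []")
    case True
    have "solves_within ts n e k (tNode N)"
      using assms(1,4) less.prems(1,2) True by (rule solves_within_leaf)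
    then show ?thesis using tNode_le unfolding solves_within_def by (meson le_trans order_trans)
  next
    case False
    then have 3: "\<not> k + k < tdeg ts ?e" "cands ts ts ?e k = []" by auto
    interpret node ts ?e k n using assms(1) less.prems(2) assms(3) 3 by (rule node_prep)
    let ?cs = "kids (dbl ?e) ts ?e k"
    have len: "length ?e \<le> N" using less.prems(1) by simp
    have "msum (set ts) ?e \<le> 2 * k" using deg 3(1) by simp
    then have y3: "3 \<le> y" using less.prems(3) by linarith
    show ?thesis
    proof (cases "?cs = []")
      case True
      have "?e \<noteq> []" using less.prems(2) assms(3) length_prep[of ts ts e]
        by (auto simp: loops_def simp del: length_prep)
      then have "answers (set ts) n e k []"
        using unsolvable_if_no_kids[OF 3(2) _ True assms(2)] solv by (simp add: answers_def)
      moreover have "fn 25 [encV (sing ts), encK ?cs] (encE []) 40" using fn_try_Nil True by simp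
      from fn_solve_kids[OF less.prems(1) assms(4) 3 this]
      have "fn 24 [encV (sing ts), encE e, Atom k] (encE []) (tNode N)"
        by (rule fn_weaken) auto
      ultimately show ?thesis using tNode_le unfolding solves_within_def by blast
    next
      case False
      then have g: "good_kids T n ?e k ?cs" by (rule good_kids)
      then obtain ds where ds: "ds \<in> drops" "list_all2 (kid_drop T ?e k) ?cs ds"
        by (auto simp: good_kids_def)
      \<comment> \<open>Children arrive unprepared. They are measured after their own preparation,
        which by \<open>msum_prep\<close> can only lower the measure; as
        \<open>d \<le> 3 \<le> y\<close>, the index \<open>y - d\<close> below is not
        truncated.\<close>
      define b where "b = (\<lambda>(e', k'). tBranch N (nat (2 * int k' - int (msum T (prep ts ts e')) + 3)))"
      have le: "2 * int k' - int (msum T (prep ts ts e')) + 3 \<le> int (y - d) \<and> 1 \<le> d"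
        if "kid_drop T ?e k (e', k') d" "d \<in> set ds" for e' k' d
      proof -
        have "1 \<le> d" "d \<le> 3" using ds(1) that(2) by (auto simp: drops_def)
        then show ?thesis using that(1) less.prems(3) msum_prep[of ts e'] y3 by (simp add: kid_drop_def of_nat_diff)
      qed
      have child: "solves_within ts n e' k' (b (e', k'))" if ek: "(e', k') \<in> set ?cs" for e' k'
      proof -
        have der: "deriv T n ?e k e' k'" using g ek by (auto simp: good_kids_def)
        obtain d where d: "kid_drop T ?e k (e', k') d" "d \<in> set ds"
          using list_all2_bex[OF ds(2) ek] by blast
        have "nat (2 * int k' - int (msum T (prep ts ts e')) + 3) < y" using le[OF d] y3 by auto
        then have "solves_within ts n e' k' (tBranch N (nat (2 * int k' - int (msum T (prep ts ts e')) + 3)))"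
          using der len by (intro less.IH) (auto simp: deriv_def)
        then show ?thesis by (simp add: b_def)
      qed
      obtain r s where r: "fn 25 [encV (sing ts), encK ?cs] (encE r) s"
        "real s \<le> (\<Sum>c\<leftarrow>?cs. b c) + 40 * (length ?cs + 1)"
        "if \<exists>(e, k)\<in>set ?cs. solv (set ts) e k
          then r \<noteq> [] \<and> (\<exists>(e, k)\<in>set ?cs. answers (set ts) n e k r) else r = []"
        using fn_try[OF child] by blast
      have a: "answers (set ts) n e k r" using ans good_kids_answers[OF g r(3)] by blast
      have "list_all2 (\<lambda>c d. b c \<le> tBranch N (y - d)) ?cs ds"
        using ds(2)
      proof (rule list.rel_mono_strong)
        fix c d assume cd: "c \<in> set ?cs" "d \<in> set ds" "kid_drop T ?e k c d"
        obtain e' k' where c: "c = (e', k')" by (cases c)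
        show "b c \<le> tBranch N (y - d)"
          using le[of e' k' d] cd by (auto simp: b_def c intro!: tBranch_mono)
      qed
      then have "(\<Sum>c\<leftarrow>?cs. b c) \<le> (\<Sum>d\<leftarrow>ds. tBranch N (y - d))" by (rule sum_list_list_all2)
      moreover have "length ?cs \<le> 3" using list_all2_lengthD[OF ds(2)] ds(1) by (auto simp: drops_def)
      moreover have "200 \<le> tNode N" by (simp add: tNode_def)
      ultimately have "real (tNode N + s - 200) \<le> tBranch N y"
        using sum_tBranch[OF ds(1) y3, of N] r(2) by simp
      then show ?thesis
        using fn_solve_kids[OF less.prems(1) assms(4) 3 r(1)] a unfolding solves_within_def by blast
    qed
  qed
qed

text \<open>Unless some cut found by \<open>cands\<close> is small enough, every terminal \<open>t\<close> satisfies
  \<open>k < (\<Sum>s \<noteq> t. dg {s})\<close>; summing over the \<open>p\<close> terminals bounds the initial measure.\<close>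

lemma solves_within_root:
  fixes k :: nat
  assumes "distinct ts" "2 \<le> length ts" "1 \<le> n" "length ts \<le> N" "length e \<le> N" "loops n e"
  defines "y \<equiv> (length ts - 2) * k div (length ts - 1) + 3"
  shows "solves_within ts n e k (tBranch N y)"
proof (cases "k + k < tdeg ts (prep ts ts e) \<or> cands ts ts (prep ts ts e) k \<noteq> []")
  case True
  have "solves_within ts n e k (tNode N)"
    using assms(1,4,5,6) True by (rule solves_within_leaf)
  then show ?thesis using tNode_le unfolding solves_within_def by (meson le_trans order_trans)
next
  case False
  let ?e = "prep ts ts e"
  have nonempty: "?e \<noteq> []" using assms(3,6) length_prep[of ts ts e]
    by (auto simp: loops_def simp del: length_prep)
  have deg: "msum (set ts) ?e = tdeg ts ?e"
    using prep[of ts ts e] by (intro msum_eq_tdeg assms(1)) simp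
  obtain q where q: "length ts = q + 2" using assms(2) by (metis le_add_diff_inverse2)
  have "k + dg ?e {t} \<le> tdeg ts ?e" if "t \<in> set ts" for t
    using cands_Nil[OF _ nonempty that, of ts k] cost_cand_le[OF that, of ?e] False by auto
  then have "(\<Sum>t\<in>set ts. k + dg ?e {t}) \<le> (\<Sum>t\<in>set ts. tdeg ts ?e)" by (rule sum_mono)
  then have "(q + 2) * k + tdeg ts ?e \<le> (q + 2) * tdeg ts ?e"
    using tdeg_eq[OF assms(1), of ?e] distinct_card[OF assms(1)] by (simp add: sum.distrib q)
  then have "(q + 2) * k \<le> (q + 1) * tdeg ts ?e" by simp
  \<comment> \<open>With \<open>q + 2\<close> terminals, subtracting
    \<open>(q + 1) * tdeg ts ?e \<ge> (q + 2) * k\<close> from \<open>2 * (q + 1) * k\<close> leaves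
    at most \<open>q * k\<close>.\<close>
  then have "(2 * k - tdeg ts ?e) * (q + 1) \<le> q * k"
    by (simp add: algebra_simps diff_mult_distrib)
  then have "2 * k - tdeg ts ?e \<le> q * k div (q + 1)"
    using less_eq_div_iff_mult_less_eq[of "q + 1"] by simp
  then have "2 * int k - int (tdeg ts ?e) + 3 \<le> int y" using False by (simp add: y_def q)
  then show ?thesis
    using assms by (intro solves_within) (auto simp: deg)
qed

section \<open>Input and output\<close>

abbreviation enc_edge :: "nat \<times> nat \<times> nat \<Rightarrow> data" where
  "enc_edge \<equiv> \<lambda>(u, v, c). Cell (Atom u) (Cell (Atom v) (Atom c))"

definition expand :: "nat \<Rightarrow> ('a \<times> 'a \<times> nat) list \<Rightarrow> ('a \<times> 'a) list" where
  "expand b es = concat (map (\<lambda>(u, v, c). replicate (min c b) (u, v)) es)"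

lemma fn_rep:
  "fn 26 [Atom c, Atom b, Atom u, Atom v, encE rest] (encE (replicate (min c b) (u, v) @ rest)) (40 * Suc b)"
proof (induction b arbitrary: c)
  case 0
  show ?case
    by (rule fn_run) (erule ev_absurd | rule ev_intros | (auto simp: max_def; fail)[1])+
next
  case (Suc b)
  show ?case
  proof (cases c)
    case 0
    show ?thesis unfolding 0
      by (rule fn_run) (erule ev_absurd | rule ev_intros | (auto simp: max_def; fail)[1])+
  next
    case (Suc d)
    have ih: "fn 26 [Atom (Suc d - 1), Atom (Suc b - 1), Atom u, Atom v, encE rest]
        (encE (replicate (min d b) (u, v) @ rest)) (40 * Suc b)"
      using Suc.IH[of d] by simp
    show ?thesis unfolding Suc
      by (rule fn_run) (erule ev_absurd | rule ev_intros ih | (auto simp: max_def; fail)[1])+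
  qed
qed

lemma fn_expand:
  "fn 27 [enc_list enc_edge es, Atom b] (encE (expand b es)) ((40 * Suc b + 60) * Suc (length es))"
proof (induction es)
  case Nil
  show ?case unfolding enc_simps
    by (rule fn_run) (erule ev_absurd | rule ev_intros | (auto simp: max_def expand_def; fail)[1])+
next
  case (Cons a es)
  obtain u v c where a: "a = (u, v, c)" by (cases a)
  note ih = Cons fn_rep[of c b u v "expand b es"]
  show ?case unfolding a enc_simps prod.case
    by (rule fn_run) (erule ev_absurd | rule ev_intros ih | (auto simp: max_def expand_def; fail)[1])+
qed

lemma fn_loops: "fn 28 [encN vs, encE rest] (encE (map (\<lambda>v. (v, v)) vs @ rest)) (40 * Suc (length vs))"
proof (induction vs)
  case Nil
  show ?case unfolding enc_simps
    by (rule fn_run) (erule ev_absurd | rule ev_intros | (auto simp: max_def; fail)[1])+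
next
  case (Cons v vs)
  show ?case unfolding enc_simps
    by (rule fn_run) (erule ev_absurd | rule ev_intros Cons | (auto simp: max_def; fail)[1])+
qed

lemma fn_sing: "fn 29 [encN ts] (encV (sing ts)) (40 * Suc (length ts))"
proof (induction ts)
  case Nil
  show ?case unfolding enc_simps
    by (rule fn_run) (erule ev_absurd | rule ev_intros | (auto simp: max_def sing_simps; fail)[1])+
next
  case (Cons t ts)
  show ?case unfolding enc_simps
    by (rule fn_run) (erule ev_absurd | rule ev_intros Cons | (auto simp: max_def sing_simps; fail)[1])+
qed

text \<open>The loops stand in the order of \<open>vs\<close>, so both lists are traversed in step
  and no search for a vertex is needed.\<close>

lemma fn_part:
  "fn 30 [Atom t, encN vs, encE (map (\<lambda>v. (\<phi> v, \<phi> v)) vs @ r)] (encN (filter (\<lambda>v. \<phi> v = t) vs))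
     (40 * Suc (length vs))"
proof (induction vs)
  case Nil
  show ?case unfolding enc_simps
    by (rule fn_run) (erule ev_absurd | rule ev_intros | (auto simp: max_def; fail)[1])+
next
  case (Cons v vs)
  show ?case unfolding enc_simps list.map append_Cons
    by (rule fn_run) (erule ev_absurd | rule ev_intros Cons | (auto simp: max_def; fail)[1])+
qed

lemma fn_parts:
  "fn 31 [encN ts, encN vs, encE (map (\<lambda>v. (\<phi> v, \<phi> v)) vs @ r)]
     (enc_list encN (map (\<lambda>t. filter (\<lambda>v. \<phi> v = t) vs) ts)) ((40 * Suc (length vs) + 40) * Suc (length ts))"
proof (induction ts)
  case Nil
  show ?case unfolding enc_simps list.map
    by (rule fn_run) (erule ev_absurd | rule ev_intros | (auto simp: max_def; fail)[1])+
next
  case (Cons t ts)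
  note ih = Cons fn_part[of t vs \<phi> r]
  show ?case unfolding enc_simps list.map
    by (rule fn_run) (erule ev_absurd | rule ev_intros ih | (auto simp: max_def; fail)[1])+
qed

definition tIO :: "nat \<Rightarrow> nat" where
  "tIO N = 400 * Suc N * Suc N"

lemma runs_main:
  fixes vs ts :: "nat list" and es :: "(nat \<times> nat \<times> nat) list"
    and k :: nat
  defines "e \<equiv> map (\<lambda>v. (v, v)) vs @ expand (k + 1) es"
  assumes r: "fn 24 [encV (sing ts), encE e, Atom k] (encE r) s"
    and \<phi>: "r \<noteq> [] \<Longrightarrow> r = map (\<lambda>v. (\<phi> v, \<phi> v)) vs @ r'"
    and le: "length vs \<le> N" "length ts \<le> N" "(k + 2) * Suc (length es) \<le> Suc N * 2"
  shows "fn 0 [Cell (encN vs) (Cell (enc_list enc_edge es) (Cell (encN ts) (Atom k)))]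
    (if r = [] then Atom 0 else Cell (Atom 1) (enc_list encN (map (\<lambda>t. filter (\<lambda>v. \<phi> v = t) vs) ts)))
    (tIO N + s)"
proof -
  define A where "A = Suc N * Suc N"
  have 1: "(40 * Suc (length vs) + 40) * Suc (length ts) \<le> 80 * A"
    unfolding A_def mult.assoc[symmetric] using le by (intro mult_le_mono) auto
  have 2: "(40 * Suc (k + 1) + 60) * Suc (length es) \<le> 80 * ((k + 2) * Suc (length es))"
    unfolding mult.assoc[symmetric] by (intro mult_le_mono) simp_all
  have 3: "Suc N \<le> A" by (simp add: A_def)
  have bound: "40 * Suc (length ts) + ((40 * Suc (k + 1) + 60) * Suc (length es)) + 40 * Suc (length vs)
      + (40 * Suc (length vs) + 40) * Suc (length ts) + 70 \<le> tIO N"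
  proof -
    have "a + b + c + d + 70 \<le> 400 * A"
      if "a \<le> 40 * Suc N" "b \<le> 80 * (Suc N * 2)" "c \<le> 40 * Suc N" "d \<le> 80 * A" for a b c d :: nat
      using that 3 by simp
    from this[OF _ _ _ 1] show ?thesis
      using le 2 unfolding tIO_def A_def mult.assoc by (meson Suc_le_mono le_trans mult_le_mono2)
  qed
  have p: "fn 31 [encN ts, encN vs, encE r]
      (enc_list encN (map (\<lambda>t. filter (\<lambda>v. \<phi> v = t) vs) ts)) ((40 * Suc (length vs) + 40) * Suc (length ts))"
    if "r \<noteq> []" using fn_parts[of ts vs \<phi> r'] \<phi>[OF that] by simp
  note ih = fn_sing[of ts] fn_expand[of es "k + 1"] fn_loops[of vs "expand (k + 1) es"] r[unfolded e_def]
  show ?thesis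
  proof (cases "r = []")
    case True
    have absurd: "is_pair (encE r) \<Longrightarrow> ev env ex (Atom 0) 0" for env ex using True by simp
    show ?thesis
      apply (rule fn_run)
      apply (erule absurd | rule ev_intros ih)+
      using True bound by auto
  next
    case False
    have absurd: "\<not> is_pair (encE r) \<Longrightarrow> ev env ex (Atom 0) 0" for env ex using False by simp
    show ?thesis
      apply (rule fn_run)
      apply (erule absurd | rule ev_intros ih p[OF False])+
      using False bound by auto
  qed
qed

section \<open>Labellings and multiterminal cuts\<close>

definition weight :: "('a \<times> 'a \<times> nat) list \<Rightarrow> ('a \<Rightarrow> 'a) \<Rightarrow> nat" where
  "weight es \<phi> = (\<Sum>(u, v, c)\<leftarrow>es. if \<phi> u \<noteq> \<phi> v then c else 0)"

lemma cost_append: "cost (xs @ ys) \<phi> = cost xs \<phi> + cost ys \<phi>"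
  by (simp add: cost_def)

lemma cost_loops: "cost (map (\<lambda>v. (v, v)) vs) \<phi> = 0"
  by (simp add: cost_def filter_empty_conv)

text \<open>Capping each multiplicity at \<open>b\<close> changes a sum only if it reaches
  \<open>b\<close> anyway. With \<open>b = k + 1\<close> the comparison with \<open>k\<close> is
  unaffected.\<close>

lemma min_cost_expand: "min (cost (expand b es) \<phi>) b = min (weight es \<phi>) b"
proof (induction es)
  case Nil
  show ?case by (simp add: expand_def weight_def)
next
  case (Cons a es)
  obtain u v c where a: "a = (u, v, c)" by (cases a)
  have "cost (replicate m (u, v)) \<phi> = (if \<phi> u \<noteq> \<phi> v then m else 0)" for m by (simp add: cost_def)
  then have "cost (expand b (a # es)) \<phi> = (if \<phi> u \<noteq> \<phi> v then min c b else 0) + cost (expand b es) \<phi>"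
    by (simp add: expand_def cost_append a)
  moreover have "weight (a # es) \<phi> = (if \<phi> u \<noteq> \<phi> v then c else 0) + weight es \<phi>"
    by (simp add: weight_def a)
  ultimately show ?case using Cons by (auto simp: min_def split: if_splits)
qed

lemma cost_expand_le_iff: "cost (expand (k + 1) es) \<phi> \<le> k \<longleftrightarrow> weight es \<phi> \<le> k"
  using min_cost_expand[of "k + 1" es \<phi>] by (auto simp: min_def split: if_splits)

lemma length_expand: "length (expand b es) \<le> length es * b"
  by (induction es) (auto simp: expand_def)

definition classes :: "'a set \<Rightarrow> 'a list \<Rightarrow> ('a \<Rightarrow> 'a) \<Rightarrow> 'a set list" where
  "classes V ts \<phi> = map (\<lambda>t. {v \<in> V. \<phi> v = t}) ts"

lemma cut_size_classes:
  assumes es: "distinct (map (\<lambda>(u, v, c). {u, v}) es)" "set (map (\<lambda>(u, v, c). {u, v}) es) = E"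
      "\<forall>(u, v, c) \<in> set es. c = w {u, v}"
    and E: "\<And>e. e \<in> E \<Longrightarrow> e \<subseteq> V" and \<phi>: "labelling (set ts) \<phi>"
  shows "cut_size E w (classes V ts \<phi>) = weight es \<phi>"
proof -
  define crosses where "crosses e \<longleftrightarrow> (\<exists>X\<in>set (classes V ts \<phi>). \<exists>Y\<in>set (classes V ts \<phi>).
    X \<noteq> Y \<and> e \<inter> X \<noteq> {} \<and> e \<inter> Y \<noteq> {})" for e
  have cr: "crosses {u, v} \<longleftrightarrow> \<phi> u \<noteq> \<phi> v" if "{u, v} \<subseteq> V" for u v
  proof
    assume "crosses {u, v}"
    then show "\<phi> u \<noteq> \<phi> v" by (auto simp: crosses_def classes_def)
  next
    assume ne: "\<phi> u \<noteq> \<phi> v"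
    have "\<phi> u \<in> set ts" "\<phi> v \<in> set ts" using \<phi> by (auto simp: labelling_def)
    moreover have "{x \<in> V. \<phi> x = \<phi> u} \<noteq> {x \<in> V. \<phi> x = \<phi> v}" using that ne by auto
    ultimately show "crosses {u, v}" using that unfolding crosses_def classes_def by fastforce
  qed
  have fin: "finite E" using es(2) by (metis List.finite_set)
  have "cut_size E w (classes V ts \<phi>) = (\<Sum>e\<in>{e \<in> E. crosses e}. w e)"
    by (simp add: cut_size_def crosses_def)
  also have "\<dots> = (\<Sum>e\<in>E. if crosses e then w e else 0)"
    using fin by (simp add: sum.inter_filter)
  also have "\<dots> = sum_list (map (\<lambda>e. if crosses e then w e else 0) (map (\<lambda>(u, v, c). {u, v}) es))"
    using sum.distinct_set_conv_list[OF es(1)] es(2) by simp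
  also have "\<dots> = (\<Sum>(u, v, c)\<leftarrow>es. if \<phi> u \<noteq> \<phi> v then c else 0)"
    unfolding map_map
  proof (intro arg_cong[where f = sum_list] map_cong refl)
    fix x assume x: "x \<in> set es"
    obtain u v c where uvc: "x = (u, v, c)" by (cases x)
    have "{u, v} \<in> E" using x es(2) uvc by force
    then have "crosses {u, v} \<longleftrightarrow> \<phi> u \<noteq> \<phi> v" using E by (intro cr) blast
    moreover have "c = w {u, v}" using x es(3) uvc by auto
    ultimately show "((\<lambda>e. if crosses e then w e else 0) \<circ> (\<lambda>(u, v, c). {u, v})) x
        = (case x of (u, v, c) \<Rightarrow> if \<phi> u \<noteq> \<phi> v then c else 0)"
      by (simp add: uvc)
  qed
  finally show ?thesis by (simp add: weight_def)
qed

lemma multiterminal_cut_classes: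
  assumes "distinct ts" "set ts \<subseteq> V" "labelling (set ts) \<phi>"
  shows "multiterminal_cut V ts (classes V ts \<phi>)"
proof -
  have t: "t \<in> {v \<in> V. \<phi> v = t}" if "t \<in> set ts" for t
    using assms that by (auto simp: labelling_def)
  have "inj_on (\<lambda>t. {v \<in> V. \<phi> v = t}) (set ts)"
  proof (rule inj_onI)
    fix x y assume "x \<in> set ts" "y \<in> set ts" "{v \<in> V. \<phi> v = x} = {v \<in> V. \<phi> v = y}"
    then have "y \<in> {v \<in> V. \<phi> v = x}" "\<phi> y = y" using t[of y] by auto
    then show "x = y" by simp
  qed
  moreover have "partition_on V (set (classes V ts \<phi>))"
  proof (rule partition_onI)
    show "\<Union>(set (classes V ts \<phi>)) = V" using assms(3) by (auto simp: classes_def labelling_def)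
    show "disjnt X Y" if "X \<in> set (classes V ts \<phi>)" "Y \<in> set (classes V ts \<phi>)" "X \<noteq> Y" for X Y
      using that by (auto simp: classes_def disjnt_def)
    have "X \<noteq> {}" if "X \<in> set (classes V ts \<phi>)" for X using that t by (auto simp: classes_def)
    then show "{} \<notin> set (classes V ts \<phi>)" by blast
  qed
  ultimately show ?thesis
    using assms(1) t by (auto simp: multiterminal_cut_def classes_def distinct_map)
qed

lemma multiterminal_cut_labelling:
  assumes cut: "multiterminal_cut V ts Vs" and ts: "ts \<noteq> []"
  obtains \<phi> where "labelling (set ts) \<phi>" "Vs = classes V ts \<phi>"
proof -
  have len: "length Vs = length ts" and dist: "distinct Vs" and part: "partition_on V (set Vs)"
    and t: "\<And>i. i < length ts \<Longrightarrow> ts ! i \<in> Vs ! i"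
    using cut by (auto simp: multiterminal_cut_def)
  have uniq: "i = j" if "i < length ts" "j < length ts" "x \<in> Vs ! i" "x \<in> Vs ! j" for i j x
  proof -
    have "Vs ! i \<in> set Vs" "Vs ! j \<in> set Vs" "Vs ! i \<inter> Vs ! j \<noteq> {}" using that len by auto
    then have "Vs ! i = Vs ! j" using partition_onD2[OF part] unfolding disjoint_def by metis
    then show ?thesis using that dist len by (simp add: nth_eq_iff_index_eq)
  qed
  have ex: "\<exists>i<length ts. x \<in> Vs ! i" if "x \<in> V" for x
    using that partition_onD1[OF part] len by (auto simp: in_set_conv_nth)
  have sub: "Vs ! i \<subseteq> V" if "i < length ts" for i
    using that partition_onD1[OF part] len by auto
  \<comment> \<open>A labelling is total, so names outside \<open>V\<close> are sent to the first
    terminal, which exists because \<open>ts\<close> is nonempty.\<close>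
  define \<phi> where "\<phi> x = (if x \<in> V then ts ! (THE i. i < length ts \<and> x \<in> Vs ! i) else ts ! 0)" for x
  have \<phi>: "\<phi> x = ts ! i" if "i < length ts" "x \<in> Vs ! i" for i x
  proof -
    have "(THE i. i < length ts \<and> x \<in> Vs ! i) = i" using that uniq by (intro the_equality) auto
    then show ?thesis using that sub by (auto simp: \<phi>_def)
  qed
  have "labelling (set ts) \<phi>" unfolding labelling_def
  proof (intro conjI ballI allI)
    show "\<phi> s = s" if "s \<in> set ts" for s using that \<phi> t by (metis in_set_conv_nth)
    show "\<phi> x \<in> set ts" for x
    proof (cases "x \<in> V")
      case True
      then show ?thesis using ex[OF True] \<phi> by (metis nth_mem)
    qed (use ts in \<open>simp add: \<phi>_def\<close>)
  qed
  moreover have "Vs = classes V ts \<phi>"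
  proof (rule nth_equalityI)
    show "length Vs = length (classes V ts \<phi>)" by (simp add: classes_def len)
    fix i assume "i < length Vs"
    then have i: "i < length ts" by (simp add: len)
    have "x \<in> Vs ! i \<longleftrightarrow> x \<in> V \<and> \<phi> x = ts ! i" for x
    proof
      assume "x \<in> V \<and> \<phi> x = ts ! i"
      then obtain j where j: "j < length ts" "x \<in> Vs ! j" "ts ! j = ts ! i"
        using ex \<phi> by metis
      then have "ts ! i \<in> Vs ! j" using t by metis
      then have "i = j" using uniq[OF i j(1)] t[OF i] by simp
      then show "x \<in> Vs ! i" using j by simp
    qed (use i sub \<phi> in blast)
    then show "Vs ! i = classes V ts \<phi> ! i" using i by (auto simp: classes_def)
  qed
  ultimately show thesis using that by blast
qed

section \<open>The time bound\<close>

text \<open>The base \<open>Suc N\<close> is at least 1, so raising the exponent only enlarges the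
  bound, including at \<open>N = 0\<close>.\<close>

definition polyb :: "(nat \<Rightarrow> nat) \<Rightarrow> bool" where
  "polyb f \<longleftrightarrow> (\<exists>C d. \<forall>N. f N \<le> C * Suc N ^ d)"

lemma polyb_const: "polyb (\<lambda>N. c)"
  unfolding polyb_def by (intro exI[of _ c] exI[of _ 0]) simp

lemma polyb_id: "polyb (\<lambda>N. N)"
  unfolding polyb_def by (intro exI[of _ 1]) simp

lemma polyb_mult:
  assumes "polyb f" "polyb g" shows "polyb (\<lambda>N. f N * g N)"
proof -
  obtain C d C' d' where "\<And>N. f N \<le> C * Suc N ^ d" "\<And>N. g N \<le> C' * Suc N ^ d'"
    using assms by (auto simp: polyb_def)
  then have "f N * g N \<le> (C * Suc N ^ d) * (C' * Suc N ^ d')" for N by (intro mult_le_mono)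
  then have "f N * g N \<le> (C * C') * Suc N ^ (d + d')" for N by (simp add: power_add mult_ac)
  then show ?thesis unfolding polyb_def by blast
qed

lemma polyb_add:
  assumes "polyb f" "polyb g" shows "polyb (\<lambda>N. f N + g N)"
proof -
  obtain C d C' d' where *: "\<And>N. f N \<le> C * Suc N ^ d" "\<And>N. g N \<le> C' * Suc N ^ d'"
    using assms by (auto simp: polyb_def)
  have "f N + g N \<le> (C + C') * Suc N ^ (d + d')" for N
  proof -
    have "C * Suc N ^ d \<le> C * Suc N ^ (d + d')" "C' * Suc N ^ d' \<le> C' * Suc N ^ (d + d')"
      by (intro mult_le_mono2 power_increasing; simp)+
    with *[of N] have "f N \<le> C * Suc N ^ (d + d')" "g N \<le> C' * Suc N ^ (d + d')"
      by (meson le_trans)+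
    then show ?thesis unfolding add_mult_distrib by (rule add_le_mono)
  qed
  then show ?thesis unfolding polyb_def by blast
qed

lemma polyb_Suc: "polyb f \<Longrightarrow> polyb (\<lambda>N. Suc (f N))"
  using polyb_add[OF _ polyb_const[of 1], of f] by simp

lemmas polyb_intros = polyb_const polyb_id polyb_mult polyb_add polyb_Suc

lemma polyb_tIO: "polyb tIO" and polyb_tNode: "polyb tNode"
  unfolding tIO_def[abs_def] tNode_def[abs_def] tKids_def tCand_def tThree_def tPick_def tTwo_def tCands_def
    tPrep_def tRen_def tCutv_def tFlow_def tAug_def tSat_def tGrow_def tLook_def tLin_def bV_def
  by (intro polyb_intros)+

text \<open>Induction on \<open>d\<close> splits \<open>g\<close> into two square roots: one takes
  care of a single factor \<open>real k + 4\<close> by Bernoulli's inequality, the other of the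
  remaining power.\<close>

lemma power_le_exponential: "1 < g \<Longrightarrow> \<exists>C>0. \<forall>k::nat. (real k + 4) ^ d \<le> C * g ^ k"
proof (induction d arbitrary: g)
  case 0
  then show ?case by (intro exI[of _ 1]) (auto intro: one_le_power less_imp_le)
next
  case (Suc d)
  define h where "h = sqrt g"
  have h: "1 < h" "h * h = g" using Suc.prems by (auto simp: h_def)
  obtain C where C: "0 < C" "\<And>k::nat. (real k + 4) ^ d \<le> C * h ^ k" using Suc.IH[OF h(1)] by blast
  \<comment> \<open>The summand 4 covers the constant term of \<open>real k + 4\<close>, and
    \<open>1 / (h - 1)\<close> turns the slope \<open>h - 1\<close> in Bernoulli's inequality into
    1.\<close>
  define D where "D = 4 + 1 / (h - 1)"
  have D: "0 < D" using h(1) by (simp add: D_def add_pos_nonneg)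
  have "real k + 4 \<le> D * h ^ k" for k
  proof -
    have "D * (1 + real k * (h - 1)) = real k + 4 + (4 * real k * (h - 1) + 1 / (h - 1))"
      using h(1) by (simp add: D_def field_simps)
    then have "real k + 4 \<le> D * (1 + real k * (h - 1))" using h(1) by simp
    also have "1 + real k * (h - 1) \<le> h ^ k" using Bernoulli_inequality[of "h - 1" k] h(1) by simp
    finally show ?thesis using D by simp
  qed
  then have "(real k + 4) * (real k + 4) ^ d \<le> (D * h ^ k) * (C * h ^ k)" for k
    using C D h(1) by (intro mult_mono) auto
  then have "(real k + 4) ^ Suc d \<le> (D * C) * g ^ k" for k
    by (simp add: mult_ac flip: h(2)) (simp add: power_mult_distrib mult_ac)
  then show ?case using C(1) D by (intro exI[of _ "D * C"]) auto
qed

text \<open>Since \<open>N\<close> grows with \<open>k\<close>, the node cost contributes a power of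
  \<open>k\<close>. It is absorbed by the ratio of \<open>1.84\<close> to \<open>base\<close>,
  raised to an exponent that is at least \<open>k / 2\<close> because
  \<open>p \<ge> 3\<close>.\<close>

lemma time_bound:
  obtains c where "\<And>p k n N y. 3 \<le> p \<Longrightarrow> p \<le> n \<Longrightarrow> N = n ^ 2 * (k + 2) \<Longrightarrow>
    y = (p - 2) * k div (p - 1) + 3 \<Longrightarrow>
    real (tIO N) + tBranch N y \<le> 1.84 powr ((real p - 2) * real k / (real p - 1)) * real n ^ c"
proof -
  obtain C d where poly: "\<And>N. tIO N + tNode N \<le> C * Suc N ^ d"
    using polyb_add[OF polyb_tIO polyb_tNode] by (auto simp: polyb_def)
  \<comment> \<open>The square root matches the lower bound \<open>k / 2\<close> for the exponent
    \<open>x\<close>.\<close>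
  define g :: real where "g = (1.84 / base) powr (1 / 2)"
  have "1 < g" by (simp add: g_def base_def)
  then obtain D where D: "0 < D" "\<And>k::nat. (real k + 4) ^ (d + 1) \<le> D * g ^ k"
    using power_le_exponential[of g "d + 1"] by blast
  \<comment> \<open>Since \<open>n \<ge> 2\<close>, the constant factor can be moved into the
    exponent of \<open>n\<close>.\<close>
  obtain m where m: "real C * base ^ 3 * D \<le> 2 ^ m"
    using real_arch_pow[of 2 "real C * base ^ 3 * D"] by (auto intro: less_imp_le)
  have "real (tIO N) + tBranch N y \<le> 1.84 powr ((real p - 2) * real k / (real p - 1)) * real n ^ (2 * d + m)"
    if p: "3 \<le> p" "p \<le> n" and N: "N = n ^ 2 * (k + 2)" and y: "y = (p - 2) * k div (p - 1) + 3"
    for p k n N y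
  proof -
    define z where "z = (p - 2) * k div (p - 1)"
    define x where "x = (real p - 2) * real k / (real p - 1)"
    have zx: "real z \<le> x"
    proof -
      have "real z \<le> real ((p - 2) * k) / real (p - 1)"
        unfolding z_def by (rule of_nat_div_le_of_nat)
      then show ?thesis using p by (simp add: x_def of_nat_diff)
    qed
    have "(p - 2) * k \<le> (p - 1) * k" by (intro mult_le_mono diff_le_mono2) auto
    then have "z \<le> (p - 1) * k div (p - 1)" unfolding z_def by (rule div_le_mono)
    then have zk: "z \<le> k" using p by simp
    have xk: "real k / 2 \<le> x"
    proof -
      have "real k * (real p - 1) \<le> 2 * ((real p - 2) * real k)"
        using p mult_left_mono[of 3 "real p" "real k"] by (simp add: algebra_simps)
      then show ?thesis using p by (simp add: x_def field_simps)
    qed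
    have "1 \<le> real (y + 1) * base ^ y"
      using mult_mono[of 1 "real (y + 1)" 1 "base ^ y"] base(1) by simp
    then have "real (tIO N) * 1 \<le> real (tIO N) * (real (y + 1) * base ^ y)"
      by (intro mult_left_mono) auto
    then have "real (tIO N) + tBranch N y \<le> real (tIO N + tNode N) * (real (y + 1) * base ^ y)"
      by (simp add: tBranch_def algebra_simps)
    also have "real (tIO N + tNode N) \<le> real (C * Suc N ^ d)" using poly by (intro of_nat_mono)
    also have "Suc N \<le> n ^ 2 * (k + 4)"
    proof -
      have "1 \<le> n ^ 2" using p by simp
      then show ?thesis unfolding N by (simp add: algebra_simps)
    qed
    also have "real (C * (n ^ 2 * (k + 4)) ^ d) = real C * real n ^ (2 * d) * (real k + 4) ^ d"
      by (simp add: power_mult_distrib power_mult)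
    also have "real (y + 1) \<le> real k + 4" using zk by (simp add: y z_def)
    also have "base ^ y = base ^ 3 * base powr real z"
      using base(1) by (simp add: y z_def power_add powr_realpow)
    also have "base powr real z \<le> base powr x" using zx base(1) by (intro powr_mono)
    also have "real C * real n ^ (2 * d) * (real k + 4) ^ d * ((real k + 4) * (base ^ 3 * base powr x))
        = real C * base ^ 3 * real n ^ (2 * d) * base powr x * (real k + 4) ^ (d + 1)"
      by simp
    also have "(real k + 4) ^ (d + 1) \<le> D * g ^ k" by (rule D(2))
    also have "g ^ k = (1.84 / base) powr (real k / 2)"
      using base(1) by (simp add: g_def powr_powr flip: powr_realpow)
    also have "\<dots> \<le> (1.84 / base) powr x" using xk by (intro powr_mono) (auto simp: base_def)
    also have "real C * base ^ 3 * real n ^ (2 * d) * base powr x * (D * (1.84 / base) powr x)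
        = (real C * base ^ 3 * D) * real n ^ (2 * d) * (base powr x * (1.84 / base) powr x)"
      by simp
    also have "base powr x * (1.84 / base) powr x = 1.84 powr x"
      using base(1) by (simp flip: powr_mult)
    also have "real C * base ^ 3 * D \<le> real n ^ m"
      using m power_mono[of 2 "real n" m] p by simp
    also have "real n ^ m * real n ^ (2 * d) * 1.84 powr x = 1.84 powr x * real n ^ (2 * d + m)"
      by (simp add: power_add)
    also note final = calculation
    have b0: "0 \<le> base" and D0: "0 \<le> D" using base(1) D(1) by auto
    show ?thesis unfolding x_def[symmetric]
      by (rule final; intro mult_left_mono mult_right_mono of_nat_mono mult_le_mono2 power_mono
          mult_nonneg_nonneg zero_le_power powr_ge_zero; simp add: b0 D0)
  qed
  then show thesis by (rule that)
qed

section \<open>From encoded instances to runs of the program\<close>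

lemma card_edges_le:
  assumes "finite V" "\<And>e. e \<in> E \<Longrightarrow> e \<subseteq> V \<and> card e = 2" shows "card E \<le> card V ^ 2"
proof -
  have "E \<subseteq> (\<lambda>(u, v). {u, v}) ` (V \<times> V)"
  proof
    fix e assume "e \<in> E"
    then obtain u v where "e = {u, v}" "e \<subseteq> V" using assms(2) by (meson card_2_iff)
    then show "e \<in> (\<lambda>(u, v). {u, v}) ` (V \<times> V)" by auto
  qed
  then have "card E \<le> card ((\<lambda>(u, v). {u, v}) ` (V \<times> V))" using assms(1) by (intro card_mono) auto
  also have "\<dots> \<le> card (V \<times> V)" using assms(1) by (intro card_image_le) auto
  finally have "card E \<le> card (V \<times> V)" .
  then show ?thesis by (simp add: card_cartesian_product power2_eq_square)
qed

lemma solves_instance: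
  assumes I: "terminal_cut_instance p V E w ts" and x: "encodes_instance V E w ts k x" and p: "3 \<le> p"
    and N: "N = card V ^ 2 * (k + 2)" and y: "y = (p - 2) * k div (p - 1) + 3"
  shows "\<exists>r t. runs prog x r t \<and> correct_answer V E w ts k r \<and> real t \<le> real (tIO N) + tBranch N y"
proof -
  obtain vs es where vs: "distinct vs" "set vs = V"
    and es: "distinct (map (\<lambda>(u, v, c). {u, v}) es)" "set (map (\<lambda>(u, v, c). {u, v}) es) = E"
      "\<forall>(u, v, c) \<in> set es. c = w {u, v}"
    and xe: "x = Cell (encN vs) (Cell (enc_list enc_edge es) (Cell (encN ts) (Atom k)))"
    using x by (auto simp: encodes_instance_def)
  have fin: "finite V" and E: "\<And>e. e \<in> E \<Longrightarrow> e \<subseteq> V \<and> card e = 2"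
    and ts: "length ts = p" "distinct ts" "set ts \<subseteq> V"
    using I by (auto simp: terminal_cut_instance_def simple_graph_def)
  define n where "n = card V"
  have n: "length vs = n" using vs distinct_card by (metis n_def)
  have pn: "p \<le> n" using ts fin card_mono distinct_card unfolding n_def by metis
  have les: "length es \<le> n ^ 2"
    using card_edges_le[of V E, OF fin E] distinct_card[OF es(1)] unfolding es(2) by (simp add: n_def)
  define e where "e = map (\<lambda>v. (v, v)) vs @ expand (k + 1) es"
  have nn: "n \<le> n ^ 2" by (simp add: power2_eq_square)
  have "length e \<le> n + length es * (k + 1)" using length_expand[of "k + 1" es] by (simp add: e_def n)
  also have "\<dots> \<le> n ^ 2 + n ^ 2 * (k + 1)" using nn les by (intro add_mono mult_le_mono) auto
  finally have lN: "length e \<le> N" by (simp add: N n_def)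
  have nN: "n \<le> N"
  proof -
    have "n ^ 2 * 1 \<le> n ^ 2 * (k + 2)" by (intro mult_le_mono) auto
    then show ?thesis using nn by (simp add: N n_def)
  qed
  have taken: "take n e = map (\<lambda>v. (v, v)) vs" by (simp add: e_def n)
  have loops: "loops n e" unfolding loops_def taken by (auto simp: e_def n)
  have "solves_within ts n e k (tBranch N ((length ts - 2) * k div (length ts - 1) + 3))"
    using ts p pn nN lN loops by (intro solves_within_root) auto
  then obtain r s where r: "fn 24 [encV (sing ts), encE e, Atom k] (encE r) s"
    "answers (set ts) n e k r" "real s \<le> tBranch N y"
    by (auto simp: solves_within_def y ts(1))
  have cost: "cost e \<phi> \<le> k \<longleftrightarrow> cut_size E w (classes V ts \<phi>) \<le> k" if "labelling (set ts) \<phi>" for \<phi>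
    using cut_size_classes[OF es _ that, of V] E cost_expand_le_iff[of k es \<phi>]
    by (simp add: e_def cost_append cost_loops)
  have solv: "solv (set ts) e k \<longleftrightarrow> (\<exists>Vs. multiterminal_cut V ts Vs \<and> cut_size E w Vs \<le> k)"
  proof
    assume "solv (set ts) e k"
    then show "\<exists>Vs. multiterminal_cut V ts Vs \<and> cut_size E w Vs \<le> k"
      using multiterminal_cut_classes[OF ts(2,3)] cost by (auto simp: solv_def)
  next
    assume "\<exists>Vs. multiterminal_cut V ts Vs \<and> cut_size E w Vs \<le> k"
    then obtain Vs where Vs: "multiterminal_cut V ts Vs" "cut_size E w Vs \<le> k" by blast
    have "ts \<noteq> []" using ts(1) p by auto
    then obtain \<phi> where "labelling (set ts) \<phi>" "Vs = classes V ts \<phi>"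
      using multiterminal_cut_labelling[OF Vs(1)] by blast
    then show "solv (set ts) e k" using cost Vs(2) by (auto simp: solv_def)
  qed
  obtain \<phi> where \<phi>: "r \<noteq> [] \<Longrightarrow> labelling (set ts) \<phi> \<and> cost e \<phi> \<le> k \<and> take n r = rename \<phi> (take n e)"
    using r(2) by (cases "r = []") (auto simp: answers_def split: if_splits)
  have split: "r = map (\<lambda>v. (\<phi> v, \<phi> v)) vs @ drop n r" if "r \<noteq> []"
  proof -
    have "take n r = map (\<lambda>v. (\<phi> v, \<phi> v)) vs" using \<phi>[OF that] by (simp add: taken rename_def)
    then show ?thesis by (metis append_take_drop_id)
  qed
  define a where "a = (if r = [] then Atom 0
    else Cell (Atom 1) (enc_list encN (map (\<lambda>t. filter (\<lambda>v. \<phi> v = t) vs) ts)))"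
  have "(k + 2) * Suc (length es) \<le> (k + 2) * Suc (n ^ 2)" using les by (intro mult_le_mono) auto
  also have "\<dots> \<le> N + N"
  proof -
    have "1 \<le> n ^ 2" using p pn by simp
    then have "(k + 2) * 1 \<le> (k + 2) * n ^ 2" by (rule mult_le_mono2)
    then show ?thesis by (simp add: N n_def algebra_simps)
  qed
  finally have "(k + 2) * Suc (length es) \<le> Suc N * 2" by simp
  then have "fn 0 [x] a (tIO N + s)"
    unfolding xe a_def using r(1) split nN n pn ts(1) unfolding e_def
    by (intro runs_main[where r' = "drop n r"]) auto
  then obtain t where t: "runs prog x a t" "t \<le> tIO N + s"
    by (auto simp: fn_def ev_def runs_def prog_def)
  have "correct_answer V E w ts k a"
  proof (cases "r = []")
    case True
    then have "\<not> solv (set ts) e k" using r(2) by (auto simp: answers_def)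
    then show ?thesis using solv True by (simp add: correct_answer_def a_def)
  next
    case False
    let ?Ls = "map (\<lambda>t. filter (\<lambda>v. \<phi> v = t) vs) ts"
    have "map set ?Ls = classes V ts \<phi>" by (auto simp: classes_def vs(2)[symmetric])
    moreover have "multiterminal_cut V ts (classes V ts \<phi>)" "cut_size E w (classes V ts \<phi>) \<le> k"
      using \<phi>[OF False] multiterminal_cut_classes[OF ts(2,3)] cost[of \<phi>] by simp_all
    ultimately show ?thesis
      using False unfolding correct_answer_def a_def by (intro disjI2 exI[of _ ?Ls]) simp
  qed
  then show ?thesis using t r(3) by (intro exI[of _ a] exI[of _ t]) auto
qed

theorem theorem2:
  "(\<exists>P c. solves_terminal_cut_within 3 P (\<lambda>k n. 1.36 ^ k * real n ^ c)) \<and>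
   (\<forall>p\<ge>3. \<exists>P c. solves_terminal_cut_within p P
      (\<lambda>k n. 1.84 powr ((real p - 2) * real k / (real p - 1)) * real n ^ c))"
proof -
  obtain c where c: "\<And>p k n N y. 3 \<le> p \<Longrightarrow> p \<le> n \<Longrightarrow> N = n ^ 2 * (k + 2) \<Longrightarrow>
    y = (p - 2) * k div (p - 1) + 3 \<Longrightarrow>
    real (tIO N) + tBranch N y \<le> 1.84 powr ((real p - 2) * real k / (real p - 1)) * real n ^ c"
    using time_bound by blast
  have general: "solves_terminal_cut_within p prog
      (\<lambda>k n. 1.84 powr ((real p - 2) * real k / (real p - 1)) * real n ^ c)" if "3 \<le> p" for p
    unfolding solves_terminal_cut_within_def
  proof (intro allI impI)
    fix V E w ts k x
    assume I: "terminal_cut_instance p V E w ts" and x: "encodes_instance V E w ts k x"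
    have "p \<le> card V"
      using I card_mono distinct_card unfolding terminal_cut_instance_def simple_graph_def by metis
    from c[OF that this refl refl, of k] solves_instance[OF I x that refl refl]
    show "\<exists>y t. runs prog x y t \<and> correct_answer V E w ts k y \<and>
        real t \<le> 1.84 powr ((real p - 2) * real k / (real p - 1)) * real (card V) ^ c"
      by (meson order_trans)
  qed
  have "1.84 powr ((real 3 - 2) * real k / (real 3 - 1)) \<le> 1.36 ^ k" for k
  proof -
    \<comment> \<open>For \<open>p = 3\<close> the exponent is \<open>k / 2\<close>, so the base
      becomes the square root of \<open>1.84\<close>, about \<open>1.3565\<close>.\<close>
    have "sqrt 1.84 \<le> 1.36" by (rule real_le_lsqrt) (simp_all add: power2_eq_square)
    then have "(1.84::real) powr (1 / 2) \<le> 1.36" by (simp add: powr_half_sqrt)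
    then have "(1.84 powr (1 / 2)) ^ k \<le> (1.36::real) ^ k" by (intro power_mono) auto
    then show ?thesis by (simp add: powr_powr flip: powr_realpow)
  qed
  then have "1.84 powr ((real 3 - 2) * real k / (real 3 - 1)) * real n ^ c \<le> 1.36 ^ k * real n ^ c" for k n
    by (intro mult_right_mono) auto
  then have "solves_terminal_cut_within 3 prog (\<lambda>k n. 1.36 ^ k * real n ^ c)"
    using general[OF order_refl] unfolding solves_terminal_cut_within_def by (meson order_trans)
  with general show ?thesis by blast
qed

end
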